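(* Let $v^\varepsilon\in L^2(0,T;L^2(\Omega_M^\varepsilon))$ be a sequence of functions satisfying $$\frac1{\sqrt\varepsilon}\|v^\varepsilon\|_{L^2(0,T;L^2(\Omega_M^\varepsilon))}\le C$$ for some constant $C>0$ independent of $\varepsilon$. Then there is $v^0\in L^2((0,T)\times\Sigma\times\mathcal T\times Y\times Z)$ such that, up to a subsequence (still denoted $v^\varepsilon$), $v^\varepsilon$ multi-scale converges to $v^0$, i.e. $$\lim_{\varepsilon\to0}\frac1\varepsilon\int_0^T\int_{\Omega_M^\varepsilon}v^\varepsilon(t,x)\,\phi\Big(t,\bar x,\frac t\varepsilon,\frac x\varepsilon,\frac{x_2}{\varepsilon^2}\Big)dx\,dt=\int_0^T\int_\Sigma\int_{\mathcal T}\int_Y\int_Zv^0(t,\bar x,\tau,y,z)\,\phi(t,\bar x,\tau,y,z)\,dz\,dy\,d\tau\,d\bar x\,dt$$ for all $\phi\in L^2((0,T)\times\Sigma;\mathcal C_\sharp(\overline{\mathcal T\times Y\times Z}))$.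
   Context: Let $h,T>0$; $\varepsilon>0$ ranges over a sequence tending to $0$ with $h=N\varepsilon$ for some $N\in\mathbb N$. $\Omega_M^\varepsilon=(-\varepsilon/2,\varepsilon/2)\times(0,h)$, $\Sigma=\{0\}\times(0,h)$ (identified with $(0,h)$), $\bar x=(0,x_2)$ for $x=(x_1,x_2)$. $Y=(-\tfrac12,\tfrac12)\times(0,1)$, $\mathcal T=Z=(0,1)$. $\mathcal C_\sharp(\overline{\mathcal T\times Y\times Z})$ is the space of continuous functions $v(\tau,y,z)$ on $\overline{\mathcal T\times Y\times Z}$ that are periodic in $\tau$, $y_2$ and $z$ (and are extended periodically in these variables). *)

theory Defs
  imports "HOL-Analysis.Analysis"
begin

text \<open>Elements of Lebesgue spaces are represented by functions rather than by equivalence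
  classes; the norms below are therefore only seminorms on functions.\<close>

definition L2_space :: "'a::euclidean_space set \<Rightarrow> ('a \<Rightarrow> real) set" where
  "L2_space S = {f \<in> borel_measurable (lebesgue_on S).
     integrable (lebesgue_on S) (\<lambda>x. (f x)\<^sup>2)}"

definition L2_norm :: "'a::euclidean_space set \<Rightarrow> ('a \<Rightarrow> real) \<Rightarrow> real" where
  "L2_norm S f = sqrt (LINT x|lebesgue_on S. (f x)\<^sup>2)"

text \<open>The Bochner space of square integrable functions on \<open>S\<close> with values in a space \<open>X\<close> of
  real functions with (semi)norm \<open>nrm\<close>.  Strong measurability means being, almost everywhere,
  the limit with respect to \<open>nrm\<close> of a sequence of \<open>X\<close>-valued simple functions.\<close>

definition strongly_measurable ::
  "'a measure \<Rightarrow> ('b \<Rightarrow> real) set \<Rightarrow> (('b \<Rightarrow> real) \<Rightarrow> real) \<Rightarrow> ('a \<Rightarrow> 'b \<Rightarrow> real) \<Rightarrow> bool" where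
  "strongly_measurable M X nrm f \<longleftrightarrow>
     (\<exists>s. (\<forall>n::nat. simple_function M (s n) \<and> s n ` space M \<subseteq> X) \<and>
          (AE a in M. (\<lambda>n. nrm (\<lambda>b. s n a b - f a b)) \<longlonglongrightarrow> 0))"

definition bochner_L2 ::
  "'a::euclidean_space set \<Rightarrow> ('b \<Rightarrow> real) set \<Rightarrow> (('b \<Rightarrow> real) \<Rightarrow> real) \<Rightarrow> ('a \<Rightarrow> 'b \<Rightarrow> real) set"
where
  "bochner_L2 S X nrm =
     {f. (AE a in lebesgue_on S. f a \<in> X) \<and> strongly_measurable (lebesgue_on S) X nrm f \<and>
         integrable (lebesgue_on S) (\<lambda>a. (nrm (f a))\<^sup>2)}"

definition bochner_L2_norm ::
  "'a::euclidean_space set \<Rightarrow> (('b \<Rightarrow> real) \<Rightarrow> real) \<Rightarrow> ('a \<Rightarrow> 'b \<Rightarrow> real) \<Rightarrow> real" where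
  "bochner_L2_norm S nrm f = sqrt (LINT a|lebesgue_on S. (nrm (f a))\<^sup>2)"

definition Omega_M :: "real \<Rightarrow> real \<Rightarrow> (real \<times> real) set" where
  "Omega_M h \<epsilon> = {- \<epsilon> / 2<..<\<epsilon> / 2} \<times> {0<..<h}"

text \<open>The segment \<open>{0} \<times> (0, h)\<close>, identified with \<open>(0, h)\<close> and carrying one-dimensional
  Lebesgue measure; accordingly the point \<open>(0, x\<^sub>2)\<close> is identified with \<open>x\<^sub>2 = snd x\<close>.\<close>

definition Sigma_M :: "real \<Rightarrow> real set" where
  "Sigma_M h = {0<..<h}"

definition T_cell :: "real set" where "T_cell = {0<..<1}"
definition Y_cell :: "(real \<times> real) set" where "Y_cell = {- 1/2<..<1/2} \<times> {0<..<1}"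
definition Z_cell :: "real set" where "Z_cell = {0<..<1}"

text \<open>Functions on the closed cell, already extended periodically in \<open>\<tau>\<close>, \<open>y\<^sub>2\<close>, \<open>z\<close> to the
  strip \<open>y\<^sub>1 \<in> [-1/2, 1/2]\<close>.  There is no periodicity in \<open>y\<^sub>1\<close>, and values outside the strip
  are irrelevant.\<close>

definition C_per :: "(real \<times> (real \<times> real) \<times> real \<Rightarrow> real) set" where
  "C_per = {w. continuous_on (UNIV \<times> ({- 1/2..1/2} \<times> UNIV) \<times> UNIV) w \<and>
     (\<forall>\<tau> y1 y2 z. y1 \<in> {- 1/2..1/2} \<longrightarrow>
        w (\<tau> + 1, (y1, y2), z) = w (\<tau>, (y1, y2), z) \<and>
        w (\<tau>, (y1, y2 + 1), z) = w (\<tau>, (y1, y2), z) \<and>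
        w (\<tau>, (y1, y2), z + 1) = w (\<tau>, (y1, y2), z))}"

definition C_per_norm :: "(real \<times> (real \<times> real) \<times> real \<Rightarrow> real) \<Rightarrow> real" where
  "C_per_norm w = (SUP p \<in> closure (T_cell \<times> Y_cell \<times> Z_cell). \<bar>w p\<bar>)"

definition multiscale_converges ::
  "real \<Rightarrow> real \<Rightarrow> (nat \<Rightarrow> real) \<Rightarrow> (nat \<Rightarrow> real \<Rightarrow> real \<times> real \<Rightarrow> real) \<Rightarrow>
   (real \<times> real \<times> real \<times> (real \<times> real) \<times> real \<Rightarrow> real) \<Rightarrow> bool" where
  "multiscale_converges h T \<epsilon> v v0 \<longleftrightarrow>
    (\<forall>\<phi> \<in> bochner_L2 ({0<..<T} \<times> Sigma_M h) C_per C_per_norm.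
      (\<lambda>n. 1 / \<epsilon> n *
         (LINT t|lebesgue_on {0<..<T}. LINT x|lebesgue_on (Omega_M h (\<epsilon> n)).
            v n t x *
            \<phi> (t, snd x) (t / \<epsilon> n, (fst x / \<epsilon> n, snd x / \<epsilon> n), snd x / (\<epsilon> n)\<^sup>2)))
      \<longlonglongrightarrow>
         (LINT t|lebesgue_on {0<..<T}. LINT xb|lebesgue_on (Sigma_M h).
            LINT \<tau>|lebesgue_on T_cell. LINT y|lebesgue_on Y_cell. LINT z|lebesgue_on Z_cell.
              v0 (t, xb, \<tau>, y, z) * \<phi> (t, xb) (\<tau>, y, z)))"

end

theory Submission
  imports Defs "HOL-Complex_Analysis.Great_Picard"
begin

text \<open>
  With \<open>L\<^sub>n \<phi>\<close> the left-hand side of the convergence statement, Cauchy--Schwarz gives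
  \<open>(L\<^sub>n \<phi>)\<^sup>2 \<le> C\<^sup>2 / \<epsilon>\<^sub>n \<integral>\<integral> (\<phi>\<^sup>\<epsilon>)\<^sup>2\<close>, where \<open>\<phi>\<^sup>\<epsilon>\<close> is the oscillating test function; hence \<open>L\<^sub>n \<phi>\<close> is at most \<open>C\<close> times
  the norm of \<open>\<phi>\<close> in \<open>L\<^sup>2((0,T) \<times> \<Sigma>; C)\<close>. Indicators of quadrants with rational corner in \<open>(t, x\<^sub>2)\<close>,
  times monomials in \<open>y\<^sub>1\<close> and trigonometric functions in \<open>\<tau>, y\<^sub>2, z\<close>, form a countable set whose
  span is dense in the test space and closed under multiplication. A diagonal subsequence makes
  \<open>L\<^sub>n\<close> converge on this span. There \<open>1 / \<epsilon>\<^sub>n \<integral>\<integral> (\<phi>\<^sup>\<epsilon>)\<^sup>2\<close> converges to the squared \<open>L\<^sup>2\<close> norm of \<open>\<phi>\<close> on the product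
  domain, because the integral of \<open>cos (\<omega> s + c)\<close> over an interval is at most \<open>2 / \<bar>\<omega>\<bar>\<close> and
  \<open>m / \<epsilon> + n / \<epsilon>\<^sup>2\<close> tends to infinity in modulus unless \<open>m = n = 0\<close>. Hence the limit functional is
  bounded for the \<open>L\<^sup>2\<close> norm, Riesz representation yields \<open>v\<^sup>0\<close>, and density extends the
  convergence to all test functions.
\<close>

section \<open>Square integrable functions\<close>

text \<open>A bound by the norm of \<open>L^2((0,T) x Sigma; C)\<close> alone would only give a
  limit represented by measures in the cell variables. To get a function, the oscillating test
  function must be squared and sent to the limit before any supremum over the cell is taken; this is
  why the generators have to be closed under multiplication.

  The other obstacle is measurability. The oscillating function evaluates a test function on a graph
  over \<open>(t, x1, x2)\<close>, a null set in the product of slow and fast variables. An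
  exceptional null set is therefore tolerable only in \<open>(t, x2)\<close>, and beyond it there
  must be control at every fast point; approximation in the sup norm provides it. Lebesgue
  measurability may be lost under composition with the oscillating substitution, so test functions
  are first replaced by Borel representatives. The functions \<open>v n\<close> are measurable in
  \<open>t\<close> only as maps into \<open>L^2\<close>, not jointly in \<open>(t, x)\<close>, so
  their pairings are handled through simple functions.\<close>

definition sqint :: "'a measure \<Rightarrow> ('a \<Rightarrow> real) \<Rightarrow> bool" where
  "sqint M f \<longleftrightarrow> f \<in> borel_measurable M \<and> integrable M (\<lambda>x. (f x)\<^sup>2)"

definition norm2 :: "'a measure \<Rightarrow> ('a \<Rightarrow> real) \<Rightarrow> real" where
  "norm2 M f = sqrt (LINT x|M. (f x)\<^sup>2)"

lemma L2_space_sqint: "f \<in> L2_space S \<longleftrightarrow> sqint (lebesgue_on S) f"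
  by (simp add: L2_space_def sqint_def)

lemma L2_norm_norm2: "L2_norm S = norm2 (lebesgue_on S)"
  by (simp add: L2_norm_def norm2_def fun_eq_iff)

lemma sqint_integrable: "sqint M f \<Longrightarrow> integrable M (\<lambda>x. (f x)\<^sup>2)"
  by (simp add: sqint_def)

lemma norm2_nonneg [simp]: "0 \<le> norm2 M f"
  by (simp add: norm2_def)

lemma norm2_power2: "(norm2 M f)\<^sup>2 = (LINT x|M. (f x)\<^sup>2)"
  by (simp add: norm2_def)

lemma integrable_mult_sqint:
  assumes "sqint M f" "sqint M g"
  shows "integrable M (\<lambda>x. f x * g x)"
proof (rule Bochner_Integration.integrable_bound)
  show "integrable M (\<lambda>x. (f x)\<^sup>2 + (g x)\<^sup>2)"
    using assms by (simp add: sqint_def)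
  show "(\<lambda>x. f x * g x) \<in> borel_measurable M"
    using assms by (auto simp: sqint_def)
  have "norm (a * b) \<le> norm (a\<^sup>2 + b\<^sup>2)" for a b :: real
  proof -
    have "0 \<le> (\<bar>a\<bar> - \<bar>b\<bar>)\<^sup>2" by simp
    then have "2 * (\<bar>a\<bar> * \<bar>b\<bar>) \<le> a\<^sup>2 + b\<^sup>2"
      by (simp add: power2_diff)
    moreover have "0 \<le> \<bar>a\<bar> * \<bar>b\<bar>" by simp
    ultimately have "\<bar>a\<bar> * \<bar>b\<bar> \<le> a\<^sup>2 + b\<^sup>2" by linarith
    then show ?thesis
      by (simp add: abs_mult)
  qed
  then show "AE x in M. norm (f x * g x) \<le> norm ((f x)\<^sup>2 + (g x)\<^sup>2)"
    by blast
qed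

lemma sqint_cmult: "sqint M f \<Longrightarrow> sqint M (\<lambda>x. c * f x)"
  by (auto simp: sqint_def power_mult_distrib)

lemma sqint_add:
  assumes "sqint M f" "sqint M g"
  shows "sqint M (\<lambda>x. f x + g x)"
proof -
  have "integrable M (\<lambda>x. (f x)\<^sup>2 + (g x)\<^sup>2 + 2 * (f x * g x))"
    using integrable_mult_sqint[OF assms] assms by (simp add: sqint_def)
  then show ?thesis
    using assms by (auto simp: sqint_def power2_sum mult.assoc)
qed

lemma sqint_diff: "sqint M f \<Longrightarrow> sqint M g \<Longrightarrow> sqint M (\<lambda>x. f x - g x)"
  using sqint_add[of M f "\<lambda>x. (- 1) * g x"] sqint_cmult[of M g "- 1"] by simp

lemma norm2_add_power2:
  assumes "sqint M f" "sqint M g"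
  shows "(norm2 M (\<lambda>x. f x + g x))\<^sup>2 = (norm2 M f)\<^sup>2 + (norm2 M g)\<^sup>2 + 2 * (LINT x|M. f x * g x)"
  using assms integrable_mult_sqint[OF assms]
  by (simp add: norm2_power2 power2_sum sqint_def mult.assoc)

lemma norm2_cmult: "norm2 M (\<lambda>x. c * f x) = \<bar>c\<bar> * norm2 M f"
  by (simp add: norm2_def power_mult_distrib real_sqrt_mult)

lemma norm2_abs: "norm2 M (\<lambda>x. \<bar>f x\<bar>) = norm2 M f"
  by (simp add: norm2_def)

lemma norm2_mono_AE:
  assumes "sqint M g" "AE x in M. \<bar>f x\<bar> \<le> \<bar>g x\<bar>"
  shows "norm2 M f \<le> norm2 M g"
  unfolding norm2_def using assms
  by (intro real_sqrt_le_mono integral_mono_AE') (auto simp: sqint_def abs_le_square_iff)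

lemma norm2_Cauchy_Schwarz:
  assumes "sqint M f" "sqint M g"
  shows "\<bar>LINT x|M. f x * g x\<bar> \<le> norm2 M f * norm2 M g"
proof -
  have q: "0 \<le> (norm2 M f)\<^sup>2 + s\<^sup>2 * (norm2 M g)\<^sup>2 + 2 * s * (LINT x|M. f x * g x)" for s
  proof -
    have "(norm2 M (\<lambda>x. f x + s * g x))\<^sup>2 = (norm2 M f)\<^sup>2 + s\<^sup>2 * (norm2 M g)\<^sup>2 + 2 * s * (LINT x|M. f x * g x)"
      by (subst norm2_add_power2) (use assms in
        \<open>auto intro: sqint_cmult simp: norm2_cmult power_mult_distrib mult.left_commute[of _ s]\<close>)
    then show ?thesis
      by (metis zero_le_power2)
  qed
  define a b c where "a = (norm2 M f)\<^sup>2" and "b = (norm2 M g)\<^sup>2" and "c = (LINT x|M. f x * g x)"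
  have "c\<^sup>2 \<le> a * b"
  proof (cases "b = 0")
    case True
    have "c = 0"
    proof (rule ccontr)
      assume "c \<noteq> 0"
      \<comment> \<open>For \<open>b = 0\<close> the quadratic is affine in \<open>s\<close>, and
        this argument gives it the value \<open>-1\<close>.\<close>
      with q[of "- (a + 1) / (2 * c)"] True show False
        by (simp add: a_def b_def c_def field_simps)
    qed
    then show ?thesis
      by (simp add: a_def b_def)
  next
    case False
    then have "b > 0" by (simp add: b_def)
    \<comment> \<open>The quadratic is evaluated at its minimiser.\<close>
    from q[of "- c / b"] have "0 \<le> a + c\<^sup>2 / b\<^sup>2 * b - 2 * c / b * c"
      by (simp add: a_def b_def c_def power_divide)
    then have "0 \<le> a - c\<^sup>2 / b"
      using \<open>b > 0\<close> by (simp add: power2_eq_square field_simps)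
    then show ?thesis
      using \<open>b > 0\<close> by (simp add: field_simps)
  qed
  then have "c\<^sup>2 \<le> (norm2 M f * norm2 M g)\<^sup>2"
    by (simp add: a_def b_def power_mult_distrib)
  then show ?thesis
    unfolding c_def using abs_le_square_iff[of c "norm2 M f * norm2 M g"]
    by (simp add: abs_mult c_def)
qed

lemma norm2_triangle:
  assumes "sqint M f" "sqint M g"
  shows "norm2 M (\<lambda>x. f x + g x) \<le> norm2 M f + norm2 M g"
proof (rule power2_le_imp_le)
  show "(norm2 M (\<lambda>x. f x + g x))\<^sup>2 \<le> (norm2 M f + norm2 M g)\<^sup>2"
    using norm2_Cauchy_Schwarz[OF assms] norm2_add_power2[OF assms] by (simp add: power2_sum)
qed simp

lemma norm2_triangle_diff:
  assumes "sqint M f" "sqint M g" "sqint M k"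
  shows "norm2 M (\<lambda>x. f x - k x) \<le> norm2 M (\<lambda>x. f x - g x) + norm2 M (\<lambda>x. g x - k x)"
  using norm2_triangle[of M "\<lambda>x. f x - g x" "\<lambda>x. g x - k x"] assms by (simp add: sqint_diff)

section \<open>Completeness and Riesz representation over a finite measure\<close>

lemma norm2_nn_integral:
  assumes "sqint M f"
  shows "(\<integral>\<^sup>+ x. ennreal ((f x)\<^sup>2) \<partial>M) = ennreal ((norm2 M f)\<^sup>2)"
  using assms by (simp add: norm2_power2 sqint_def nn_integral_eq_integral)

text \<open>Finiteness of the measure turns the geometric \<open>L^2\<close> increments into
  summable \<open>L^1\<close> increments, by Cauchy-Schwarz against the constant 1, so the
  telescoping series converges almost everywhere. Fatou's lemma then carries the tail bound
  \<open>2 * c * (1/2)^k\<close> over to the pointwise limit.\<close>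

lemma (in finite_measure) sqint_complete:
  fixes f :: "nat \<Rightarrow> 'a \<Rightarrow> real"
  assumes f: "\<And>k. sqint M (f k)"
    and cauchy: "\<And>k. norm2 M (\<lambda>x. f (Suc k) x - f k x) \<le> c * (1/2)^k"
  shows "\<exists>g. sqint M g \<and> (\<lambda>k. norm2 M (\<lambda>x. g x - f k x)) \<longlonglongrightarrow> 0"
proof -
  define d where "d k x = f (Suc k) x - f k x" for k x
  have d: "sqint M (d k)" for k
    unfolding d_def by (intro sqint_diff f)
  have [measurable]: "f k \<in> borel_measurable M" "d k \<in> borel_measurable M" for k
    using f d by (auto simp: sqint_def)
  have one: "sqint M (\<lambda>_. 1)"
    by (simp add: sqint_def)
  define m where "m = norm2 M (\<lambda>_. 1)"
  have c: "c \<ge> 0"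
    using order_trans[OF norm2_nonneg cauchy[of 0]] by simp
  have d1: "(\<integral>\<^sup>+ x. ennreal \<bar>d k x\<bar> \<partial>M) \<le> ennreal (c * m * (1/2)^k)" for k
  proof -
    have "integrable M (d k)"
      using square_integrable_imp_integrable[of "d k"] d[of k] by (simp add: sqint_def)
    then have "(\<integral>\<^sup>+ x. ennreal \<bar>d k x\<bar> \<partial>M) = ennreal (LINT x|M. \<bar>d k x\<bar>)"
      by (intro nn_integral_eq_integral) auto
    also have "(LINT x|M. \<bar>d k x\<bar>) \<le> c * m * (1/2)^k"
    proof -
      have "\<bar>LINT x|M. \<bar>d k x\<bar> * 1\<bar> \<le> norm2 M (\<lambda>x. \<bar>d k x\<bar>) * m"
        unfolding m_def using d[of k] one by (intro norm2_Cauchy_Schwarz) (simp_all add: sqint_def)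
      also have "\<dots> \<le> c * (1/2)^k * m"
        using cauchy[of k] by (intro mult_right_mono) (simp_all add: norm2_abs d_def[abs_def] m_def)
      finally show ?thesis
        by (simp add: mult_ac)
    qed
    finally show ?thesis
      by (simp add: ennreal_leI)
  qed
  have "(\<integral>\<^sup>+ x. (\<Sum>k. ennreal \<bar>d k x\<bar>) \<partial>M) = (\<Sum>k. \<integral>\<^sup>+ x. ennreal \<bar>d k x\<bar> \<partial>M)"
    by (rule nn_integral_suminf) simp
  also have "\<dots> \<le> (\<Sum>k. ennreal (c * m * (1/2)^k))"
    by (intro suminf_le d1) auto
  also have "\<dots> = ennreal (\<Sum>k. c * m * (1/2)^k)"
    by (intro suminf_ennreal2 summable_mult) (auto simp: c m_def summable_geometric)
  also have "\<dots> < \<infinity>" by simp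
  finally have "(\<integral>\<^sup>+ x. (\<Sum>k. ennreal \<bar>d k x\<bar>) \<partial>M) \<noteq> \<infinity>"
    by simp
  then have "AE x in M. (\<Sum>k. ennreal \<bar>d k x\<bar>) \<noteq> \<infinity>"
    by (intro nn_integral_noteq_infinite) auto
  then have ae: "AE x in M. (\<lambda>k. f k x) \<longlonglongrightarrow> lim (\<lambda>k. f k x)"
  proof eventually_elim
    case (elim x)
    then have "summable (\<lambda>k. \<bar>d k x\<bar>)"
      by (intro summable_suminf_not_top) auto
    then have "summable (\<lambda>k. d k x)"
      by (rule summable_rabs_cancel)
    then have "convergent (\<lambda>n. \<Sum>k<n. d k x)"
      by (simp add: summable_iff_convergent)
    moreover have "(\<Sum>k<n. d k x) = f n x - f 0 x" for n
      by (simp add: d_def sum_lessThan_telescope[of "\<lambda>k. f k x"])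
    ultimately have "convergent (\<lambda>n. f n x - f 0 x + f 0 x)"
      by (intro convergent_add) (auto simp: convergent_const)
    then show ?case
      by (simp add: convergent_LIMSEQ_iff)
  qed
  define g where "g x = lim (\<lambda>k. f k x)" for x
  have g_meas [measurable]: "g \<in> borel_measurable M"
    unfolding g_def by measurable
  have tail: "norm2 M (\<lambda>x. f (k + j) x - f k x) \<le> 2 * c * (1/2)^k" for k j
  proof -
    have "norm2 M (\<lambda>x. f (k + j) x - f k x) \<le> (\<Sum>i<j. c * (1/2)^(k + i))"
    proof (induction j)
      case 0
      then show ?case by (simp add: norm2_def)
    next
      case (Suc j)
      have "norm2 M (\<lambda>x. f (k + Suc j) x - f k x)
        \<le> norm2 M (\<lambda>x. f (k + Suc j) x - f (k + j) x) + norm2 M (\<lambda>x. f (k + j) x - f k x)"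
        by (intro norm2_triangle_diff f)
      with Suc cauchy[of "k + j"] show ?case by simp
    qed
    also have "\<dots> = c * (1/2)^k * (\<Sum>i<j. (1/2)^i)"
      by (simp add: sum_distrib_left power_add mult_ac)
    also have "\<dots> \<le> c * (1/2)^k * 2"
      using c by (intro mult_left_mono) (auto simp: sum_gp_strict)
    finally show ?thesis by (simp add: mult_ac)
  qed
  have fatou: "(\<integral>\<^sup>+ x. ennreal ((g x - f k x)\<^sup>2) \<partial>M) \<le> ennreal ((2 * c * (1/2)^k)\<^sup>2)" for k
  proof -
    have "(\<integral>\<^sup>+ x. ennreal ((g x - f k x)\<^sup>2) \<partial>M)
      = (\<integral>\<^sup>+ x. liminf (\<lambda>j. ennreal ((f (k + j) x - f k x)\<^sup>2)) \<partial>M)"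
    proof (rule nn_integral_cong_AE, use ae in eventually_elim)
      case (elim x)
      have "(\<lambda>j. f (k + j) x) \<longlonglongrightarrow> g x"
        using LIMSEQ_ignore_initial_segment[OF elim, of k] by (simp add: g_def add.commute)
      then have "(\<lambda>j. ennreal ((f (k + j) x - f k x)\<^sup>2)) \<longlonglongrightarrow> ennreal ((g x - f k x)\<^sup>2)"
        by (intro tendsto_intros)
      then show ?case
        using lim_imp_Liminf[OF sequentially_bot] by metis
    qed
    also have "\<dots> \<le> liminf (\<lambda>j. \<integral>\<^sup>+ x. ennreal ((f (k + j) x - f k x)\<^sup>2) \<partial>M)"
      by (rule nn_integral_liminf) simp
    also have "\<dots> \<le> liminf (\<lambda>j. ennreal ((2 * c * (1/2)^k)\<^sup>2))"
    proof (rule Liminf_mono, rule always_eventually, rule allI)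
      fix j
      have "(\<integral>\<^sup>+ x. ennreal ((f (k + j) x - f k x)\<^sup>2) \<partial>M)
        = ennreal ((norm2 M (\<lambda>x. f (k + j) x - f k x))\<^sup>2)"
        by (rule norm2_nn_integral) (intro sqint_diff f)
      also have "\<dots> \<le> ennreal ((2 * c * (1/2)^k)\<^sup>2)"
        by (intro ennreal_leI power_mono tail) simp
      finally show "(\<integral>\<^sup>+ x. ennreal ((f (k + j) x - f k x)\<^sup>2) \<partial>M) \<le> ennreal ((2 * c * (1/2)^k)\<^sup>2)" .
    qed
    also have "\<dots> = ennreal ((2 * c * (1/2)^k)\<^sup>2)"
      by (simp add: Liminf_const)
    finally show ?thesis .
  qed
  have gf: "sqint M (\<lambda>x. g x - f k x)" for k
    unfolding sqint_def using fatou[of k]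
    by (auto intro!: integrableI_bounded intro: le_less_trans)
  have "sqint M (\<lambda>x. (g x - f 0 x) + f 0 x)"
    by (intro sqint_add gf f)
  then have "sqint M g" by simp
  moreover have bound: "norm2 M (\<lambda>x. g x - f k x) \<le> 2 * c * (1/2)^k" for k
  proof (rule power2_le_imp_le)
    show "(norm2 M (\<lambda>x. g x - f k x))\<^sup>2 \<le> (2 * c * (1/2)^k)\<^sup>2"
      using fatou[of k] unfolding norm2_nn_integral[OF gf]
      by (subst (asm) ennreal_le_iff) auto
  qed (use c in auto)
  have "(\<lambda>k. norm2 M (\<lambda>x. g x - f k x)) \<longlonglongrightarrow> 0"
  proof (rule tendsto_0_le[where K = 1])
    show "(\<lambda>k. 2 * c * (1/2)^k) \<longlonglongrightarrow> 0"
      by (intro tendsto_mult_right_zero LIMSEQ_power_zero) simp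
    show "\<forall>\<^sub>F k in sequentially. norm (norm2 M (\<lambda>x. g x - f k x)) \<le> norm (2 * c * (1/2)^k) * 1"
      using bound by (intro always_eventually allI) (auto intro: order_trans[OF _ abs_ge_self])
  qed
  ultimately show ?thesis by blast
qed

text \<open>Minimises \<open>\<integral>g\<^sup>2 - 2 L g\<close> over \<open>D\<close>: by the parallelogram law a minimising
  sequence is Cauchy, and its limit represents \<open>L\<close>.\<close>

lemma (in finite_measure) riesz_representation_subspace:
  fixes D :: "('a \<Rightarrow> real) set" and L :: "('a \<Rightarrow> real) \<Rightarrow> real"
  assumes D: "\<And>f. f \<in> D \<Longrightarrow> sqint M f"
    and D0: "d0 \<in> D"
    and Dadd: "\<And>f g. f \<in> D \<Longrightarrow> g \<in> D \<Longrightarrow> (\<lambda>x. f x + g x) \<in> D"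
    and Dscale: "\<And>c f. f \<in> D \<Longrightarrow> (\<lambda>x. c * f x) \<in> D"
    and Ladd: "\<And>f g. f \<in> D \<Longrightarrow> g \<in> D \<Longrightarrow> L (\<lambda>x. f x + g x) = L f + L g"
    and Lscale: "\<And>c f. f \<in> D \<Longrightarrow> L (\<lambda>x. c * f x) = c * L f"
    and Lbound: "\<And>f. f \<in> D \<Longrightarrow> \<bar>L f\<bar> \<le> C * norm2 M f"
  shows "\<exists>v. sqint M v \<and> (\<forall>f\<in>D. (LINT x|M. v x * f x) = L f)"
proof -
  \<comment> \<open>If \<open>v\<close> represents \<open>L\<close>, then \<open>J f\<close> is the
    squared distance from \<open>f\<close> to \<open>v\<close> minus the squared norm of
    \<open>v\<close>. Minimising \<open>J\<close> thus approaches \<open>v\<close> from within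
    \<open>D\<close>, which need not be closed.\<close>
  define J where "J f = (norm2 M f)\<^sup>2 - 2 * L f" for f
  have Jbound: "J f \<ge> - (C\<^sup>2)" if "f \<in> D" for f
  proof -
    have "0 \<le> (norm2 M f - C)\<^sup>2" by simp
    with Lbound[OF that] show ?thesis
      by (simp add: J_def power2_diff abs_le_iff mult.commute)
  qed
  define m where "m = Inf (J ` D)"
  have bdd: "bdd_below (J ` D)"
    using Jbound by (intro bdd_belowI[of _ "- (C\<^sup>2)"]) auto
  have m: "m \<le> J f" if "f \<in> D" for f
    unfolding m_def using that bdd by (intro cInf_lower) auto
  \<comment> \<open>The gaps control squared distances, so \<open>(1/4)^k\<close> yields the rate
    \<open>(1/2)^k\<close> that \<open>sqint_complete\<close> asks for.\<close>
  have "\<exists>f\<in>D. J f < m + (1/4)^k" for k :: nat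
  proof -
    have "Inf (J ` D) < m + (1/4)^k" by (simp add: m_def)
    then show ?thesis
      using D0 bdd by (subst (asm) cInf_less_iff) auto
  qed
  then obtain f where f: "\<And>k. f k \<in> D" "\<And>k. J (f k) < m + (1/4)^k"
    by metis
  \<comment> \<open>The midpoint of \<open>g\<close> and \<open>k\<close> lies in \<open>D\<close>,
    so \<open>J\<close> is at least \<open>m\<close> there; the parallelogram law does the
    rest.\<close>
  have paral: "(norm2 M (\<lambda>x. g x - k x))\<^sup>2 \<le> 2 * (J g - m) + 2 * (J k - m)"
    if gk: "g \<in> D" "k \<in> D" for g k
  proof -
    have sq: "sqint M g" "sqint M k" using that D by auto
    have i: "integrable M (\<lambda>x. g x * k x)" by (intro integrable_mult_sqint sq)
    have s: "(\<lambda>x. 1/2 * (g x + k x)) \<in> D" using gk by (intro Dscale Dadd)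
    have a: "(norm2 M (\<lambda>x. g x - k x))\<^sup>2
        = (norm2 M g)\<^sup>2 + (norm2 M k)\<^sup>2 - 2 * (LINT x|M. g x * k x)"
      using norm2_add_power2[of M g "\<lambda>x. (- 1) * k x"] sqint_cmult[of M k "- 1"] sq
        norm2_cmult[of M "-1" k] by simp
    have eq: "J (\<lambda>x. 1/2 * (g x + k x))
      = ((norm2 M g)\<^sup>2 + (norm2 M k)\<^sup>2 + 2 * (LINT x|M. g x * k x)) / 4 - (L g + L k)"
      unfolding J_def norm2_cmult using norm2_add_power2[OF sq]
        Lscale[OF Dadd[OF gk], of "1/2"] Ladd[OF gk]
      by (simp add: power_divide)
    have "4 * m \<le> (norm2 M g)\<^sup>2 + (norm2 M k)\<^sup>2 + 2 * (LINT x|M. g x * k x) - 4 * (L g + L k)"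
      using m[OF s, unfolded eq] by (simp add: field_simps)
    then show ?thesis
      unfolding J_def a by (simp add: algebra_simps)
  qed
  have "\<exists>v. sqint M v \<and> (\<lambda>k. norm2 M (\<lambda>x. v x - f k x)) \<longlonglongrightarrow> 0"
  proof (rule sqint_complete[where c = 2])
    show "sqint M (f k)" for k using D f by auto
    show "norm2 M (\<lambda>x. f (Suc k) x - f k x) \<le> 2 * (1/2)^k" for k
    proof (rule power2_le_imp_le)
      have "(norm2 M (\<lambda>x. f (Suc k) x - f k x))\<^sup>2 \<le> 2 * (1/4)^Suc k + 2 * (1/4)^k"
        using paral[OF f(1)[of "Suc k"] f(1)[of k]] f(2)[of "Suc k"] f(2)[of k] by simp
      also have "\<dots> \<le> 4 * (1/4)^k" by simp
      also have "\<dots> = (2 * (1/2)^k)\<^sup>2"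
        by (simp add: power_mult_distrib power2_eq_square power_divide flip: power_mult_distrib)
      finally show "(norm2 M (\<lambda>x. f (Suc k) x - f k x))\<^sup>2 \<le> (2 * (1/2)^k)\<^sup>2" .
    qed simp
  qed
  then obtain v where v: "sqint M v" "(\<lambda>k. norm2 M (\<lambda>x. v x - f k x)) \<longlonglongrightarrow> 0" by blast
  have "(LINT x|M. v x * g x) = L g" if g: "g \<in> D" for g
  proof -
    have sg: "sqint M g" and sf: "\<And>k. sqint M (f k)" using D g f by auto
    have lim: "(\<lambda>k. LINT x|M. f k x * g x) \<longlonglongrightarrow> (LINT x|M. v x * g x)"
    proof (rule LIM_zero_cancel, rule Lim_null_comparison[OF always_eventually], rule allI)
      fix k
      have "norm ((LINT x|M. f k x * g x) - (LINT x|M. v x * g x))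
          = \<bar>LINT x|M. (v x - f k x) * g x\<bar>"
        using sf sg v by (simp add: integrable_mult_sqint left_diff_distrib abs_minus_commute)
      also have "\<dots> \<le> norm2 M (\<lambda>x. v x - f k x) * norm2 M g"
        by (intro norm2_Cauchy_Schwarz sqint_diff v sf sg)
      finally show "norm ((LINT x|M. f k x * g x) - (LINT x|M. v x * g x))
          \<le> norm2 M (\<lambda>x. v x - f k x) * norm2 M g" .
      show "(\<lambda>k. norm2 M (\<lambda>x. v x - f k x) * norm2 M g) \<longlonglongrightarrow> 0"
        by (intro tendsto_mult_left_zero v)
    qed
    define a where "a = (LINT x|M. v x * g x) - L g"
    define q where "q = (norm2 M g)\<^sup>2"
    \<comment> \<open>First variation: moving \<open>f k\<close> by \<open>s * g\<close> cannot
      bring \<open>J\<close> below \<open>m\<close>, while \<open>J (f k)\<close> exceeds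
      \<open>m\<close> by less than \<open>(1/4)^k\<close>. The limit is a nonnegative quadratic in
      \<open>s\<close> without constant term, so its linear coefficient must vanish.\<close>
    have key: "0 \<le> 2 * s * a + s\<^sup>2 * q" for s
    proof (rule tendsto_lowerbound)
      show "(\<lambda>k. 2 * s * ((LINT x|M. f k x * g x) - L g) + s\<^sup>2 * q + (1/4)^k)
          \<longlonglongrightarrow> 2 * s * a + s\<^sup>2 * q"
        unfolding a_def using LIMSEQ_power_zero[of "1/4 :: real"]
        by (auto intro!: tendsto_eq_intros lim)
      show "\<forall>\<^sub>F k in sequentially. 0 \<le> 2 * s * ((LINT x|M. f k x * g x) - L g) + s\<^sup>2 * q + (1/4)^k"
      proof (rule always_eventually, rule allI)
        fix k
        have "m \<le> J (\<lambda>x. f k x + s * g x)"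
          using f g by (intro m Dadd Dscale)
        also have "\<dots> = J (f k) + 2 * s * ((LINT x|M. f k x * g x) - L g) + s\<^sup>2 * q"
          using norm2_add_power2[OF sf sqint_cmult[OF sg], of k s] Ladd[OF f(1) Dscale[OF g], of k s]
            Lscale[OF g, of s]
          by (simp add: J_def q_def norm2_cmult power_mult_distrib mult.left_commute[of _ s] algebra_simps)
        finally show "0 \<le> 2 * s * ((LINT x|M. f k x * g x) - L g) + s\<^sup>2 * q + (1/4)^k"
          using f(2)[of k] by linarith
      qed
    qed simp
    have "a = 0"
    proof (rule ccontr)
      assume "a \<noteq> 0"
      have "q \<ge> 0" by (simp add: q_def)
      \<comment> \<open>The argument \<open>- a / (q + 1)\<close> stands in for the minimiser
        \<open>- a / q\<close>; the added 1 covers \<open>q = 0\<close>.\<close>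
      have "0 \<le> - 2 * a\<^sup>2 / (q + 1) + (a / (q + 1))\<^sup>2 * q"
        using key[of "- a / (q + 1)"] by (simp add: power2_eq_square)
      also have "\<dots> = a\<^sup>2 / (q + 1) * (q / (q + 1) - 2)"
        by (simp add: power_divide power2_eq_square right_diff_distrib)
      also have "\<dots> < 0"
        using \<open>a \<noteq> 0\<close> \<open>q \<ge> 0\<close> by (intro mult_pos_neg) (auto simp: field_simps)
      finally show False by simp
    qed
    then show ?thesis by (simp add: a_def)
  qed
  with v show ?thesis by blast
qed

section \<open>Borel representatives for Lebesgue measure on a Borel set\<close>

lemma AE_lebesgue_on:
  fixes A :: "'a::euclidean_space set"
  assumes "A \<in> sets borel"
  shows "(AE x in lebesgue_on A. P x) \<longleftrightarrow> (AE x in lborel. x \<in> A \<longrightarrow> P x)"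
  using assms by (subst AE_restrict_space_iff) (auto simp: AE_completion_iff)

lemma complete_measure_lebesgue_on:
  assumes "A \<in> sets lebesgue"
  shows "complete_measure (lebesgue_on A)"
proof
  fix B N :: "'a set"
  assume B: "B \<subseteq> N" "N \<in> null_sets (lebesgue_on A)"
  then have "N \<subseteq> A" "N \<in> null_sets lebesgue"
    using assms by (auto simp: null_sets_restrict_space)
  then have "B \<subseteq> A" "B \<in> sets lebesgue"
    using B completion.complete2[of B N lborel] by auto
  then show "B \<in> sets (lebesgue_on A)"
    using assms by (auto simp: sets_restrict_space_iff)
qed

text \<open>Preimages change only by null sets, which completeness keeps measurable. This serves for
  norms and inner integrals that are identified with a measurable expression only almost
  everywhere.\<close>

lemma (in complete_measure) measurable_AE_cong:
  assumes g: "g \<in> measurable M N" and ae: "AE x in M. f x = g x"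
    and sp: "\<And>x. x \<in> space M \<Longrightarrow> f x \<in> space N"
  shows "f \<in> measurable M N"
proof (rule measurableI)
  fix A assume "A \<in> sets N"
  then have "g -` A \<inter> space M \<in> sets M"
    using g by measurable
  moreover have "AE x in M. x \<in> g -` A \<inter> space M \<longleftrightarrow> x \<in> f -` A \<inter> space M"
    using ae by eventually_elim auto
  ultimately show "f -` A \<inter> space M \<in> sets M"
    using in_sets_AE[of "g -` A \<inter> space M" "f -` A \<inter> space M"] by auto
qed (rule sp)

context
  fixes A :: "'a::euclidean_space set" and f g :: "'a \<Rightarrow> real"
  assumes A: "A \<in> sets borel" and g: "g \<in> borel_measurable borel"
    and eq: "AE x in lborel. x \<in> A \<longrightarrow> f x = g x"
begin

text \<open>Borel functions have Borel sections and compose with continuous maps, which may fail for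
  Lebesgue measurable ones. These three facts move measurability, integrability and integrals from
  \<open>f\<close> on \<open>lebesgue_on A\<close> to a Borel \<open>g\<close> on
  \<open>lborel\<close>.\<close>

lemma lebesgue_on_measurable_cong_borel: "f \<in> borel_measurable (lebesgue_on A)"
proof -
  interpret complete_measure "lebesgue_on A"
    using A by (intro complete_measure_lebesgue_on) simp
  show ?thesis
  proof (rule measurable_AE_cong)
    show "g \<in> borel_measurable (lebesgue_on A)"
      using g by (intro measurable_restrict_space1 measurable_completion) simp
    show "AE x in lebesgue_on A. f x = g x"
      using eq A by (simp add: AE_lebesgue_on)
  qed simp
qed

lemma lebesgue_on_integrable_cong_borel:
  "integrable (lebesgue_on A) f \<longleftrightarrow> integrable lborel (\<lambda>x. indicator A x * g x)"
proof -
  have "integrable (lebesgue_on A) f \<longleftrightarrow> integrable (lebesgue_on A) g"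
    using eq A g by (intro integrable_cong_AE lebesgue_on_measurable_cong_borel
      measurable_restrict_space1 measurable_completion) (simp_all add: AE_lebesgue_on)
  also have "\<dots> \<longleftrightarrow> integrable lebesgue (\<lambda>x. indicator A x * g x)"
    using A by (simp add: integrable_restrict_space)
  also have "\<dots> \<longleftrightarrow> integrable lborel (\<lambda>x. indicator A x * g x)"
    using A g by (intro integrable_completion) auto
  finally show ?thesis .
qed

lemma lebesgue_on_integral_cong_borel:
  "(LINT x|lebesgue_on A. f x) = (LINT x|lborel. indicator A x * g x)"
proof -
  have "(LINT x|lebesgue_on A. f x) = (LINT x|lebesgue_on A. g x)"
    using eq A g by (intro integral_cong_AE lebesgue_on_measurable_cong_borel
      measurable_restrict_space1 measurable_completion) (simp_all add: AE_lebesgue_on)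
  also have "\<dots> = (LINT x|lebesgue. indicator A x * g x)"
    using A by (simp add: integral_restrict_space)
  also have "\<dots> = (LINT x|lborel. indicator A x * g x)"
    using A g by (intro integral_completion) auto
  finally show ?thesis .
qed

end

text \<open>The value type carries no topology, because it will be a space of functions. Simple
  functions still transfer, since only finitely many level sets are altered, each by a null
  set.\<close>

lemma lebesgue_on_simple_function_borel:
  fixes A :: "'a::euclidean_space set"
  assumes A: "A \<in> sets borel" and s: "simple_function (lebesgue_on A) s"
  shows "\<exists>s'. simple_function (lborel :: 'a measure) s' \<and> (AE x in lborel. x \<in> A \<longrightarrow> s x = s' x)"
proof -
  define t where "t x = (if x \<in> A then s x else undefined)" for x
  have "simple_function lebesgue t"
    unfolding simple_function_eq_measurable
  proof
    have "t ` space lebesgue \<subseteq> insert undefined (s ` space (lebesgue_on A))"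
      by (auto simp: t_def)
    then show "finite (t ` space lebesgue)"
      using simple_functionD(1)[OF s] finite_subset by auto
    show "t \<in> lebesgue \<rightarrow>\<^sub>M count_space UNIV"
      using measurable_simple_function[OF s] A unfolding t_def[abs_def]
      by (subst (asm) measurable_restrict_space_iff[where c = undefined]) auto
  qed
  from completion_ex_simple_function[OF this] obtain s' where
    s': "simple_function lborel s'" "AE x in lborel. t x = s' x" by auto
  from s'(2) have "AE x in lborel. x \<in> A \<longrightarrow> s x = s' x"
    by eventually_elim (auto simp: t_def)
  with s' show ?thesis by blast
qed

lemma lebesgue_on_borel_representative:
  fixes A :: "'a::euclidean_space set" and f :: "'a \<Rightarrow> real"
  assumes A: "A \<in> sets borel" and f: "f \<in> borel_measurable (lebesgue_on A)"
  shows "\<exists>g\<in>borel_measurable borel. AE x in lborel. x \<in> A \<longrightarrow> f x = g x"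
proof -
  have "(\<lambda>x. if x \<in> A then f x else 0) \<in> borel_measurable (completion lborel)"
    using f A by (subst (asm) measurable_restrict_space_iff[where c = 0]) auto
  from completion_ex_borel_measurable_real[OF this] obtain g where
    g: "g \<in> borel_measurable lborel" "AE x in lborel. (if x \<in> A then f x else 0) = g x" by auto
  from g(2) have "AE x in lborel. x \<in> A \<longrightarrow> f x = g x"
    by eventually_elim auto
  with g(1) show ?thesis by auto
qed

section \<open>Periodic continuous functions\<close>

abbreviation strip :: "(real \<times> (real \<times> real) \<times> real) set" where
  "strip \<equiv> UNIV \<times> ({- 1/2..1/2} \<times> UNIV) \<times> UNIV"

abbreviation (input) cell :: "(real \<times> (real \<times> real) \<times> real) set" where
  "cell \<equiv> T_cell \<times> Y_cell \<times> Z_cell"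

lemma closure_cell: "closure cell = {0..1} \<times> ({- 1/2..1/2} \<times> {0..1}) \<times> {0..1}"
  by (simp add: T_cell_def Y_cell_def Z_cell_def closure_Times)

lemma closure_cell_subset_strip: "closure cell \<subseteq> strip"
  by (auto simp: closure_cell)

lemma compact_closure_cell: "compact (closure cell)"
  unfolding closure_cell by (intro compact_Times compact_Icc)

lemma C_per_cmult: "w \<in> C_per \<Longrightarrow> (\<lambda>p. c * w p) \<in> C_per"
  by (auto simp: C_per_def intro!: continuous_intros)

lemma C_per_add: "w \<in> C_per \<Longrightarrow> u \<in> C_per \<Longrightarrow> (\<lambda>p. w p + u p) \<in> C_per"
  by (auto simp: C_per_def intro!: continuous_intros)

lemma C_per_diff: "w \<in> C_per \<Longrightarrow> u \<in> C_per \<Longrightarrow> (\<lambda>p. w p - u p) \<in> C_per"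
  by (auto simp: C_per_def intro!: continuous_intros)

lemma C_per_const: "(\<lambda>p. c) \<in> C_per"
  by (auto simp: C_per_def intro!: continuous_intros)

lemma periodic_shift_int:
  fixes f :: "real \<Rightarrow> 'a"
  assumes "\<And>x. f (x + 1) = f x"
  shows "f (x + of_int k) = f x"
proof (induction k rule: int_induct[where k = 0])
  case (step1 i)
  then show ?case
    using assms[of "x + of_int i"] by (simp add: add.assoc)
next
  case (step2 i)
  then show ?case
    using assms[of "x + of_int (i - 1)"] by (simp add: add.assoc)
qed simp

text \<open>Fractional parts in the periodic variables move a point of the strip into the closed
  cell, where compactness makes the supremum finite. This is what permits evaluation at unbounded
  arguments such as \<open>t / \<epsilon>\<close>.\<close>

lemma C_per_le_norm:
  assumes w: "w \<in> C_per" and p: "p \<in> strip"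
  shows "\<bar>w p\<bar> \<le> C_per_norm w"
proof -
  obtain \<tau> y1 y2 z where p_eq: "p = (\<tau>, (y1, y2), z)"
    by (cases p) auto
  then have y1: "y1 \<in> {- 1/2..1/2}" using p by auto
  have per: "\<And>\<tau> y2 z. w (\<tau> + 1, (y1, y2), z) = w (\<tau>, (y1, y2), z)"
    "\<And>\<tau> y2 z. w (\<tau>, (y1, y2 + 1), z) = w (\<tau>, (y1, y2), z)"
    "\<And>\<tau> y2 z. w (\<tau>, (y1, y2), z + 1) = w (\<tau>, (y1, y2), z)"
    using w y1 by (auto simp: C_per_def)
  define q where "q = (frac \<tau>, (y1, frac y2), frac z)"
  have "w p = w q"
    unfolding p_eq q_def frac_def
    using periodic_shift_int[of "\<lambda>t. w (t, (y1, y2), z)" \<tau> "- \<lfloor>\<tau>\<rfloor>"]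
      periodic_shift_int[of "\<lambda>t. w (\<tau> - \<lfloor>\<tau>\<rfloor>, (y1, t), z)" y2 "- \<lfloor>y2\<rfloor>"]
      periodic_shift_int[of "\<lambda>t. w (\<tau> - \<lfloor>\<tau>\<rfloor>, (y1, y2 - \<lfloor>y2\<rfloor>), t)" z "- \<lfloor>z\<rfloor>"]
    by (simp add: per)
  have "q \<in> closure cell"
    using y1 unfolding closure_cell q_def
    by (auto simp: frac_ge_0 less_imp_le frac_lt_1)
  have "bounded ((\<lambda>p. \<bar>w p\<bar>) ` closure cell)"
    using w closure_cell_subset_strip
    by (intro compact_imp_bounded compact_continuous_image compact_closure_cell continuous_intros)
       (auto simp: C_per_def intro: continuous_on_subset)
  then have "bdd_above ((\<lambda>p. \<bar>w p\<bar>) ` closure cell)"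
    by (rule bounded_imp_bdd_above)
  then show ?thesis
    unfolding C_per_norm_def \<open>w p = w q\<close> using \<open>q \<in> closure cell\<close> by (intro cSUP_upper)
qed

lemma C_per_norm_least:
  assumes "\<And>p. p \<in> strip \<Longrightarrow> \<bar>w p\<bar> \<le> c"
  shows "C_per_norm w \<le> c"
  unfolding C_per_norm_def using assms closure_cell_subset_strip
  by (intro cSUP_least) (auto simp: closure_cell)

lemma C_per_norm_nonneg:
  assumes "w \<in> C_per" shows "0 \<le> C_per_norm w"
  using C_per_le_norm[OF assms, of "(0, (0, 0), 0)"] by simp

lemma C_per_norm_add:
  assumes "w \<in> C_per" "u \<in> C_per"
  shows "C_per_norm (\<lambda>p. w p + u p) \<le> C_per_norm w + C_per_norm u"
  by (rule C_per_norm_least)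
     (use C_per_le_norm[OF assms(1)] C_per_le_norm[OF assms(2)] in \<open>meson abs_triangle_ineq add_mono order_trans\<close>)

lemma C_per_norm_cmult:
  assumes "w \<in> C_per"
  shows "C_per_norm (\<lambda>p. c * w p) \<le> \<bar>c\<bar> * C_per_norm w"
  by (rule C_per_norm_least) (use C_per_le_norm[OF assms] in \<open>simp add: abs_mult mult_left_mono\<close>)

lemma C_per_norm_minus: "C_per_norm (\<lambda>p. w p - u p) = C_per_norm (\<lambda>p. u p - w p)"
  by (simp add: C_per_norm_def abs_minus_commute)

lemma C_per_norm_diff:
  assumes "w \<in> C_per" "u \<in> C_per"
  shows "\<bar>C_per_norm w - C_per_norm u\<bar> \<le> C_per_norm (\<lambda>p. w p - u p)"
  using C_per_norm_add[OF C_per_diff[OF assms] assms(2)]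
    C_per_norm_add[OF C_per_diff[OF assms(2,1)] assms(1)] C_per_norm_minus[of w u]
  by simp

section \<open>The Bochner space of test functions\<close>

abbreviation test_space :: "(real \<times> real) set \<Rightarrow> (real \<times> real \<Rightarrow> real \<times> (real \<times> real) \<times> real \<Rightarrow> real) set" where
  "test_space S \<equiv> bochner_L2 S C_per C_per_norm"

abbreviation test_norm :: "(real \<times> real) set \<Rightarrow> (real \<times> real \<Rightarrow> real \<times> (real \<times> real) \<times> real \<Rightarrow> real) \<Rightarrow> real" where
  "test_norm S \<equiv> bochner_L2_norm S C_per_norm"

lemma test_norm_norm2: "test_norm S f = norm2 (lebesgue_on S) (\<lambda>a. C_per_norm (f a))"
  by (simp add: bochner_L2_norm_def norm2_def)

text \<open>The norm is 1-Lipschitz, so the norms of the approximating simple functions converge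
  almost everywhere to the norm of \<open>f\<close>; completeness of the measure covers the
  exceptional set.\<close>

lemma strongly_measurable_norm:
  assumes S: "S \<in> sets borel" and f: "strongly_measurable (lebesgue_on S) C_per C_per_norm f"
    and fC: "AE a in lebesgue_on S. f a \<in> C_per"
  shows "(\<lambda>a. C_per_norm (f a)) \<in> borel_measurable (lebesgue_on S)"
proof -
  interpret complete_measure "lebesgue_on S"
    using S by (intro complete_measure_lebesgue_on) simp
  obtain s where s: "\<And>n::nat. simple_function (lebesgue_on S) (s n)"
      "\<And>n. s n ` space (lebesgue_on S) \<subseteq> C_per"
      "AE a in lebesgue_on S. (\<lambda>n. C_per_norm (\<lambda>b. s n a b - f a b)) \<longlonglongrightarrow> 0"
    using f by (auto simp: strongly_measurable_def)
  have [measurable]: "(\<lambda>a. C_per_norm (s n a)) \<in> borel_measurable (lebesgue_on S)" for n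
    using borel_measurable_simple_function[OF simple_function_compose1[OF s(1)]] .
  show ?thesis
  proof (rule measurable_AE_cong)
    show "(\<lambda>a. lim (\<lambda>n. C_per_norm (s n a))) \<in> borel_measurable (lebesgue_on S)"
      by measurable
    have "AE a in lebesgue_on S. a \<in> space (lebesgue_on S)" by (rule AE_space)
    then show "AE a in lebesgue_on S. C_per_norm (f a) = lim (\<lambda>n. C_per_norm (s n a))"
      using s(3) fC
    proof eventually_elim
      case (elim a)
      have "(\<lambda>n. C_per_norm (s n a) - C_per_norm (f a)) \<longlonglongrightarrow> 0"
      proof (rule Lim_null_comparison[OF always_eventually elim(2)], rule allI)
        fix n
        have "s n a \<in> C_per" using s(2)[of n] elim(1) by auto
        with elim(3) show "norm (C_per_norm (s n a) - C_per_norm (f a)) \<le> C_per_norm (\<lambda>b. s n a b - f a b)"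
          using C_per_norm_diff by simp
      qed
      then show ?case by (simp add: LIM_zero_iff limI)
    qed
  qed simp
qed

lemma test_spaceI:
  assumes S: "S \<in> sets borel" and f: "strongly_measurable (lebesgue_on S) C_per C_per_norm f"
    and fC: "AE a in lebesgue_on S. f a \<in> C_per"
    and g: "sqint (lebesgue_on S) g" and fg: "AE a in lebesgue_on S. C_per_norm (f a) \<le> g a"
  shows "f \<in> test_space S"
proof -
  note [measurable] = strongly_measurable_norm[OF S f fC]
  have "integrable (lebesgue_on S) (\<lambda>a. (C_per_norm (f a))\<^sup>2)"
  proof (rule Bochner_Integration.integrable_bound)
    show "integrable (lebesgue_on S) (\<lambda>a. (g a)\<^sup>2)" using g by (simp add: sqint_def)
    show "AE a in lebesgue_on S. norm ((C_per_norm (f a))\<^sup>2) \<le> norm ((g a)\<^sup>2)"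
      using fg fC
    proof eventually_elim
      case (elim a)
      then show ?case using C_per_norm_nonneg[of "f a"] by (simp add: power_mono)
    qed
  qed measurable
  with f fC show ?thesis by (simp add: bochner_L2_def)
qed

lemma test_space_sqint:
  assumes "S \<in> sets borel" "f \<in> test_space S"
  shows "sqint (lebesgue_on S) (\<lambda>a. C_per_norm (f a))"
  using assms by (auto simp: bochner_L2_def sqint_def intro: strongly_measurable_norm)

lemma strongly_measurable_add:
  assumes f: "strongly_measurable M C_per C_per_norm f" and g: "strongly_measurable M C_per C_per_norm g"
    and fC: "AE a in M. f a \<in> C_per" and gC: "AE a in M. g a \<in> C_per"
  shows "strongly_measurable M C_per C_per_norm (\<lambda>a p. f a p + g a p)"
proof -
  obtain s where s: "\<And>n::nat. simple_function M (s n)" "\<And>n. s n ` space M \<subseteq> C_per"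
      "AE a in M. (\<lambda>n. C_per_norm (\<lambda>b. s n a b - f a b)) \<longlonglongrightarrow> 0"
    using f by (auto simp: strongly_measurable_def)
  obtain t where t: "\<And>n::nat. simple_function M (t n)" "\<And>n. t n ` space M \<subseteq> C_per"
      "AE a in M. (\<lambda>n. C_per_norm (\<lambda>b. t n a b - g a b)) \<longlonglongrightarrow> 0"
    using g by (auto simp: strongly_measurable_def)
  have "simple_function M (\<lambda>a b. s n a b + t n a b)" for n
    using simple_function_compose2[OF s(1)[of n] t(1)[of n], of "\<lambda>u w b. u b + w b"] .
  moreover have "(\<lambda>a b. s n a b + t n a b) ` space M \<subseteq> C_per" for n
    using s(2)[of n] t(2)[of n] by (auto intro!: C_per_add)
  moreover have "AE a in M. (\<lambda>n. C_per_norm (\<lambda>b. (s n a b + t n a b) - (f a b + g a b))) \<longlonglongrightarrow> 0"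
    using AE_space s(3) t(3) fC gC
  proof eventually_elim
    case (elim a)
    have C: "s n a \<in> C_per" "t n a \<in> C_per" for n
      using s(2)[of n] t(2)[of n] elim(1) by auto
    have lim: "(\<lambda>n. C_per_norm (\<lambda>b. s n a b - f a b) + C_per_norm (\<lambda>b. t n a b - g a b)) \<longlonglongrightarrow> 0"
      using tendsto_add[OF elim(2,3)] by simp
    show ?case
    proof (rule Lim_null_comparison[OF always_eventually lim], rule allI)
      fix n
      have "(\<lambda>b. (s n a b + t n a b) - (f a b + g a b)) = (\<lambda>b. (s n a b - f a b) + (t n a b - g a b))"
        by auto
      then show "norm (C_per_norm (\<lambda>b. (s n a b + t n a b) - (f a b + g a b)))
          \<le> C_per_norm (\<lambda>b. s n a b - f a b) + C_per_norm (\<lambda>b. t n a b - g a b)"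
        using C_per_norm_nonneg[OF C_per_add[OF C_per_diff[OF C(1) elim(4)] C_per_diff[OF C(2) elim(5)]]]
          C_per_norm_add[OF C_per_diff[OF C(1) elim(4)] C_per_diff[OF C(2) elim(5)]]
        by simp
    qed
  qed
  ultimately show ?thesis
    unfolding strongly_measurable_def by (intro exI[of _ "\<lambda>n a b. s n a b + t n a b"]) blast
qed

lemma strongly_measurable_cmult:
  assumes f: "strongly_measurable M C_per C_per_norm f" and fC: "AE a in M. f a \<in> C_per"
  shows "strongly_measurable M C_per C_per_norm (\<lambda>a p. c * f a p)"
proof -
  obtain s where s: "\<And>n::nat. simple_function M (s n)" "\<And>n. s n ` space M \<subseteq> C_per"
      "AE a in M. (\<lambda>n. C_per_norm (\<lambda>b. s n a b - f a b)) \<longlonglongrightarrow> 0"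
    using f by (auto simp: strongly_measurable_def)
  have "simple_function M (\<lambda>a b. c * s n a b)" for n
    using simple_function_compose1[OF s(1)[of n], of "\<lambda>u b. c * u b"] .
  moreover have "(\<lambda>a b. c * s n a b) ` space M \<subseteq> C_per" for n
    using s(2)[of n] by (auto intro!: C_per_cmult)
  moreover have "AE a in M. (\<lambda>n. C_per_norm (\<lambda>b. c * s n a b - c * f a b)) \<longlonglongrightarrow> 0"
    using AE_space s(3) fC
  proof eventually_elim
    case (elim a)
    have C: "s n a \<in> C_per" for n
      using s(2)[of n] elim(1) by auto
    have lim: "(\<lambda>n. \<bar>c\<bar> * C_per_norm (\<lambda>b. s n a b - f a b)) \<longlonglongrightarrow> 0"
      using tendsto_mult_right_zero[OF elim(2)] by simp
    show ?case
    proof (rule Lim_null_comparison[OF always_eventually lim], rule allI)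
      fix n
      have d: "(\<lambda>b. s n a b - f a b) \<in> C_per" by (intro C_per_diff C elim)
      show "norm (C_per_norm (\<lambda>b. c * s n a b - c * f a b)) \<le> \<bar>c\<bar> * C_per_norm (\<lambda>b. s n a b - f a b)"
        using C_per_norm_nonneg[OF C_per_cmult[OF d, of c]] C_per_norm_cmult[OF d, of c]
        by (simp add: right_diff_distrib)
    qed
  qed
  ultimately show ?thesis
    unfolding strongly_measurable_def by (intro exI[of _ "\<lambda>n a b. c * s n a b"]) blast
qed

lemma test_space_add:
  assumes S: "S \<in> sets borel" and f: "f \<in> test_space S" and g: "g \<in> test_space S"
  shows "(\<lambda>a p. f a p + g a p) \<in> test_space S"
proof (rule test_spaceI[OF S])
  have fC: "AE a in lebesgue_on S. f a \<in> C_per" and gC: "AE a in lebesgue_on S. g a \<in> C_per"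
    using f g by (auto simp: bochner_L2_def)
  show "strongly_measurable (lebesgue_on S) C_per C_per_norm (\<lambda>a p. f a p + g a p)"
    using f g by (intro strongly_measurable_add fC gC) (auto simp: bochner_L2_def)
  show "AE a in lebesgue_on S. (\<lambda>p. f a p + g a p) \<in> C_per"
    using fC gC by eventually_elim (rule C_per_add)
  show "AE a in lebesgue_on S. C_per_norm (\<lambda>p. f a p + g a p) \<le> C_per_norm (f a) + C_per_norm (g a)"
    using fC gC by eventually_elim (rule C_per_norm_add)
  show "sqint (lebesgue_on S) (\<lambda>a. C_per_norm (f a) + C_per_norm (g a))"
    by (intro sqint_add test_space_sqint S f g)
qed

lemma test_space_cmult:
  assumes S: "S \<in> sets borel" and f: "f \<in> test_space S"
  shows "(\<lambda>a p. c * f a p) \<in> test_space S"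
proof (rule test_spaceI[OF S])
  have fC: "AE a in lebesgue_on S. f a \<in> C_per"
    using f by (auto simp: bochner_L2_def)
  show "strongly_measurable (lebesgue_on S) C_per C_per_norm (\<lambda>a p. c * f a p)"
    using f by (intro strongly_measurable_cmult fC) (auto simp: bochner_L2_def)
  show "AE a in lebesgue_on S. (\<lambda>p. c * f a p) \<in> C_per"
    using fC by eventually_elim (rule C_per_cmult)
  show "AE a in lebesgue_on S. C_per_norm (\<lambda>p. c * f a p) \<le> \<bar>c\<bar> * C_per_norm (f a)"
    using fC by eventually_elim (rule C_per_norm_cmult)
  show "sqint (lebesgue_on S) (\<lambda>a. \<bar>c\<bar> * C_per_norm (f a))"
    by (intro sqint_cmult test_space_sqint S f)
qed

lemma test_space_diff:
  assumes S: "S \<in> sets borel" and f: "f \<in> test_space S" and g: "g \<in> test_space S"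
  shows "(\<lambda>a p. f a p - g a p) \<in> test_space S"
  using test_space_add[OF S f test_space_cmult[OF S g, of "- 1"]] by simp

lemma test_space_simple:
  assumes S: "S \<in> sets borel" and fin: "emeasure lborel S < \<infinity>"
    and s: "simple_function (lebesgue_on S) s" "s ` space (lebesgue_on S) \<subseteq> C_per"
  shows "s \<in> test_space S"
proof (rule test_spaceI[OF S])
  show "AE a in lebesgue_on S. s a \<in> C_per"
    using s(2) by (intro AE_I2) auto
  have z: "C_per_norm (\<lambda>b. 0) = 0"
    by (simp add: C_per_norm_def closure_cell)
  show "strongly_measurable (lebesgue_on S) C_per C_per_norm s"
    unfolding strongly_measurable_def by (intro exI[of _ "\<lambda>n. s"]) (use s in \<open>simp add: z\<close>)
  define c where "c = Max ((\<lambda>w. \<bar>C_per_norm w\<bar>) ` (s ` space (lebesgue_on S)))"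
  have "finite (s ` space (lebesgue_on S))"
    by (rule simple_functionD(1)[OF s(1)])
  then have "C_per_norm (s a) \<le> c" if "a \<in> space (lebesgue_on S)" for a
    using that unfolding c_def by (intro Max_ge[THEN order_trans[OF abs_ge_self]]) auto
  then show "AE a in lebesgue_on S. C_per_norm (s a) \<le> c"
    by (intro AE_I2)
  have "finite_measure (lebesgue_on S)"
    using fin S by (intro finite_measureI) (simp add: emeasure_restrict_space)
  then interpret finite_measure "lebesgue_on S" .
  show "sqint (lebesgue_on S) (\<lambda>_. c)"
    by (simp add: sqint_def)
qed

lemma test_norm_le:
  assumes "sqint (lebesgue_on S) g" "AE a in lebesgue_on S. f a \<in> C_per"
    "AE a in lebesgue_on S. C_per_norm (f a) \<le> \<bar>g a\<bar>"
  shows "test_norm S f \<le> norm2 (lebesgue_on S) g"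
  unfolding test_norm_norm2
proof (rule norm2_mono_AE[OF assms(1)])
  show "AE a in lebesgue_on S. \<bar>C_per_norm (f a)\<bar> \<le> \<bar>g a\<bar>"
    using assms(2,3)
  proof eventually_elim
    case (elim a)
    then show ?case using C_per_norm_nonneg[of "f a"] by simp
  qed
qed

text \<open>Truncating at twice the norm of \<open>f\<close> makes the approximating simple functions dominated.\<close>

lemma test_space_dense_simple:
  assumes S: "S \<in> sets borel" and f: "f \<in> test_space S" and e: "0 < e"
  shows "\<exists>s. simple_function (lebesgue_on S) s \<and> s ` space (lebesgue_on S) \<subseteq> C_per \<and>
           test_norm S (\<lambda>a p. f a p - s a p) < e"
proof -
  let ?M = "lebesgue_on S"
  have fC: "AE a in ?M. f a \<in> C_per" and fm: "strongly_measurable ?M C_per C_per_norm f"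
    using f by (auto simp: bochner_L2_def)
  obtain s where s: "\<And>n::nat. simple_function ?M (s n)"
      "\<And>n. s n ` space ?M \<subseteq> C_per"
      "AE a in ?M. (\<lambda>n. C_per_norm (\<lambda>b. s n a b - f a b)) \<longlonglongrightarrow> 0"
    using fm by (auto simp: strongly_measurable_def)
  have sf: "sqint ?M (\<lambda>a. C_per_norm (f a))"
    by (rule test_space_sqint[OF S f])
  then have [measurable]: "(\<lambda>a. C_per_norm (f a)) \<in> borel_measurable ?M"
    by (simp add: sqint_def)
  have [measurable]: "(\<lambda>a. C_per_norm (s n a)) \<in> borel_measurable ?M" for n
    using borel_measurable_simple_function[OF simple_function_compose1[OF s(1)]] .
  define t where "t n a = (if C_per_norm (s n a) \<le> 2 * C_per_norm (f a) then s n a else (\<lambda>_. 0))" for n a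
  have t: "simple_function ?M (t n)" "t n ` space ?M \<subseteq> C_per" for n
  proof -
    have "{a \<in> space ?M. C_per_norm (s n a) \<le> 2 * C_per_norm (f a)} \<in> sets ?M"
      by measurable
    then show "simple_function ?M (t n)"
      unfolding t_def[abs_def] by (intro simple_function_If s) auto
    show "t n ` space ?M \<subseteq> C_per"
      using s(2)[of n] C_per_const by (auto simp: t_def)
  qed
  have z: "C_per_norm (\<lambda>b. 0) = 0"
    by (simp add: C_per_norm_def closure_cell)
  have tC: "AE a in ?M. (\<lambda>p. f a p - t n a p) \<in> C_per" for n
    using fC AE_space by eventually_elim (use t(2)[of n] in \<open>auto intro!: C_per_diff\<close>)
  have bound: "AE a in ?M. C_per_norm (\<lambda>p. f a p - t n a p) \<le> 3 * C_per_norm (f a)" for n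
    using fC AE_space
  proof eventually_elim
    case (elim a)
    have ta: "t n a \<in> C_per" using t(2)[of n] elim by auto
    have "C_per_norm (t n a) \<le> 2 * C_per_norm (f a)"
      using C_per_norm_nonneg[OF elim(1)] by (simp add: t_def z)
    then show ?case
      using C_per_norm_add[OF elim(1) C_per_cmult[OF ta, of "-1"]] C_per_norm_cmult[OF ta, of "-1"]
      by simp
  qed
  have meas: "(\<lambda>a. C_per_norm (\<lambda>p. f a p - t n a p)) \<in> borel_measurable ?M" for n
  proof -
    have "strongly_measurable ?M C_per C_per_norm (t n)"
      unfolding strongly_measurable_def by (intro exI[of _ "\<lambda>m. t n"]) (use t in \<open>simp add: z\<close>)
    moreover have "AE a in ?M. t n a \<in> C_per" "AE a in ?M. (\<lambda>p. (- 1) * t n a p) \<in> C_per"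
      by (intro AE_I2 C_per_cmult; use t(2)[of n] in auto)+
    ultimately have "strongly_measurable ?M C_per C_per_norm (\<lambda>a p. f a p + (- 1) * t n a p)"
      by (intro strongly_measurable_add strongly_measurable_cmult fm fC)
    then show ?thesis
      by (intro strongly_measurable_norm S tC) simp
  qed
  have "(\<lambda>n. LINT a|?M. (C_per_norm (\<lambda>p. f a p - t n a p))\<^sup>2) \<longlonglongrightarrow> (LINT a|?M. 0)"
  proof (rule integral_dominated_convergence)
    show "integrable ?M (\<lambda>a. (3 * C_per_norm (f a))\<^sup>2)"
      using sqint_cmult[OF sf, of 3] by (simp add: sqint_def)
    show "AE a in ?M. norm ((C_per_norm (\<lambda>p. f a p - t n a p))\<^sup>2) \<le> (3 * C_per_norm (f a))\<^sup>2" for n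
      using bound[of n] tC[of n]
    proof eventually_elim
      case (elim a)
      then show ?case using power_mono[OF elim(1) C_per_norm_nonneg[OF elim(2)], of 2] by simp
    qed
    show "AE a in ?M. (\<lambda>n. (C_per_norm (\<lambda>p. f a p - t n a p))\<^sup>2) \<longlonglongrightarrow> 0"
      using s(3) fC AE_space
    proof eventually_elim
      case (elim a)
      have sC: "s n a \<in> C_per" for n using s(2)[of n] elim by auto
      \<comment> \<open>If \<open>f a\<close> has norm 0, then \<open>t n a\<close> is either
        \<open>s n a\<close> or 0, and both are at a vanishing distance from \<open>f a\<close>. If
        the norm is positive, then \<open>s n a\<close> eventually stays below twice that norm and
        is not truncated any more.\<close>
      have "(\<lambda>n. C_per_norm (\<lambda>p. f a p - t n a p)) \<longlonglongrightarrow> 0"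
      proof (cases "C_per_norm (f a) = 0")
        case True
        have "C_per_norm (\<lambda>p. f a p - t n a p) = C_per_norm (\<lambda>p. s n a p - f a p) \<or>
            C_per_norm (\<lambda>p. f a p - t n a p) = 0" for n
        proof (cases "C_per_norm (s n a) \<le> 2 * C_per_norm (f a)")
          case True
          then have "t n a = s n a" by (simp add: t_def)
          then show ?thesis using C_per_norm_minus[of "f a" "s n a"] by simp
        next
          case False
          then have "t n a = (\<lambda>_. 0)" by (simp add: t_def)
          then show ?thesis using True by simp
        qed
        note d = this
        have "norm (C_per_norm (\<lambda>p. f a p - t n a p)) \<le> norm (C_per_norm (\<lambda>p. s n a p - f a p)) * 1" for n
          by (rule disjE[OF d[of n]]) simp_all
        then show ?thesis
          by (intro tendsto_0_le[OF elim(1)] always_eventually allI)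
      next
        case False
        then have pos: "C_per_norm (f a) > 0" using C_per_norm_nonneg[OF elim(2)] by simp
        from order_tendstoD(2)[OF elim(1) this]
        have ev: "\<forall>\<^sub>F n in sequentially. C_per_norm (\<lambda>b. s n a b - f a b) < C_per_norm (f a)" .
        have "\<forall>\<^sub>F n in sequentially. C_per_norm (\<lambda>b. s n a b - f a b) = C_per_norm (\<lambda>p. f a p - t n a p)"
          using ev
        proof eventually_elim
          case (elim n)
          have "C_per_norm (s n a) \<le> 2 * C_per_norm (f a)"
            using C_per_norm_diff[OF sC[of n] \<open>f a \<in> C_per\<close>] elim by linarith
          then show ?case by (simp add: t_def C_per_norm_minus[of "f a"])
        qed
        from Lim_transform_eventually[OF elim(1) this] show ?thesis .
      qed
      from tendsto_power[OF this, of 2] show ?case by simp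
    qed
  qed (use meas in measurable)
  then have "(\<lambda>n. test_norm S (\<lambda>a p. f a p - t n a p)) \<longlonglongrightarrow> sqrt 0"
    unfolding bochner_L2_norm_def by (intro tendsto_real_sqrt) simp
  then have "(\<lambda>n. test_norm S (\<lambda>a p. f a p - t n a p)) \<longlonglongrightarrow> 0" by simp
  from order_tendstoD(2)[OF this e] obtain n where "test_norm S (\<lambda>a p. f a p - t n a p) < e"
    by (auto dest: eventually_happens)
  with t show ?thesis by blast
qed

section \<open>Iterated integrals\<close>

lemma measurable_lborel_pair:
  fixes f :: "'a::euclidean_space \<times> 'b::euclidean_space \<Rightarrow> 'c::topological_space"
  assumes "f \<in> borel_measurable borel"
  shows "f \<in> borel_measurable (lborel \<Otimes>\<^sub>M lborel)"
  using assms by (simp add: lborel_prod)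

lemma borel_measurable_Pair1:
  fixes f :: "'a::euclidean_space \<times> 'b::euclidean_space \<Rightarrow> 'c::topological_space"
  assumes "f \<in> borel_measurable borel"
  shows "(\<lambda>b. f (a, b)) \<in> borel_measurable borel"
  using assms by (rule measurable_compose[rotated]) (intro borel_measurable_continuous_onI continuous_intros)

lemma AE_lborel_pair:
  fixes P :: "'a::euclidean_space \<times> 'b::euclidean_space \<Rightarrow> bool"
  assumes "AE x in lborel. P x"
  shows "AE a in lborel. AE b in lborel. P (a, b)"
  by (rule lborel_pair.AE_pair) (unfold lborel_prod, rule assms)

text \<open>A cylinder over a null set is null even though its other factor has infinite measure.
  This lifts an exceptional set in \<open>x2\<close> to one in \<open>(x1, x2)\<close>.\<close>

lemma AE_lborel_snd:
  fixes P :: "'b::euclidean_space \<Rightarrow> bool"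
  assumes "AE b in lborel. P b"
  shows "AE x in (lborel :: ('a::euclidean_space \<times> 'b) measure). P (snd x)"
proof -
  obtain N where N: "{b. \<not> P b} \<subseteq> N" "N \<in> null_sets lborel"
    using assms by (auto simp: eventually_ae_filter)
  have "(UNIV :: 'a set) \<times> N \<in> null_sets (lborel \<Otimes>\<^sub>M lborel)"
    using null_setsD1[OF N(2)] null_setsD2[OF N(2)] lborel.emeasure_pair_measure_Times[of "UNIV :: 'a set" lborel N]
    by (intro null_setsI) auto
  then show ?thesis
    unfolding lborel_prod by (rule AE_I') (use N in auto)
qed

lemma nn_integral_lborel_pair:
  fixes f :: "'a::euclidean_space \<times> 'b::euclidean_space \<Rightarrow> ennreal"
  assumes "f \<in> borel_measurable borel"
  shows "(\<integral>\<^sup>+ x. f x \<partial>lborel) = (\<integral>\<^sup>+ a. \<integral>\<^sup>+ b. f (a, b) \<partial>lborel \<partial>lborel)"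
  using lborel.nn_integral_fst[OF measurable_lborel_pair[OF assms]] by (simp add: lborel_prod)

lemma borel_measurable_nn_integral_Pair1:
  fixes f :: "'a::euclidean_space \<times> 'b::euclidean_space \<Rightarrow> ennreal"
  assumes "f \<in> borel_measurable borel"
  shows "(\<lambda>a. \<integral>\<^sup>+ b. f (a, b) \<partial>lborel) \<in> borel_measurable borel"
  using lborel.borel_measurable_nn_integral_fst[OF measurable_lborel_pair[OF assms]] by simp

lemma borel_measurable_integral_Pair1:
  fixes f :: "'a::euclidean_space \<times> 'b::euclidean_space \<Rightarrow> real"
  assumes "f \<in> borel_measurable borel"
  shows "(\<lambda>a. LINT b|lborel. f (a, b)) \<in> borel_measurable borel"
  using lborel.borel_measurable_lebesgue_integral[of "\<lambda>a b. f (a, b)" lborel]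
    measurable_lborel_pair[OF assms] by simp

lemma integral_lborel_pair:
  fixes f :: "'a::euclidean_space \<times> 'b::euclidean_space \<Rightarrow> real"
  assumes "integrable lborel f"
  shows "(LINT x|lborel. f x) = (LINT a|lborel. LINT b|lborel. f (a, b))"
    and "AE a in lborel. integrable lborel (\<lambda>b. f (a, b))"
    and "integrable lborel (\<lambda>a. LINT b|lborel. f (a, b))"
proof -
  have f: "integrable (lborel \<Otimes>\<^sub>M lborel) f"
    using assms by (simp add: lborel_prod)
  show "(LINT x|lborel. f x) = (LINT a|lborel. LINT b|lborel. f (a, b))"
    using lborel_pair.integral_fst'[OF f] by (simp add: lborel_prod)
  show "AE a in lborel. integrable lborel (\<lambda>b. f (a, b))"
    by (rule lborel_pair.AE_integrable_fst'[OF f])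
  show "integrable lborel (\<lambda>a. LINT b|lborel. f (a, b))"
    by (rule lborel_pair.integrable_fst'[OF f])
qed

text \<open>Test functions take \<open>(t, x2)\<close> as a single argument \<open>a\<close>, while
  the limit domain is a right-nested product; this regroups the variables accordingly.\<close>

lemma nn_integral_lborel_assoc:
  fixes f :: "'a::euclidean_space \<times> 'b::euclidean_space \<times> 'c::euclidean_space \<Rightarrow> ennreal"
  assumes f: "f \<in> borel_measurable borel"
  shows "(\<integral>\<^sup>+ x. f x \<partial>lborel) = (\<integral>\<^sup>+ a. \<integral>\<^sup>+ r. f (fst a, snd a, r) \<partial>lborel \<partial>lborel)"
proof -
  have g: "(\<lambda>x. f (fst (fst x), snd (fst x), snd x)) \<in> borel_measurable borel"
    by (rule measurable_compose[OF _ f]) (intro borel_measurable_continuous_onI continuous_intros)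
  have "(\<integral>\<^sup>+ x. f x \<partial>lborel) = (\<integral>\<^sup>+ a. \<integral>\<^sup>+ b. \<integral>\<^sup>+ c. f (a, b, c) \<partial>lborel \<partial>lborel \<partial>lborel)"
    by (simp add: nn_integral_lborel_pair[OF f] nn_integral_lborel_pair[OF borel_measurable_Pair1[OF f]])
  also have "\<dots> = (\<integral>\<^sup>+ a. \<integral>\<^sup>+ r. f (fst a, snd a, r) \<partial>lborel \<partial>lborel)"
    using nn_integral_lborel_pair[OF borel_measurable_nn_integral_Pair1[OF g]] by simp
  finally show ?thesis .
qed

text \<open>One variable of an iterated integral over \<open>lebesgue_on\<close>; iterating it turns nested
  integrals into a single integral over a product.\<close>

lemma nested_integral_step:
  fixes F :: "'a::euclidean_space \<times> 'b::euclidean_space \<Rightarrow> real"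
  assumes A: "A \<in> sets borel" and B: "B \<in> sets borel" and F: "F \<in> borel_measurable borel"
    and int: "integrable lborel (\<lambda>p. indicator (A \<times> B) p * F p)"
    and G: "AE x in lborel. x \<in> A \<longrightarrow> integrable lborel (\<lambda>y. indicator B y * F (x, y)) \<longrightarrow>
              G x = (LINT y|lborel. indicator B y * F (x, y))"
  shows "(LINT x|lebesgue_on A. G x) = (LINT p|lborel. indicator (A \<times> B) p * F p)"
proof -
  have "(\<lambda>p. indicator B (snd p) * F p) \<in> borel_measurable borel"
  proof (intro borel_measurable_times F)
    show "(\<lambda>p :: 'a \<times> 'b. indicator B (snd p) :: real) \<in> borel_measurable borel"
      by (rule measurable_compose[OF _ borel_measurable_indicator[OF B]])
         (intro borel_measurable_continuous_onI continuous_intros)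
  qed
  from borel_measurable_integral_Pair1[OF this]
  have m: "(\<lambda>x. LINT y|lborel. indicator B y * F (x, y)) \<in> borel_measurable borel" by simp
  \<comment> \<open>Fubini discharges the integrability premise of \<open>G\<close> almost
    everywhere. That premise is what the next nesting level receives as its own integrability
    assumption.\<close>
  have "AE x in lborel. x \<in> A \<longrightarrow> G x = (LINT y|lborel. indicator B y * F (x, y))"
    using G integral_lborel_pair(2)[OF int]
  proof eventually_elim
    case (elim x)
    show ?case
    proof
      assume "x \<in> A"
      with elim show "G x = (LINT y|lborel. indicator B y * F (x, y))"
        by (simp add: indicator_times)
    qed
  qed
  from lebesgue_on_integral_cong_borel[OF A m this]
  have "(LINT x|lebesgue_on A. G x) = (LINT x|lborel. LINT y|lborel. indicator (A \<times> B) (x, y) * F (x, y))"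
    by (simp add: indicator_times mult.assoc)
  also have "\<dots> = (LINT p|lborel. indicator (A \<times> B) p * F p)"
    using integral_lborel_pair(1)[OF int] by simp
  finally show ?thesis .
qed

section \<open>Borel representatives of test functions\<close>

lemma strip_borel: "strip \<in> sets borel"
  by (intro borel_closed closed_Times) auto

text \<open>The exceptional set lies in \<open>a\<close> alone: for almost every \<open>a\<close>,
  sup-norm convergence of the simple functions gives convergence at every point of the strip.
  Equality merely almost everywhere in \<open>(a, p)\<close> would say nothing on the graph along
  which the oscillating function evaluates \<open>\<Phi>\<close>.\<close>

lemma test_space_representative:
  assumes S: "S \<in> sets borel" and f: "\<phi> \<in> test_space S"
  obtains \<Phi> m where "\<Phi> \<in> borel_measurable borel" "m \<in> borel_measurable borel"
    "AE a in lborel. a \<in> S \<longrightarrow> \<phi> a \<in> C_per \<and> (\<forall>p\<in>strip. \<phi> a p = \<Phi> (a, p)) \<and> C_per_norm (\<phi> a) = m a"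
    "(\<integral>\<^sup>+ a. indicator S a * ennreal ((m a)\<^sup>2) \<partial>lborel) = ennreal ((test_norm S \<phi>)\<^sup>2)"
proof -
  let ?M = "lebesgue_on S"
  have fC: "AE a in ?M. \<phi> a \<in> C_per" and fm: "strongly_measurable ?M C_per C_per_norm \<phi>"
    using f by (auto simp: bochner_L2_def)
  obtain s where s: "\<And>n::nat. simple_function ?M (s n)"
      "\<And>n. s n ` space ?M \<subseteq> C_per"
      "AE a in ?M. (\<lambda>n. C_per_norm (\<lambda>b. s n a b - \<phi> a b)) \<longlonglongrightarrow> 0"
    using fm by (auto simp: strongly_measurable_def)
  have "\<exists>s'. \<forall>n. simple_function (lborel :: (real \<times> real) measure) (s' n) \<and>
      (AE x in lborel. x \<in> S \<longrightarrow> s n x = s' n x)"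
    using lebesgue_on_simple_function_borel[OF S s(1)] by (intro choice) blast
  then obtain s' where s': "\<And>n. simple_function (lborel :: (real \<times> real) measure) (s' n)"
      "\<And>n. AE x in lborel. x \<in> S \<longrightarrow> s n x = s' n x"
    by blast
  \<comment> \<open>Members of \<open>C_per\<close> are controlled only on the strip, and off
    \<open>S\<close> the Borel version \<open>s'\<close> may take values outside
    \<open>C_per\<close>; both cases are cut off to 0. As \<open>s' n\<close> has finitely many
    values, measurability of \<open>u n\<close> can be checked for one fixed value at a time,
    without a measurable structure on the function space.\<close>
  define u where "u n x = (if s' n (fst x) \<in> C_per then indicator strip (snd x) * s' n (fst x) (snd x) else 0)"
    for n and x :: "(real \<times> real) \<times> real \<times> (real \<times> real) \<times> real"
  have u[measurable]: "u n \<in> borel_measurable borel" for n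
  proof -
    have "(\<lambda>x :: (real \<times> real) \<times> real \<times> (real \<times> real) \<times> real.
        (\<lambda>w x. if w \<in> C_per then indicator strip (snd x) * w (snd x) else 0) (s' n (fst x)) x)
        \<in> borel_measurable borel"
    proof (rule measurable_compose_countable'[where I = "range (s' n)" and g = "\<lambda>x. s' n (fst x)"
          and f = "\<lambda>w x. if w \<in> C_per then indicator strip (snd x) * w (snd x) else 0"])
      show "(\<lambda>x. if w \<in> C_per then indicator strip (snd x) * w (snd x) else 0 :: real)
          \<in> borel_measurable (borel :: ((real \<times> real) \<times> real \<times> (real \<times> real) \<times> real) measure)" for w
      proof (cases "w \<in> C_per")
        case True
        then have "(\<lambda>x. indicator strip x *\<^sub>R w x) \<in> borel_measurable borel"
          by (intro borel_measurable_continuous_on_indicator strip_borel) (auto simp: C_per_def)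
        then have "(\<lambda>x :: (real \<times> real) \<times> real \<times> (real \<times> real) \<times> real. indicator strip (snd x) *\<^sub>R w (snd x)) \<in> borel_measurable borel"
          by (rule measurable_compose[rotated]) (intro borel_measurable_continuous_onI continuous_intros)
        with True show ?thesis by simp
      qed simp
      have "s' n \<in> measurable borel (count_space (range (s' n)))"
        using s'(1)[of n] by (simp add: simple_function_def measurable_count_space_eq2)
      then show "(\<lambda>x :: (real \<times> real) \<times> real \<times> (real \<times> real) \<times> real. s' n (fst x)) \<in> measurable borel (count_space (range (s' n)))"
        by (rule measurable_compose[rotated]) (intro borel_measurable_continuous_onI continuous_intros)
      show "countable (range (s' n))"
        using simple_functionD(1)[OF s'(1)[of n]] by (intro countable_finite) simp
    qed
    then show ?thesis by (simp add: u_def[abs_def])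
  qed
  define \<Phi> where "\<Phi> x = lim (\<lambda>n. u n x)" for x
  have \<Phi>: "\<Phi> \<in> borel_measurable borel"
    unfolding \<Phi>_def by measurable
  have sf: "sqint ?M (\<lambda>a. C_per_norm (\<phi> a))"
    by (rule test_space_sqint[OF S f])
  then obtain m where m [measurable]: "m \<in> borel_measurable borel" and
      m': "AE a in lborel. a \<in> S \<longrightarrow> C_per_norm (\<phi> a) = m a"
    using lebesgue_on_borel_representative[OF S, of "\<lambda>a. C_per_norm (\<phi> a)"] by (auto simp: sqint_def)
  have "AE a in lborel. \<forall>n. a \<in> S \<longrightarrow> s n a = s' n a"
    unfolding AE_all_countable using s'(2) by blast
  moreover have "AE a in lborel. a \<in> S \<longrightarrow> (\<lambda>n. C_per_norm (\<lambda>b. s n a b - \<phi> a b)) \<longlonglongrightarrow> 0"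
    using s(3) S by (simp add: AE_lebesgue_on)
  moreover have "AE a in lborel. a \<in> S \<longrightarrow> \<phi> a \<in> C_per"
    using fC S by (simp add: AE_lebesgue_on)
  ultimately have main: "AE a in lborel. a \<in> S \<longrightarrow> \<phi> a \<in> C_per \<and> (\<forall>p\<in>strip. \<phi> a p = \<Phi> (a, p)) \<and> C_per_norm (\<phi> a) = m a"
    using m'
  proof eventually_elim
    case (elim a)
    show ?case
    proof (intro impI conjI ballI)
      assume a: "a \<in> S"
      with elim show "\<phi> a \<in> C_per" "C_per_norm (\<phi> a) = m a" by auto
      have lim: "(\<lambda>n. C_per_norm (\<lambda>b. s n a b - \<phi> a b)) \<longlonglongrightarrow> 0" using elim a by blast
      fix p assume p: "p \<in> strip"
      have sC: "s n a \<in> C_per" for n using s(2)[of n] a by auto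
      have un: "u n (a, p) = s n a p" for n
        using elim(1) a sC[of n] p by (simp add: u_def)
      have "(\<lambda>n. s n a p - \<phi> a p) \<longlonglongrightarrow> 0"
        by (rule Lim_null_comparison[OF always_eventually lim])
           (use C_per_le_norm[OF C_per_diff[OF sC \<open>\<phi> a \<in> C_per\<close>] p] in auto)
      then have "(\<lambda>n. u n (a, p)) \<longlonglongrightarrow> \<phi> a p"
        by (simp add: LIM_zero_iff un)
      then show "\<phi> a p = \<Phi> (a, p)"
        by (simp add: \<Phi>_def limI)
    qed
  qed
  have m2: "AE a in lborel. a \<in> S \<longrightarrow> (C_per_norm (\<phi> a))\<^sup>2 = (m a)\<^sup>2"
    using m' by eventually_elim simp
  have "integrable lborel (\<lambda>a. indicator S a * (m a)\<^sup>2)"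
    using sf lebesgue_on_integrable_cong_borel[OF S _ m2] by (simp add: sqint_def)
  then have "(\<integral>\<^sup>+ a. ennreal (indicator S a * (m a)\<^sup>2) \<partial>lborel) = ennreal (LINT a|lborel. indicator S a * (m a)\<^sup>2)"
    by (rule nn_integral_eq_integral) simp
  also have "(LINT a|lborel. indicator S a * (m a)\<^sup>2) = (test_norm S \<phi>)\<^sup>2"
    using lebesgue_on_integral_cong_borel[OF S _ m2] by (simp add: test_norm_norm2 norm2_power2)
  finally have "(\<integral>\<^sup>+ a. indicator S a * ennreal ((m a)\<^sup>2) \<partial>lborel) = ennreal ((test_norm S \<phi>)\<^sup>2)"
    by (simp add: ennreal_mult' ennreal_indicator)
  with that \<Phi> m main show ?thesis by blast
qed

section \<open>The pairing with the sequence\<close>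

context
  fixes I :: "real set" and \<Omega> :: "'b::euclidean_space set"
    and v :: "real \<Rightarrow> 'b \<Rightarrow> real" and \<psi> :: "real \<times> 'b \<Rightarrow> real" and F :: "real \<Rightarrow> 'b \<Rightarrow> real"
  assumes I: "I \<in> sets borel" and \<Omega>: "\<Omega> \<in> sets borel"
    and v: "v \<in> bochner_L2 I (L2_space \<Omega>) (L2_norm \<Omega>)"
    and \<psi>: "\<psi> \<in> borel_measurable borel"
    and \<psi>2: "integrable lborel (\<lambda>p. indicator (I \<times> \<Omega>) p * (\<psi> p)\<^sup>2)"
    and F: "AE t in lborel. t \<in> I \<longrightarrow> (AE x in lborel. x \<in> \<Omega> \<longrightarrow> F t x = \<psi> (t, x))"
begin

private lemma \<psi>_section [measurable]: "(\<lambda>x. \<psi> (t, x)) \<in> borel_measurable borel"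
  by (rule borel_measurable_Pair1[OF \<psi>])

private lemma F_sqint: "AE t in lebesgue_on I. sqint (lebesgue_on \<Omega>) (F t) \<and>
    (norm2 (lebesgue_on \<Omega>) (F t))\<^sup>2 = (LINT x|lborel. indicator \<Omega> x * (\<psi> (t, x))\<^sup>2)"
proof -
  have "AE t in lborel. t \<in> I \<longrightarrow> sqint (lebesgue_on \<Omega>) (F t) \<and>
    (norm2 (lebesgue_on \<Omega>) (F t))\<^sup>2 = (LINT x|lborel. indicator \<Omega> x * (\<psi> (t, x))\<^sup>2)"
    using F integral_lborel_pair(2)[OF \<psi>2]
  proof eventually_elim
    case (elim t)
    show ?case
    proof
      assume t: "t \<in> I"
      with elim have ae: "AE x in lborel. x \<in> \<Omega> \<longrightarrow> F t x = \<psi> (t, x)" by blast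
      then have ae2: "AE x in lborel. x \<in> \<Omega> \<longrightarrow> (F t x)\<^sup>2 = (\<psi> (t, x))\<^sup>2"
        by eventually_elim simp
      have m2: "(\<lambda>x. (\<psi> (t, x))\<^sup>2) \<in> borel_measurable borel" by measurable
      have "integrable lborel (\<lambda>x. indicator \<Omega> x * (\<psi> (t, x))\<^sup>2)"
        using elim(2) t by (simp add: indicator_times)
      then show "sqint (lebesgue_on \<Omega>) (F t) \<and>
        (norm2 (lebesgue_on \<Omega>) (F t))\<^sup>2 = (LINT x|lborel. indicator \<Omega> x * (\<psi> (t, x))\<^sup>2)"
        using lebesgue_on_measurable_cong_borel[OF \<Omega> \<psi>_section ae]
          lebesgue_on_integrable_cong_borel[OF \<Omega> m2 ae2] lebesgue_on_integral_cong_borel[OF \<Omega> m2 ae2]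
        by (simp add: sqint_def norm2_power2)
    qed
  qed
  then show ?thesis using I by (subst AE_lebesgue_on)
qed

private lemma F_norm: "sqint (lebesgue_on I) (\<lambda>t. norm2 (lebesgue_on \<Omega>) (F t))"
  "norm2 (lebesgue_on I) (\<lambda>t. norm2 (lebesgue_on \<Omega>) (F t))
     = sqrt (LINT p|lborel. indicator (I \<times> \<Omega>) p * (\<psi> p)\<^sup>2)"
proof -
  have "(\<lambda>p. indicator \<Omega> (snd p) * (\<psi> p)\<^sup>2) \<in> borel_measurable borel"
  proof (intro borel_measurable_times borel_measurable_power \<psi>)
    show "(\<lambda>p :: real \<times> 'b. indicator \<Omega> (snd p) :: real) \<in> borel_measurable borel"
      by (rule measurable_compose[OF _ borel_measurable_indicator[OF \<Omega>]])
         (intro borel_measurable_continuous_onI continuous_intros)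
  qed
  from borel_measurable_integral_Pair1[OF this]
  have m: "(\<lambda>t. LINT x|lborel. indicator \<Omega> x * (\<psi> (t, x))\<^sup>2) \<in> borel_measurable borel" by simp
  have ae2: "AE t in lborel. t \<in> I \<longrightarrow> (norm2 (lebesgue_on \<Omega>) (F t))\<^sup>2 = (LINT x|lborel. indicator \<Omega> x * (\<psi> (t, x))\<^sup>2)"
    using F_sqint I by (auto simp: AE_lebesgue_on elim: eventually_mono)
  then have ae1: "AE t in lborel. t \<in> I \<longrightarrow> norm2 (lebesgue_on \<Omega>) (F t) = sqrt (LINT x|lborel. indicator \<Omega> x * (\<psi> (t, x))\<^sup>2)"
    by eventually_elim (metis norm2_nonneg real_sqrt_abs abs_of_nonneg)
  have eq: "indicator I t * (LINT x|lborel. indicator \<Omega> x * (\<psi> (t, x))\<^sup>2)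
      = (LINT x|lborel. indicator (I \<times> \<Omega>) (t, x) * (\<psi> (t, x))\<^sup>2)" for t
    by (simp add: indicator_times mult.assoc)
  have "integrable (lebesgue_on I) (\<lambda>t. (norm2 (lebesgue_on \<Omega>) (F t))\<^sup>2)"
    unfolding lebesgue_on_integrable_cong_borel[OF I m ae2] eq
    using integral_lborel_pair(3)[OF \<psi>2] by simp
  moreover have "(\<lambda>t. norm2 (lebesgue_on \<Omega>) (F t)) \<in> borel_measurable (lebesgue_on I)"
    by (rule lebesgue_on_measurable_cong_borel[OF I _ ae1]) (use m in measurable)
  ultimately show "sqint (lebesgue_on I) (\<lambda>t. norm2 (lebesgue_on \<Omega>) (F t))"
    by (simp add: sqint_def)
  show "norm2 (lebesgue_on I) (\<lambda>t. norm2 (lebesgue_on \<Omega>) (F t))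
     = sqrt (LINT p|lborel. indicator (I \<times> \<Omega>) p * (\<psi> p)\<^sup>2)"
    unfolding norm2_def[of "lebesgue_on I"] lebesgue_on_integral_cong_borel[OF I m ae2] eq
    using integral_lborel_pair(1)[OF \<psi>2] by simp
qed

text \<open>For a fixed \<open>w\<close> in \<open>L^2\<close>, the pairing with
  \<open>\<psi> (t, x)\<close> is measurable in \<open>t\<close> by Fubini. A simple function takes
  finitely many such values, and Cauchy-Schwarz in \<open>x\<close> transfers the limit of the
  simple approximations to \<open>v\<close>, so joint measurability of \<open>v\<close> is
  avoided.\<close>

private lemma pairing_measurable:
  "(\<lambda>t. LINT x|lebesgue_on \<Omega>. v t x * F t x) \<in> borel_measurable (lebesgue_on I)"
proof -
  interpret complete_measure "lebesgue_on I"
    using I by (intro complete_measure_lebesgue_on) simp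
  obtain s where s: "\<And>n::nat. simple_function (lebesgue_on I) (s n)"
      "\<And>n. s n ` space (lebesgue_on I) \<subseteq> L2_space \<Omega>"
      "AE t in lebesgue_on I. (\<lambda>n. L2_norm \<Omega> (\<lambda>x. s n t x - v t x)) \<longlonglongrightarrow> 0"
    and vL: "AE t in lebesgue_on I. v t \<in> L2_space \<Omega>"
    using v by (auto simp: bochner_L2_def strongly_measurable_def)
  have [measurable]: "(\<lambda>t. LINT x|lebesgue_on \<Omega>. s n t x * \<psi> (t, x)) \<in> borel_measurable (lebesgue_on I)" for n
  proof (rule measurable_compose_countable'[where I = "s n ` space (lebesgue_on I)" and g = "s n"
        and f = "\<lambda>w t. LINT x|lebesgue_on \<Omega>. w x * \<psi> (t, x)"])
    fix w assume "w \<in> s n ` space (lebesgue_on I)"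
    then have "w \<in> borel_measurable (lebesgue_on \<Omega>)"
      using s(2)[of n] by (auto simp: L2_space_def)
    then obtain w' where w': "w' \<in> borel_measurable borel" "AE x in lborel. x \<in> \<Omega> \<longrightarrow> w x = w' x"
      using lebesgue_on_borel_representative[OF \<Omega>] by blast
    have "(LINT x|lebesgue_on \<Omega>. w x * \<psi> (t, x)) = (LINT x|lborel. indicator \<Omega> x * (w' x * \<psi> (t, x)))" for t
    proof (rule lebesgue_on_integral_cong_borel[OF \<Omega>])
      show "(\<lambda>x. w' x * \<psi> (t, x)) \<in> borel_measurable borel" using w'(1) by measurable
      show "AE x in lborel. x \<in> \<Omega> \<longrightarrow> w x * \<psi> (t, x) = w' x * \<psi> (t, x)"
        using w'(2) by eventually_elim simp
    qed
    moreover have "(\<lambda>t. LINT x|lborel. indicator \<Omega> x * (w' x * \<psi> (t, x))) \<in> borel_measurable borel"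
    proof -
      have s: "(snd :: real \<times> 'b \<Rightarrow> 'b) \<in> borel_measurable borel"
        by (intro borel_measurable_continuous_onI continuous_intros)
      have "(\<lambda>p. indicator \<Omega> (snd p) * (w' (snd p) * \<psi> p)) \<in> borel_measurable borel"
        by (intro borel_measurable_times \<psi> measurable_compose[OF s borel_measurable_indicator[OF \<Omega>]]
            measurable_compose[OF s w'(1)])
      from borel_measurable_integral_Pair1[OF this] show ?thesis by simp
    qed
    ultimately show "(\<lambda>t. LINT x|lebesgue_on \<Omega>. w x * \<psi> (t, x)) \<in> borel_measurable (lebesgue_on I)"
      by (auto intro!: measurable_restrict_space1 measurable_completion)
  next
    show "s n \<in> lebesgue_on I \<rightarrow>\<^sub>M count_space (s n ` space (lebesgue_on I))"
      using s(1)[of n] by (simp add: simple_function_def measurable_count_space_eq2)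
    show "countable (s n ` space (lebesgue_on I))"
      using simple_functionD(1)[OF s(1)[of n]] by (rule countable_finite)
  qed
  have FA: "AE t in lebesgue_on I. AE x in lborel. x \<in> \<Omega> \<longrightarrow> F t x = \<psi> (t, x)"
    using F I by (simp add: AE_lebesgue_on)
  show ?thesis
  proof (rule measurable_AE_cong)
    show "(\<lambda>t. lim (\<lambda>n. LINT x|lebesgue_on \<Omega>. s n t x * \<psi> (t, x))) \<in> borel_measurable (lebesgue_on I)"
      by measurable
    show "AE t in lebesgue_on I. (LINT x|lebesgue_on \<Omega>. v t x * F t x) = lim (\<lambda>n. LINT x|lebesgue_on \<Omega>. s n t x * \<psi> (t, x))"
      using s(3) vL F_sqint AE_space FA
    proof eventually_elim
      case (elim t)
      have sL: "sqint (lebesgue_on \<Omega>) (s n t)" for n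
        using s(2)[of n] elim(4) by (auto simp: L2_space_sqint)
      have vt: "sqint (lebesgue_on \<Omega>) (v t)" and Ft: "sqint (lebesgue_on \<Omega>) (F t)"
        using elim by (auto simp: L2_space_sqint)
      have eq: "(LINT x|lebesgue_on \<Omega>. s n t x * \<psi> (t, x)) = (LINT x|lebesgue_on \<Omega>. s n t x * F t x)" for n
      proof (rule integral_cong_AE)
        have [measurable]: "s n t \<in> borel_measurable (lebesgue_on \<Omega>)" "F t \<in> borel_measurable (lebesgue_on \<Omega>)"
          "(\<lambda>x. \<psi> (t, x)) \<in> borel_measurable (lebesgue_on \<Omega>)"
          using sL[of n] Ft \<psi>_section by (auto simp: sqint_def intro!: measurable_restrict_space1 measurable_completion)
        show "(\<lambda>x. s n t x * \<psi> (t, x)) \<in> borel_measurable (lebesgue_on \<Omega>)"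
          "(\<lambda>x. s n t x * F t x) \<in> borel_measurable (lebesgue_on \<Omega>)" by measurable
        have "AE x in lebesgue_on \<Omega>. F t x = \<psi> (t, x)"
          using elim(5) \<Omega> by (simp add: AE_lebesgue_on)
        then show "AE x in lebesgue_on \<Omega>. s n t x * \<psi> (t, x) = s n t x * F t x"
          by eventually_elim simp
      qed
      have lim: "(\<lambda>n. L2_norm \<Omega> (\<lambda>x. s n t x - v t x) * norm2 (lebesgue_on \<Omega>) (F t)) \<longlonglongrightarrow> 0"
        by (intro tendsto_mult_left_zero elim)
      have "(\<lambda>n. (LINT x|lebesgue_on \<Omega>. s n t x * F t x) - (LINT x|lebesgue_on \<Omega>. v t x * F t x)) \<longlonglongrightarrow> 0"
      proof (rule Lim_null_comparison[OF always_eventually lim], rule allI)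
        fix n
        have "(LINT x|lebesgue_on \<Omega>. s n t x * F t x) - (LINT x|lebesgue_on \<Omega>. v t x * F t x)
          = (LINT x|lebesgue_on \<Omega>. (s n t x - v t x) * F t x)"
          using sL[of n] vt Ft by (simp add: left_diff_distrib integrable_mult_sqint)
        then show "norm ((LINT x|lebesgue_on \<Omega>. s n t x * F t x) - (LINT x|lebesgue_on \<Omega>. v t x * F t x))
            \<le> L2_norm \<Omega> (\<lambda>x. s n t x - v t x) * norm2 (lebesgue_on \<Omega>) (F t)"
          using norm2_Cauchy_Schwarz[OF sqint_diff[OF sL[of n] vt] Ft] by (simp add: L2_norm_norm2)
      qed
      then show ?case
        by (simp add: LIM_zero_iff eq limI)
    qed
  qed simp
qed

text \<open>Cauchy-Schwarz is applied twice, first in \<open>x\<close> for almost every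
  \<open>t\<close> and then in \<open>t\<close>. The integral of the square of \<open>\<psi>\<close>
  is kept as it stands, so that it can later be estimated either by a supremum or by its
  limit.\<close>

lemma pairing:
  shows "AE t in lebesgue_on I. integrable (lebesgue_on \<Omega>) (\<lambda>x. v t x * F t x)"
    and "integrable (lebesgue_on I) (\<lambda>t. LINT x|lebesgue_on \<Omega>. v t x * F t x)"
    and "\<bar>LINT t|lebesgue_on I. LINT x|lebesgue_on \<Omega>. v t x * F t x\<bar>
      \<le> bochner_L2_norm I (L2_norm \<Omega>) v * sqrt (LINT p|lborel. indicator (I \<times> \<Omega>) p * (\<psi> p)\<^sup>2)"
proof -
  let ?n = "\<lambda>t. norm2 (lebesgue_on \<Omega>) (F t)" and ?w = "\<lambda>t. L2_norm \<Omega> (v t)"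
  have vL: "AE t in lebesgue_on I. v t \<in> L2_space \<Omega>"
    using v by (auto simp: bochner_L2_def)
  show "AE t in lebesgue_on I. integrable (lebesgue_on \<Omega>) (\<lambda>x. v t x * F t x)"
    using vL F_sqint by eventually_elim (simp add: L2_space_sqint integrable_mult_sqint)
  have w: "sqint (lebesgue_on I) ?w"
  proof -
    have i: "integrable (lebesgue_on I) (\<lambda>t. (?w t)\<^sup>2)"
      using v by (auto simp: bochner_L2_def)
    \<comment> \<open>Membership in the Bochner space speaks about the squared norm; measurability
      of the norm itself is recovered by a square root.\<close>
    then have "(\<lambda>t. sqrt ((?w t)\<^sup>2)) \<in> borel_measurable (lebesgue_on I)" by measurable
    then show ?thesis using i by (simp add: sqint_def L2_norm_norm2)
  qed
  have bound: "AE t in lebesgue_on I. norm (LINT x|lebesgue_on \<Omega>. v t x * F t x) \<le> ?w t * ?n t"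
    using vL F_sqint
  proof eventually_elim
    case (elim t)
    then show ?case
      using norm2_Cauchy_Schwarz[of "lebesgue_on \<Omega>" "v t" "F t"] by (simp add: L2_space_sqint L2_norm_norm2)
  qed
  have wn: "integrable (lebesgue_on I) (\<lambda>t. ?w t * ?n t)"
    by (rule integrable_mult_sqint[OF w F_norm(1)])
  show int: "integrable (lebesgue_on I) (\<lambda>t. LINT x|lebesgue_on \<Omega>. v t x * F t x)"
    by (rule Bochner_Integration.integrable_bound[OF wn pairing_measurable])
       (use bound in eventually_elim, simp add: L2_norm_norm2)
  have "\<bar>LINT t|lebesgue_on I. LINT x|lebesgue_on \<Omega>. v t x * F t x\<bar>
      \<le> (LINT t|lebesgue_on I. \<bar>LINT x|lebesgue_on \<Omega>. v t x * F t x\<bar>)"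
    by (rule integral_abs_bound)
  also have "\<dots> \<le> (LINT t|lebesgue_on I. ?w t * ?n t)"
    by (rule integral_mono_AE) (use int wn bound in auto)
  also have "\<dots> \<le> norm2 (lebesgue_on I) ?w * norm2 (lebesgue_on I) ?n"
    using norm2_Cauchy_Schwarz[OF w F_norm(1)] by simp
  also have "\<dots> = bochner_L2_norm I (L2_norm \<Omega>) v * sqrt (LINT p|lborel. indicator (I \<times> \<Omega>) p * (\<psi> p)\<^sup>2)"
    unfolding F_norm(2) by (simp add: bochner_L2_norm_def norm2_def)
  finally show "\<bar>LINT t|lebesgue_on I. LINT x|lebesgue_on \<Omega>. v t x * F t x\<bar>
      \<le> bochner_L2_norm I (L2_norm \<Omega>) v * sqrt (LINT p|lborel. indicator (I \<times> \<Omega>) p * (\<psi> p)\<^sup>2)" .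
qed

end

section \<open>Estimates for test functions\<close>

abbreviation space_time :: "real \<Rightarrow> real \<Rightarrow> (real \<times> real) set" where
  "space_time h T \<equiv> {0<..<T} \<times> Sigma_M h"

abbreviation (input) limit_domain :: "real \<Rightarrow> real \<Rightarrow> (real \<times> real \<times> real \<times> (real \<times> real) \<times> real) set" where
  "limit_domain h T \<equiv> {0<..<T} \<times> Sigma_M h \<times> T_cell \<times> Y_cell \<times> Z_cell"

definition oscillate :: "real \<Rightarrow> real \<times> real \<times> real \<Rightarrow> (real \<times> real) \<times> real \<times> (real \<times> real) \<times> real" where
  "oscillate \<epsilon> p = ((fst p, snd (snd p)),
     (fst p / \<epsilon>, (fst (snd p) / \<epsilon>, snd (snd p) / \<epsilon>), snd (snd p) / \<epsilon>\<^sup>2))"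

abbreviation oscillating ::
  "real \<Rightarrow> (real \<times> real \<Rightarrow> real \<times> (real \<times> real) \<times> real \<Rightarrow> real) \<Rightarrow> real \<Rightarrow> real \<times> real \<Rightarrow> real" where
  "oscillating \<epsilon> \<phi> t x \<equiv> \<phi> (t, snd x) (t / \<epsilon>, (fst x / \<epsilon>, snd x / \<epsilon>), snd x / \<epsilon>\<^sup>2)"

definition uncurry_test ::
  "(real \<times> real \<Rightarrow> real \<times> (real \<times> real) \<times> real \<Rightarrow> real) \<Rightarrow> real \<times> real \<times> real \<times> (real \<times> real) \<times> real \<Rightarrow> real" where
  "uncurry_test \<phi> q = \<phi> (fst q, fst (snd q)) (snd (snd q))"

lemma domain_borel:
  "{0<..<T::real} \<in> sets borel" "Sigma_M h \<in> sets borel" "space_time h T \<in> sets borel"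
  "Omega_M h \<epsilon> \<in> sets borel" "T_cell \<in> sets borel" "Y_cell \<in> sets borel" "Z_cell \<in> sets borel"
  "Y_cell \<times> Z_cell \<in> sets borel" "cell \<in> sets borel" "Sigma_M h \<times> cell \<in> sets borel"
  "limit_domain h T \<in> sets borel"
  unfolding Sigma_M_def Omega_M_def T_cell_def Y_cell_def Z_cell_def
  by (intro borel_open open_Times open_greaterThanLessThan)+

lemma cell_subset_strip: "cell \<subseteq> strip"
  by (auto simp: Y_cell_def)

lemma oscillate_borel: "\<Phi> \<in> borel_measurable borel \<Longrightarrow> (\<lambda>p. \<Phi> (oscillate \<epsilon> p) :: real) \<in> borel_measurable borel"
  unfolding oscillate_def divide_inverse
  by (rule measurable_compose[rotated], assumption)
     (intro borel_measurable_continuous_onI continuous_intros)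

lemma oscillate_strip:
  assumes "0 < \<epsilon>" "x \<in> Omega_M h \<epsilon>"
  shows "snd (oscillate \<epsilon> (t, x)) \<in> strip"
  using assms by (auto simp: oscillate_def Omega_M_def field_simps)

lemma emeasure_cell: "emeasure lborel cell = 1"
proof -
  have l: "emeasure lborel (A \<times> B) = emeasure lborel A * emeasure lborel B"
    if "A \<in> sets borel" "B \<in> sets borel" for A :: "'a::euclidean_space set" and B :: "'b::euclidean_space set"
    using that lborel.emeasure_pair_measure_Times[of A lborel B] by (simp add: lborel_prod)
  have "emeasure lborel Y_cell = 1"
    unfolding Y_cell_def by (subst l) auto
  then show ?thesis
    using domain_borel by (subst l, simp, simp, subst l) (simp_all add: T_cell_def Z_cell_def)
qed

lemma integrable_from_nn_integral_le:
  fixes f :: "'a \<Rightarrow> real"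
  assumes f: "f \<in> borel_measurable M" "\<And>x. 0 \<le> f x" and le: "(\<integral>\<^sup>+ x. ennreal (f x) \<partial>M) \<le> ennreal c" and c: "0 \<le> c"
  shows "integrable M f" "(LINT x|M. f x) \<le> c"
proof -
  show "integrable M f"
    using f le by (intro integrableI_bounded) (auto intro: le_less_trans)
  then show "(LINT x|M. f x) \<le> c"
    using le f c by (simp add: nn_integral_eq_integral)
qed

text \<open>The counterpart of \<open>AE_lborel_snd\<close> for the limit domain: an exceptional set
  in \<open>(t, x2)\<close> stays null after the cell variables are added.\<close>

lemma AE_lborel_assoc:
  fixes Q :: "'a::euclidean_space \<times> 'b::euclidean_space \<Rightarrow> bool"
  assumes "AE a in lborel. Q a"
  shows "AE q in (lborel :: ('a \<times> 'b \<times> 'c::euclidean_space) measure). Q (fst q, fst (snd q))"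
proof -
  obtain N where N: "{a. \<not> Q a} \<subseteq> N" "N \<in> null_sets lborel"
    using assms by (auto simp: eventually_ae_filter)
  have m: "(\<lambda>q :: 'a \<times> 'b \<times> 'c. (fst q, fst (snd q))) \<in> borel_measurable borel"
    by (intro borel_measurable_continuous_onI continuous_intros)
  have Nb: "N \<in> sets borel" using N by auto
  let ?N = "(\<lambda>q :: 'a \<times> 'b \<times> 'c. (fst q, fst (snd q))) -` N"
  have "?N \<in> sets borel"
    using measurable_sets[OF m Nb] by simp
  have "(\<integral>\<^sup>+ q. indicator N (fst q, fst (snd q)) \<partial>(lborel :: ('a \<times> 'b \<times> 'c) measure))
      = (\<integral>\<^sup>+ a. \<integral>\<^sup>+ r. indicator N (fst a, snd a) \<partial>(lborel :: 'c measure) \<partial>lborel)"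
    using nn_integral_lborel_assoc[OF measurable_compose[OF m borel_measurable_indicator[OF Nb]]] by simp
  also have "\<dots> = (\<integral>\<^sup>+ a. indicator N a * \<infinity> \<partial>lborel)"
    by (simp add: nn_integral_const)
  also have "\<dots> = 0"
    using N Nb by (simp add: nn_integral_multc null_setsD1)
  also have "(\<integral>\<^sup>+ q. indicator N (fst q, fst (snd q)) \<partial>(lborel :: ('a \<times> 'b \<times> 'c) measure))
      = (\<integral>\<^sup>+ q. indicator ?N q \<partial>lborel)"
    by (rule nn_integral_cong) (simp add: indicator_def)
  finally have "emeasure lborel ?N = 0"
    using \<open>?N \<in> sets borel\<close> by simp
  then have "?N \<in> null_sets lborel"
    using \<open>?N \<in> sets borel\<close> by (intro null_setsI) auto
  then show ?thesis
    by (rule AE_I') (use N in auto)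
qed

context
  fixes h T :: real and \<phi> :: "real \<times> real \<Rightarrow> real \<times> (real \<times> real) \<times> real \<Rightarrow> real"
  assumes \<phi>: "\<phi> \<in> test_space (space_time h T)"
begin

text \<open>At each point the oscillating value is at most the sup norm \<open>m (t, x2)\<close>,
  because \<open>x1 / \<epsilon>\<close> stays within the strip on the thin layer. The bound does
  not depend on \<open>x1\<close>, so integrating over the width of the layer produces exactly the
  factor \<open>\<epsilon>\<close> that the scaling \<open>1 / \<epsilon>\<close> removes.\<close>

lemma test_oscillate:
  assumes e: "0 < \<epsilon>"
  obtains \<psi> where "\<psi> \<in> borel_measurable borel"
    "AE t in lborel. t \<in> {0<..<T} \<longrightarrow> (AE x in lborel. x \<in> Omega_M h \<epsilon> \<longrightarrow>
       oscillating \<epsilon> \<phi> t x = \<psi> (t, x))"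
    "integrable lborel (\<lambda>p. indicator ({0<..<T} \<times> Omega_M h \<epsilon>) p * (\<psi> p)\<^sup>2)"
    "(LINT p|lborel. indicator ({0<..<T} \<times> Omega_M h \<epsilon>) p * (\<psi> p)\<^sup>2) \<le> \<epsilon> * (test_norm (space_time h T) \<phi>)\<^sup>2"
proof -
  let ?S = "space_time h T" and ?I = "{0<..<T}" and ?\<Omega> = "Omega_M h \<epsilon>"
  obtain \<Phi> m where \<Phi>: "\<Phi> \<in> borel_measurable borel" and m: "m \<in> borel_measurable borel"
    and ae: "AE a in lborel. a \<in> ?S \<longrightarrow> \<phi> a \<in> C_per \<and> (\<forall>p\<in>strip. \<phi> a p = \<Phi> (a, p)) \<and> C_per_norm (\<phi> a) = m a"
    and mi: "(\<integral>\<^sup>+ a. indicator ?S a * ennreal ((m a)\<^sup>2) \<partial>lborel) = ennreal ((test_norm ?S \<phi>)\<^sup>2)"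
    using test_space_representative[OF domain_borel(3) \<phi>] by blast
  define \<psi> where "\<psi> p = \<Phi> (oscillate \<epsilon> p)" for p
  have \<psi>: "\<psi> \<in> borel_measurable borel"
    unfolding \<psi>_def by (rule oscillate_borel[OF \<Phi>])
  have ae1: "AE t in lborel. AE x in (lborel :: (real \<times> real) measure).
      (t, snd x) \<in> ?S \<longrightarrow> \<phi> (t, snd x) \<in> C_per \<and> (\<forall>p\<in>strip. \<phi> (t, snd x) p = \<Phi> ((t, snd x), p)) \<and> C_per_norm (\<phi> (t, snd x)) = m (t, snd x)"
    using AE_lborel_pair[OF ae] by eventually_elim (rule AE_lborel_snd)
  have val: "oscillating \<epsilon> \<phi> t x = \<psi> (t, x)"
      and val_le: "\<bar>\<psi> (t, x)\<bar> \<le> m (t, snd x)"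
    if "x \<in> ?\<Omega>" "\<phi> (t, snd x) \<in> C_per" "\<forall>p\<in>strip. \<phi> (t, snd x) p = \<Phi> ((t, snd x), p)"
      "C_per_norm (\<phi> (t, snd x)) = m (t, snd x)" for t x
  proof -
    have s: "snd (oscillate \<epsilon> (t, x)) \<in> strip" by (rule oscillate_strip[OF e that(1)])
    have o: "oscillate \<epsilon> (t, x) = ((t, snd x), snd (oscillate \<epsilon> (t, x)))" by (simp add: oscillate_def)
    have v: "\<phi> (t, snd x) (snd (oscillate \<epsilon> (t, x))) = \<psi> (t, x)"
      using bspec[OF that(3) s] o by (metis \<psi>_def)
    then show "oscillating \<epsilon> \<phi> t x = \<psi> (t, x)"
      by (simp add: oscillate_def)
    show "\<bar>\<psi> (t, x)\<bar> \<le> m (t, snd x)"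
      using C_per_le_norm[OF that(2) s] v that(4) by simp
  qed
  have Omega_S: "(t, snd x) \<in> ?S" if "t \<in> ?I" "x \<in> ?\<Omega>" for t x
    using that by (auto simp: Omega_M_def Sigma_M_def)
  have 1: "AE t in lborel. t \<in> ?I \<longrightarrow> (AE x in lborel. x \<in> ?\<Omega> \<longrightarrow>
       oscillating \<epsilon> \<phi> t x = \<psi> (t, x))"
    using ae1
  proof eventually_elim
    case (elim t)
    show ?case
    proof
      assume t: "t \<in> ?I"
      show "AE x in lborel. x \<in> ?\<Omega> \<longrightarrow> oscillating \<epsilon> \<phi> t x = \<psi> (t, x)"
        using elim by eventually_elim (use val Omega_S t in blast)
    qed
  qed
  let ?J = "{- \<epsilon> / 2<..<\<epsilon> / 2}"
  define K where "K a = indicator ?S a * ennreal ((m a)\<^sup>2)" for a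
  have K: "K \<in> borel_measurable borel"
    unfolding K_def using m domain_borel(3)[of T h] by measurable
  have meas: "(\<lambda>p. indicator (?I \<times> ?\<Omega>) p * (\<psi> p)\<^sup>2) \<in> borel_measurable borel"
    using \<psi> by (intro borel_measurable_times borel_measurable_indicator borel_measurable_power)
      (auto simp: Omega_M_def intro!: borel_open open_Times)
  have "(\<integral>\<^sup>+ p. ennreal (indicator (?I \<times> ?\<Omega>) p * (\<psi> p)\<^sup>2) \<partial>lborel)
      = (\<integral>\<^sup>+ t. \<integral>\<^sup>+ x. ennreal (indicator (?I \<times> ?\<Omega>) (t, x) * (\<psi> (t, x))\<^sup>2) \<partial>lborel \<partial>lborel)"
    by (rule nn_integral_lborel_pair[OF measurable_compose[OF meas measurable_ennreal]])
  also have "\<dots> \<le> (\<integral>\<^sup>+ t. \<integral>\<^sup>+ x. indicator ?J (fst x) * K (t, snd x) \<partial>lborel \<partial>lborel)"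
  proof (rule nn_integral_mono_AE, use ae1 in eventually_elim)
    case (elim t)
    show ?case
    proof (rule nn_integral_mono_AE, use elim in eventually_elim)
      case (elim x)
      show ?case
      proof (cases "t \<in> ?I \<and> x \<in> ?\<Omega>")
        case True
        then have "\<bar>\<psi> (t, x)\<bar> \<le> m (t, snd x)" using elim val_le Omega_S by blast
        from power_mono[OF this, of 2] have "(\<psi> (t, x))\<^sup>2 \<le> (m (t, snd x))\<^sup>2" by simp
        moreover have "fst x \<in> ?J" using True by (auto simp: Omega_M_def)
        ultimately show ?thesis
          using True Omega_S[of t x] by (simp add: K_def ennreal_leI)
      qed (auto simp: indicator_def)
    qed
  qed
  also have "\<dots> = (\<integral>\<^sup>+ t. \<integral>\<^sup>+ x1. indicator ?J x1 * (\<integral>\<^sup>+ x2. K (t, x2) \<partial>lborel) \<partial>lborel \<partial>lborel)"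
  proof (rule nn_integral_cong)
    fix t :: real
    have K1: "(\<lambda>x2. K (t, x2)) \<in> borel_measurable borel" by (rule borel_measurable_Pair1[OF K])
    have f: "fst \<in> borel_measurable (borel :: (real \<times> real) measure)" "snd \<in> borel_measurable (borel :: (real \<times> real) measure)"
      by (intro borel_measurable_continuous_onI continuous_intros)+
    have "(\<lambda>x. indicator ?J (fst x) * K (t, snd x)) \<in> borel_measurable borel"
      by (intro borel_measurable_times_ennreal measurable_compose[OF f(1) borel_measurable_indicator]
          measurable_compose[OF f(2) K1]) simp
    from nn_integral_lborel_pair[OF this]
    show "(\<integral>\<^sup>+ x. indicator ?J (fst x) * K (t, snd x) \<partial>lborel)
        = (\<integral>\<^sup>+ x1. indicator ?J x1 * (\<integral>\<^sup>+ x2. K (t, x2) \<partial>lborel) \<partial>lborel)"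
      using K1 by (simp add: nn_integral_cmult)
  qed
  also have "\<dots> = (\<integral>\<^sup>+ t. ennreal \<epsilon> * (\<integral>\<^sup>+ x2. K (t, x2) \<partial>lborel) \<partial>lborel)"
    using e by (simp add: nn_integral_multc)
  also have "\<dots> = ennreal \<epsilon> * (\<integral>\<^sup>+ t. \<integral>\<^sup>+ x2. K (t, x2) \<partial>lborel \<partial>lborel)"
    using borel_measurable_nn_integral_Pair1[OF K] by (intro nn_integral_cmult) simp
  also have "(\<integral>\<^sup>+ t. \<integral>\<^sup>+ x2. K (t, x2) \<partial>lborel \<partial>lborel) = ennreal ((test_norm ?S \<phi>)\<^sup>2)"
    using nn_integral_lborel_pair[OF K] mi by (simp add: K_def)
  also have "ennreal \<epsilon> * \<dots> = ennreal (\<epsilon> * (test_norm ?S \<phi>)\<^sup>2)"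
    using e by (simp add: ennreal_mult)
  finally have le: "(\<integral>\<^sup>+ p. ennreal (indicator (?I \<times> ?\<Omega>) p * (\<psi> p)\<^sup>2) \<partial>lborel) \<le> ennreal (\<epsilon> * (test_norm ?S \<phi>)\<^sup>2)" .
  have meas': "(\<lambda>p. indicator (?I \<times> ?\<Omega>) p * (\<psi> p)\<^sup>2) \<in> borel_measurable lborel" using meas by simp
  have nn: "0 \<le> indicator (?I \<times> ?\<Omega>) p * (\<psi> p)\<^sup>2" for p by simp
  have "0 \<le> \<epsilon> * (test_norm ?S \<phi>)\<^sup>2" using e by simp
  note 2 = integrable_from_nn_integral_le[OF meas' nn le this]
  from that[OF \<psi> 1 2] show thesis .
qed

text \<open>The cell has measure 1, so the \<open>L^2\<close> norm over it is at most the sup norm.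
  In the last claim \<open>v0\<close> is Borel so that all sections in the nested integrals are
  measurable.\<close>

lemma test_uncurry:
  shows "sqint (lebesgue_on (limit_domain h T)) (uncurry_test \<phi>)"
    and "norm2 (lebesgue_on (limit_domain h T)) (uncurry_test \<phi>) \<le> test_norm (space_time h T) \<phi>"
    and "\<And>v0. v0 \<in> borel_measurable borel \<Longrightarrow> sqint (lebesgue_on (limit_domain h T)) v0 \<Longrightarrow>
      (LINT t|lebesgue_on {0<..<T}. LINT xb|lebesgue_on (Sigma_M h).
            LINT \<tau>|lebesgue_on T_cell. LINT y|lebesgue_on Y_cell. LINT z|lebesgue_on Z_cell.
              v0 (t, xb, \<tau>, y, z) * \<phi> (t, xb) (\<tau>, y, z))
      = (LINT q|lebesgue_on (limit_domain h T). v0 q * uncurry_test \<phi> q)"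
proof -
  let ?S = "space_time h T" and ?P = "limit_domain h T"
  obtain \<Phi> m where \<Phi>: "\<Phi> \<in> borel_measurable borel" and m: "m \<in> borel_measurable borel"
    and ae: "AE a in lborel. a \<in> ?S \<longrightarrow> \<phi> a \<in> C_per \<and> (\<forall>p\<in>strip. \<phi> a p = \<Phi> (a, p)) \<and> C_per_norm (\<phi> a) = m a"
    and mi: "(\<integral>\<^sup>+ a. indicator ?S a * ennreal ((m a)\<^sup>2) \<partial>lborel) = ennreal ((test_norm ?S \<phi>)\<^sup>2)"
    using test_space_representative[OF domain_borel(3) \<phi>] by blast
  define \<Psi> where "\<Psi> q = \<Phi> ((fst q, fst (snd q)), snd (snd q))" for q
  have \<Psi>: "\<Psi> \<in> borel_measurable borel"
    unfolding \<Psi>_def by (rule measurable_compose[OF _ \<Phi>]) (intro borel_measurable_continuous_onI continuous_intros)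
  have "AE q in (lborel :: (real \<times> real \<times> real \<times> (real \<times> real) \<times> real) measure).
      (fst q, fst (snd q)) \<in> ?S \<longrightarrow> (\<forall>p\<in>strip. \<phi> (fst q, fst (snd q)) p = \<Phi> ((fst q, fst (snd q)), p))"
    using ae by (intro AE_lborel_assoc) (auto elim: eventually_mono)
  then have aeP: "AE q in lborel. q \<in> ?P \<longrightarrow> uncurry_test \<phi> q = \<Psi> q"
  proof eventually_elim
    case (elim q)
    show ?case
    proof
      assume q: "q \<in> ?P"
      then have S: "(fst q, fst (snd q)) \<in> ?S" and s: "snd (snd q) \<in> strip"
        using cell_subset_strip by auto
      show "uncurry_test \<phi> q = \<Psi> q"
        unfolding uncurry_test_def \<Psi>_def by (rule bspec[OF mp[OF elim S] s])
    qed
  qed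
  have aeP2: "AE q in lborel. q \<in> ?P \<longrightarrow> (uncurry_test \<phi> q)\<^sup>2 = (\<Psi> q)\<^sup>2"
    using aeP by eventually_elim simp
  have meas: "(\<lambda>q. indicator ?P q * (\<Psi> q)\<^sup>2) \<in> borel_measurable borel"
    using \<Psi> domain_borel(11)[of T h] by measurable
  have "(\<integral>\<^sup>+ q. ennreal (indicator ?P q * (\<Psi> q)\<^sup>2) \<partial>lborel)
      = (\<integral>\<^sup>+ a. \<integral>\<^sup>+ r. ennreal (indicator ?P (fst a, snd a, r) * (\<Psi> (fst a, snd a, r))\<^sup>2) \<partial>lborel \<partial>lborel)"
    by (rule nn_integral_lborel_assoc[OF measurable_compose[OF meas measurable_ennreal]])
  also have "\<dots> \<le> (\<integral>\<^sup>+ a. \<integral>\<^sup>+ r. indicator ?S a * ennreal ((m a)\<^sup>2) * indicator cell r \<partial>lborel \<partial>lborel)"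
  proof (rule nn_integral_mono_AE, use ae in eventually_elim)
    case (elim a)
    show ?case
    proof (rule nn_integral_mono)
      fix r :: "real \<times> (real \<times> real) \<times> real"
      show "ennreal (indicator ?P (fst a, snd a, r) * (\<Psi> (fst a, snd a, r))\<^sup>2) \<le> indicator ?S a * ennreal ((m a)\<^sup>2) * indicator cell r"
      proof (cases "a \<in> ?S \<and> r \<in> cell")
        case True
        then have r: "r \<in> strip" using cell_subset_strip by blast
        have "\<bar>\<Psi> (fst a, snd a, r)\<bar> \<le> m a"
          using C_per_le_norm[of "\<phi> a" r] elim True r by (simp add: \<Psi>_def)
        from power_mono[OF this, of 2] have "(\<Psi> (fst a, snd a, r))\<^sup>2 \<le> (m a)\<^sup>2" by simp
        then show ?thesis using True by (simp add: ennreal_leI indicator_def split: if_splits)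
      next
        case False
        then have "(fst a, snd a, r) \<notin> ?P" by (cases a) auto
        then show ?thesis by simp
      qed
    qed
  qed
  also have "\<dots> = ennreal ((test_norm ?S \<phi>)\<^sup>2)"
    using domain_borel(9) emeasure_cell mi by (simp add: nn_integral_cmult)
  finally have le: "(\<integral>\<^sup>+ q. ennreal (indicator ?P q * (\<Psi> q)\<^sup>2) \<partial>lborel) \<le> ennreal ((test_norm ?S \<phi>)\<^sup>2)" .
  have meas': "(\<lambda>q. indicator ?P q * (\<Psi> q)\<^sup>2) \<in> borel_measurable lborel" using meas by simp
  have nn: "0 \<le> indicator ?P q * (\<Psi> q)\<^sup>2" for q by simp
  note int = integrable_from_nn_integral_le[OF meas' nn le zero_le_power2]
  have \<Psi>2: "(\<lambda>q. (\<Psi> q)\<^sup>2) \<in> borel_measurable borel" using \<Psi> by measurable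
  show sq: "sqint (lebesgue_on ?P) (uncurry_test \<phi>)"
    using lebesgue_on_measurable_cong_borel[OF domain_borel(11) \<Psi> aeP]
      lebesgue_on_integrable_cong_borel[OF domain_borel(11) \<Psi>2 aeP2] int(1)
    by (simp add: sqint_def)
  have tn: "0 \<le> test_norm ?S \<phi>" by (simp add: test_norm_norm2)
  show "norm2 (lebesgue_on ?P) (uncurry_test \<phi>) \<le> test_norm ?S \<phi>"
    using int(2) lebesgue_on_integral_cong_borel[OF domain_borel(11) \<Psi>2 aeP2] tn
    by (simp add: norm2_def real_le_lsqrt)
  fix v0 :: "real \<times> real \<times> real \<times> (real \<times> real) \<times> real \<Rightarrow> real"
  assume v0: "v0 \<in> borel_measurable borel" "sqint (lebesgue_on ?P) v0"
  define F where "F q = v0 q * \<Psi> q" for q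
  have F: "F \<in> borel_measurable borel"
    unfolding F_def using v0 \<Psi> by measurable
  have aeF: "AE q in lborel. q \<in> ?P \<longrightarrow> v0 q * uncurry_test \<phi> q = F q"
    using aeP by eventually_elim (simp add: F_def)
  have intF: "integrable lborel (\<lambda>q. indicator ?P q * F q)"
    using integrable_mult_sqint[OF v0(2) sq] lebesgue_on_integrable_cong_borel[OF domain_borel(11) F aeF]
    by simp
  \<comment> \<open>\<open>nested_integral_step\<close> is used for \<open>t\<close>,
    \<open>xb\<close>, \<open>\<tau>\<close> and \<open>y\<close>, and a direct replacement by
    \<open>F\<close> for \<open>z\<close>. The exceptional set concerns only \<open>t\<close> and
    \<open>xb\<close>; from \<open>\<tau>\<close> inward the identification holds
    everywhere.\<close>
  have "(LINT t|lebesgue_on {0<..<T}. LINT xb|lebesgue_on (Sigma_M h).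
            LINT \<tau>|lebesgue_on T_cell. LINT y|lebesgue_on Y_cell. LINT z|lebesgue_on Z_cell.
              v0 (t, xb, \<tau>, y, z) * \<phi> (t, xb) (\<tau>, y, z)) = (LINT q|lborel. indicator ?P q * F q)"
  proof (rule nested_integral_step[OF domain_borel(1) domain_borel(10) F intF],
      use AE_lborel_pair[OF ae] in eventually_elim, intro impI,
      rule nested_integral_step[OF domain_borel(2) domain_borel(9) borel_measurable_Pair1[OF F]],
      assumption, goal_cases)
    case (1 t)
    show ?case
      using 1(1)
    proof eventually_elim
      case (elim xb)
      have F2: "(\<lambda>r. F (t, xb, r)) \<in> borel_measurable borel"
        using borel_measurable_Pair1[OF borel_measurable_Pair1[OF F]] .
      show ?case
      proof (intro impI, rule nested_integral_step[OF domain_borel(5) domain_borel(8) F2],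
          assumption, rule AE_I2, intro impI,
          rule nested_integral_step[OF domain_borel(6) domain_borel(7) borel_measurable_Pair1[OF F2]],
          assumption, rule AE_I2, intro impI, rule lebesgue_on_integral_cong_borel[OF domain_borel(7)],
          goal_cases)
        case (1 \<tau> y)
        show ?case
          by (rule borel_measurable_Pair1[OF borel_measurable_Pair1[OF F2]])
      next
        case (2 \<tau> y)
        have "v0 (t, xb, \<tau>, y, z) * \<phi> (t, xb) (\<tau>, y, z) = F (t, xb, \<tau>, y, z)" if "z \<in> Z_cell" for z
        proof -
          have "(\<tau>, y, z) \<in> strip" using 2 that cell_subset_strip by blast
          moreover have "\<forall>p\<in>strip. \<phi> (t, xb) p = \<Phi> ((t, xb), p)"
            using elim 1(2) 2(1) by blast
          ultimately have "\<phi> (t, xb) (\<tau>, y, z) = \<Phi> ((t, xb), (\<tau>, y, z))"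
            by (rule bspec[rotated])
          then show ?thesis by (simp add: F_def \<Psi>_def)
        qed
        then show ?case by (intro AE_I2) auto
      qed
    qed
  qed
  also have "\<dots> = (LINT q|lebesgue_on ?P. v0 q * uncurry_test \<phi> q)"
    using lebesgue_on_integral_cong_borel[OF domain_borel(11) F aeF] by simp
  finally show "(LINT t|lebesgue_on {0<..<T}. LINT xb|lebesgue_on (Sigma_M h).
            LINT \<tau>|lebesgue_on T_cell. LINT y|lebesgue_on Y_cell. LINT z|lebesgue_on Z_cell.
              v0 (t, xb, \<tau>, y, z) * \<phi> (t, xb) (\<tau>, y, z))
      = (LINT q|lebesgue_on ?P. v0 q * uncurry_test \<phi> q)" .
qed

end

section \<open>Trigonometric polynomials\<close>

text \<open>The phases count quarter turns, so one cosine covers sines as well (phase 3). The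
  variables \<open>y2\<close> and \<open>z\<close> share a cosine because both are driven by
  \<open>x2\<close> after oscillation, which merges their frequencies; \<open>\<tau>\<close> is
  driven by \<open>t\<close> and stays apart.\<close>

definition trig_gen :: "nat \<Rightarrow> int \<Rightarrow> nat \<Rightarrow> int \<Rightarrow> int \<Rightarrow> nat \<Rightarrow> real \<times> (real \<times> real) \<times> real \<Rightarrow> real" where
  "trig_gen j k c m n d p = (case p of (\<tau>, (y1, y2), z) \<Rightarrow>
     y1 ^ j * cos (2 * pi * (of_int k * \<tau>) + of_nat c * (pi/2)) *
       cos (2 * pi * (of_int m * y2 + of_int n * z) + of_nat d * (pi/2)))"

inductive_set trig_poly :: "(real \<times> (real \<times> real) \<times> real \<Rightarrow> real) set" where
  gen: "trig_gen j k c m n d \<in> trig_poly"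
| add: "f \<in> trig_poly \<Longrightarrow> g \<in> trig_poly \<Longrightarrow> (\<lambda>p. f p + g p) \<in> trig_poly"
| cmult: "f \<in> trig_poly \<Longrightarrow> (\<lambda>p. r * f p) \<in> trig_poly"

lemma cos_plus_even_pi:
  "cos (x + 2 * pi * of_int k) = cos x"
  using sin_cos_eq_iff[of "x + 2 * pi * of_int k" x] by auto

lemma trig_gen_C_per: "trig_gen j k c m n d \<in> C_per"
proof -
  have "continuous_on strip (trig_gen j k c m n d)"
    unfolding trig_gen_def[abs_def] case_prod_beta by (intro continuous_intros)
  moreover have "trig_gen j k c m n d (\<tau> + 1, (y1, y2), z) = trig_gen j k c m n d (\<tau>, (y1, y2), z)" for \<tau> y1 y2 z
    using cos_plus_even_pi[of "2 * pi * (of_int k * \<tau>) + of_nat c * (pi/2)" k]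
    by (simp add: trig_gen_def algebra_simps)
  moreover have "trig_gen j k c m n d (\<tau>, (y1, y2 + 1), z) = trig_gen j k c m n d (\<tau>, (y1, y2), z)" for \<tau> y1 y2 z
    using cos_plus_even_pi[of "2 * pi * (of_int m * y2 + of_int n * z) + of_nat d * (pi/2)" m]
    by (simp add: trig_gen_def algebra_simps)
  moreover have "trig_gen j k c m n d (\<tau>, (y1, y2), z + 1) = trig_gen j k c m n d (\<tau>, (y1, y2), z)" for \<tau> y1 y2 z
    using cos_plus_even_pi[of "2 * pi * (of_int m * y2 + of_int n * z) + of_nat d * (pi/2)" n]
    by (simp add: trig_gen_def algebra_simps)
  ultimately show ?thesis by (simp add: C_per_def)
qed

lemma trig_poly_C_per: "f \<in> trig_poly \<Longrightarrow> f \<in> C_per"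
  by (induction rule: trig_poly.induct) (auto intro: trig_gen_C_per C_per_add C_per_cmult)

text \<open>Product-to-sum formulas for the two cosines give four terms. A phase difference
  \<open>c - c'\<close> is written \<open>c + 3 * c'\<close>, which differs from it by full turns
  and remains a natural number.\<close>

lemma trig_gen_mult:
  "trig_gen j k c m n d p * trig_gen j' k' c' m' n' d' p =
     1/4 * (trig_gen (j + j') (k + k') (c + c') (m + m') (n + n') (d + d') p
      + trig_gen (j + j') (k - k') (c + 3 * c') (m + m') (n + n') (d + d') p
      + (trig_gen (j + j') (k + k') (c + c') (m - m') (n - n') (d + 3 * d') p
      + trig_gen (j + j') (k - k') (c + 3 * c') (m - m') (n - n') (d + 3 * d') p))"
proof -
  have sub: "cos (x - y + 2 * pi * of_nat c) = cos (x - y)" for x y c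
    using cos_plus_even_pi[of "x - y" "int c"] by simp
  have prod: "cos x * cos y = 1/2 * (cos (x + y) + cos (x - y))" for x y :: real
    by (simp add: cos_add cos_diff)
  obtain \<tau> y1 y2 z where p: "p = (\<tau>, (y1, y2), z)" by (cases p) auto
  define x where "x = 2 * pi * (of_int k * \<tau>) + of_nat c * (pi/2)"
  define x' where "x' = 2 * pi * (of_int k' * \<tau>) + of_nat c' * (pi/2)"
  define y where "y = 2 * pi * (of_int m * y2 + of_int n * z) + of_nat d * (pi/2)"
  define y' where "y' = 2 * pi * (of_int m' * y2 + of_int n' * z) + of_nat d' * (pi/2)"
  have 1: "cos (2 * pi * (of_int (k + k') * \<tau>) + of_nat (c + c') * (pi/2)) = cos (x + x')"
    by (simp add: x_def x'_def algebra_simps add_divide_distrib)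
  have 2: "cos (2 * pi * (of_int (k - k') * \<tau>) + of_nat (c + 3 * c') * (pi/2)) = cos (x - x')"
    by (subst sub[of x x' c', symmetric], rule arg_cong[where f = cos]) (simp add: x_def x'_def field_simps)
  have 3: "cos (2 * pi * (of_int (m + m') * y2 + of_int (n + n') * z) + of_nat (d + d') * (pi/2)) = cos (y + y')"
    by (simp add: y_def y'_def algebra_simps add_divide_distrib)
  have 4: "cos (2 * pi * (of_int (m - m') * y2 + of_int (n - n') * z) + of_nat (d + 3 * d') * (pi/2)) = cos (y - y')"
    by (subst sub[of y y' d', symmetric], rule arg_cong[where f = cos]) (simp add: y_def y'_def field_simps)
  have "y1 ^ j * cos x * cos y * (y1 ^ j' * cos x' * cos y')
      = y1 ^ (j + j') * (cos x * cos x') * (cos y * cos y')"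
    by (simp add: power_add mult_ac)
  also have "\<dots> = 1/4 * (y1 ^ (j + j') * cos (x + x') * cos (y + y')
      + y1 ^ (j + j') * cos (x - x') * cos (y + y')
      + (y1 ^ (j + j') * cos (x + x') * cos (y - y')
      + y1 ^ (j + j') * cos (x - x') * cos (y - y')))"
    unfolding prod by (simp add: algebra_simps)
  finally show ?thesis
    unfolding trig_gen_def p prod.case 1 2 3 4 x_def x'_def y_def y'_def by simp
qed

lemma trig_poly_mult:
  assumes "f \<in> trig_poly" "g \<in> trig_poly"
  shows "(\<lambda>p. f p * g p) \<in> trig_poly"
  using assms
proof (induction f rule: trig_poly.induct)
  case (gen j k c m n d)
  from gen show ?case
  proof (induction g rule: trig_poly.induct)
    case (gen j' k' c' m' n' d')
    show ?case unfolding trig_gen_mult by (intro trig_poly.intros)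
  next
    case (add f g)
    then show ?case by (simp add: distrib_left trig_poly.add)
  next
    case (cmult f r)
    then show ?case by (simp add: mult.left_commute[of _ r] trig_poly.cmult)
  qed
next
  case (add f g)
  then show ?case by (simp add: distrib_right trig_poly.add)
next
  case (cmult f r)
  then show ?case by (simp add: mult.assoc trig_poly.cmult)
qed

section \<open>Density of trigonometric polynomials in the sup norm\<close>

text \<open>Stone--Weierstrass on the image of the closed cell under \<open>torus\<close>, which identifies
  exactly the points that periodic functions cannot separate.\<close>

definition torus :: "real \<times> (real \<times> real) \<times> real \<Rightarrow> real \<times> real \<times> real \<times> real \<times> real \<times> real \<times> real" where
  "torus p = (case p of (\<tau>, (y1, y2), z) \<Rightarrow>
     (cos (2 * pi * \<tau>), sin (2 * pi * \<tau>), y1, cos (2 * pi * y2), sin (2 * pi * y2), cos (2 * pi * z), sin (2 * pi * z)))"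

lemma continuous_on_torus: "continuous_on A torus"
  unfolding torus_def[abs_def] case_prod_beta by (intro continuous_intros)

lemma torus_eq_imp_eq:
  assumes w: "w \<in> C_per" and p: "p \<in> strip" and eq: "torus p = torus q"
  shows "w p = w q"
proof -
  obtain \<tau> y1 y2 z where pp: "p = (\<tau>, (y1, y2), z)" by (cases p) auto
  obtain \<tau>' y1' y2' z' where qq: "q = (\<tau>', (y1', y2'), z')" by (cases q) auto
  have per: "\<exists>n::int. x' = x + of_int n"
    if sc: "cos (2 * pi * x) = cos (2 * pi * x')" "sin (2 * pi * x) = sin (2 * pi * x')" for x x' :: real
  proof -
    obtain n :: int where "2 * pi * x' = 2 * pi * x + 2 * pi * of_int n"
      using iffD1[OF sin_cos_eq_iff conjI[OF sc(2)[symmetric] sc(1)[symmetric]]] by blast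
    then have "2 * pi * x' = 2 * pi * (x + of_int n)" by (simp add: distrib_left)
    then have "x' = x + of_int n" by simp
    then show ?thesis by blast
  qed
  have y: "y1' = y1" using eq by (simp add: pp qq torus_def)
  obtain a b c :: int where abc: "\<tau>' = \<tau> + of_int a" "y2' = y2 + of_int b" "z' = z + of_int c"
    using eq per[of \<tau> \<tau>'] per[of y2 y2'] per[of z z'] by (auto simp: pp qq torus_def)
  have y1: "y1 \<in> {- 1/2..1/2}" using p by (auto simp: pp)
  have per: "\<And>\<tau> y2 z. w (\<tau> + 1, (y1, y2), z) = w (\<tau>, (y1, y2), z)"
    "\<And>\<tau> y2 z. w (\<tau>, (y1, y2 + 1), z) = w (\<tau>, (y1, y2), z)"
    "\<And>\<tau> y2 z. w (\<tau>, (y1, y2), z + 1) = w (\<tau>, (y1, y2), z)"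
    using w y1 by (auto simp: C_per_def)
  show ?thesis
    unfolding pp qq y abc
    using periodic_shift_int[of "\<lambda>t. w (t, (y1, y2 + of_int b), z + of_int c)" \<tau> a]
      periodic_shift_int[of "\<lambda>t. w (\<tau>, (y1, t), z + of_int c)" y2 b]
      periodic_shift_int[of "\<lambda>t. w (\<tau>, (y1, y2), t)" z c]
    by (simp add: per)
qed

text \<open>A linear functional is a combination of the seven coordinates, expanded over the unit
  vectors \<open>?b i\<close>, and each coordinate of \<open>torus\<close> is itself a generator.
  Products are covered by \<open>trig_poly_mult\<close>.\<close>

lemma real_polynomial_torus:
  assumes "real_polynomial_function g"
  shows "(\<lambda>p. g (torus p)) \<in> trig_poly"
  using assms
proof (induction rule: real_polynomial_function.induct)
  case (linear f)
  interpret bounded_linear f by fact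
  let ?b = "\<lambda>i::nat. (of_bool (i = 0), of_bool (i = 1), of_bool (i = 2), of_bool (i = 3), of_bool (i = 4), of_bool (i = 5), of_bool (i = 6))
    :: real \<times> real \<times> real \<times> real \<times> real \<times> real \<times> real"
  have dec: "f (a0, a1, a2, a3, a4, a5, a6) =
     (f (?b 0) * a0 + (f (?b 1) * a1 + (f (?b 2) * a2 + (f (?b 3) * a3 + (f (?b 4) * a4 + (f (?b 5) * a5 + f (?b 6) * a6))))))"
    for a0 a1 a2 a3 a4 a5 a6
  proof -
    have "(a0, a1, a2, a3, a4, a5, a6) =
      a0 *\<^sub>R ?b 0 + (a1 *\<^sub>R ?b 1 + (a2 *\<^sub>R ?b 2 + (a3 *\<^sub>R ?b 3 + (a4 *\<^sub>R ?b 4 + (a5 *\<^sub>R ?b 5 + a6 *\<^sub>R ?b 6)))))"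
      by simp
    then show ?thesis
      by (simp only: add scaleR) (simp add: mult.commute)
  qed
  have sin_cos: "sin x = cos (x + of_nat 3 * (pi/2))" for x :: real
  proof -
    have "of_nat 3 * (pi/2) = 3/2 * pi" by simp
    then show ?thesis by (simp only: cos_add cos_3over2_pi sin_3over2_pi)
  qed
  have c: "(\<lambda>p. cos (2 * pi * fst p)) = trig_gen 0 1 0 0 0 0"
    "(\<lambda>p. sin (2 * pi * fst p)) = trig_gen 0 1 3 0 0 0"
    "(\<lambda>p. fst (fst (snd p))) = trig_gen 1 0 0 0 0 0"
    "(\<lambda>p. cos (2 * pi * snd (fst (snd p)))) = trig_gen 0 0 0 1 0 0"
    "(\<lambda>p. sin (2 * pi * snd (fst (snd p)))) = trig_gen 0 0 0 1 0 3"
    "(\<lambda>p. cos (2 * pi * snd (snd p))) = trig_gen 0 0 0 0 1 0"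
    "(\<lambda>p. sin (2 * pi * snd (snd p))) = trig_gen 0 0 0 0 1 3"
    by (auto simp: fun_eq_iff trig_gen_def sin_cos)
  have m: "(\<lambda>p. cos (2 * pi * fst p)) \<in> trig_poly"
    "(\<lambda>p. sin (2 * pi * fst p)) \<in> trig_poly"
    "(\<lambda>p. fst (fst (snd p))) \<in> trig_poly"
    "(\<lambda>p. cos (2 * pi * snd (fst (snd p)))) \<in> trig_poly"
    "(\<lambda>p. sin (2 * pi * snd (fst (snd p)))) \<in> trig_poly"
    "(\<lambda>p. cos (2 * pi * snd (snd p))) \<in> trig_poly"
    "(\<lambda>p. sin (2 * pi * snd (snd p))) \<in> trig_poly"
    by (simp_all only: c trig_poly.gen)
  have torus: "f (torus p) = (f (?b 0) * cos (2 * pi * fst p) + (f (?b 1) * sin (2 * pi * fst p) + (f (?b 2) * fst (fst (snd p)) +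
      (f (?b 3) * cos (2 * pi * snd (fst (snd p))) + (f (?b 4) * sin (2 * pi * snd (fst (snd p))) + (f (?b 5) * cos (2 * pi * snd (snd p)) + f (?b 6) * sin (2 * pi * snd (snd p))))))))" for p
    unfolding torus_def case_prod_beta by (rule dec)
  show ?case
    unfolding torus
    by (rule trig_poly.add[OF trig_poly.cmult[OF m(1)] trig_poly.add[OF trig_poly.cmult[OF m(2)] trig_poly.add[OF trig_poly.cmult[OF m(3)] 
      trig_poly.add[OF trig_poly.cmult[OF m(4)] trig_poly.add[OF trig_poly.cmult[OF m(5)] trig_poly.add[OF trig_poly.cmult[OF m(6)] trig_poly.cmult[OF m(7)]]]]]]])
next
  case (const r)
  have "(\<lambda>p. r * trig_gen 0 0 0 0 0 0 p) \<in> trig_poly" by (intro trig_poly.intros)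
  then show ?case by (simp add: trig_gen_def case_prod_beta)
next
  case (add f g)
  show ?case by (rule trig_poly.add[OF add.IH])
next
  case (mult f g)
  show ?case by (rule trig_poly_mult[OF mult.IH])
qed

text \<open>\<open>w\<close> factors through \<open>torus\<close> as \<open>W\<close>, defined by
  choosing preimages, which is harmless by \<open>torus_eq_imp_eq\<close>. Continuity of
  \<open>W\<close> follows from the closed graph: the graph is a continuous image of the compact
  closed cell, and \<open>W\<close> maps into a compact set.\<close>

lemma trig_poly_dense:
  assumes w: "w \<in> C_per" and e: "0 < e"
  shows "\<exists>u\<in>trig_poly. C_per_norm (\<lambda>p. w p - u p) \<le> e"
proof -
  let ?C = "closure cell"
  let ?K = "torus ` ?C"
  have cw: "continuous_on ?C w"
    using w closure_cell_subset_strip by (auto simp: C_per_def intro: continuous_on_subset)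
  define W where "W x = w (SOME p. p \<in> ?C \<and> torus p = x)" for x
  have W: "W (torus p) = w p" if "p \<in> ?C" for p
  proof -
    have "(SOME q. q \<in> ?C \<and> torus q = torus p) \<in> ?C \<and> torus (SOME q. q \<in> ?C \<and> torus q = torus p) = torus p"
      by (rule someI[of _ p]) (use that in auto)
    then show ?thesis
      unfolding W_def using closure_cell_subset_strip by (intro torus_eq_imp_eq[OF w]) auto
  qed
  have comp: "compact ?K"
    by (intro compact_continuous_image continuous_on_torus compact_closure_cell)
  have "continuous_on ?K W"
  proof (rule continuous_from_closed_graph)
    show "compact (w ` ?C)"
      by (intro compact_continuous_image cw compact_closure_cell)
    show "W \<in> ?K \<rightarrow> w ` ?C" using W by auto
    have "(\<lambda>x. (x, W x)) ` ?K = (\<lambda>p. (torus p, w p)) ` ?C"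
      using W by (auto simp: image_image intro!: image_cong)
    moreover have "compact ((\<lambda>p. (torus p, w p)) ` ?C)"
      by (intro compact_continuous_image continuous_on_Pair continuous_on_torus cw compact_closure_cell)
    ultimately show "closed ((\<lambda>x. (x, W x)) ` ?K)"
      by (simp add: compact_imp_closed)
  qed
  then obtain g where g: "real_polynomial_function g" "\<And>x. x \<in> ?K \<Longrightarrow> \<bar>W x - g x\<bar> < e"
    using Stone_Weierstrass_real_polynomial_function[OF comp _ e] by blast
  have "C_per_norm (\<lambda>p. w p - g (torus p)) \<le> e"
    unfolding C_per_norm_def
  proof (rule cSUP_least)
    show "closure cell \<noteq> {}" by (auto simp: closure_cell)
    show "\<bar>w p - g (torus p)\<bar> \<le> e" if "p \<in> ?C" for p
      using g(2)[of "torus p"] W[OF that] that by force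
  qed
  then show ?thesis
    by (rule bexI[OF _ real_polynomial_torus[OF g(1)]])
qed

section \<open>Density of the generators\<close>

text \<open>Quadrants with rational corners are countable in number, generate the Borel sets, and
  intersect in quadrants again, so they serve both Dynkin's argument and the product of two
  generators. Cut with the domain, they leave intervals starting at 0 in \<open>t\<close> and in
  \<open>x2\<close>.\<close>

definition quadrant :: "rat \<times> rat \<Rightarrow> (real \<times> real) set" where
  "quadrant q = {..<of_rat (fst q)} \<times> {..<of_rat (snd q)}"

lemma quadrant_borel: "quadrant q \<in> sets borel"
  unfolding quadrant_def by (intro borel_open open_Times open_lessThan)

lemma borel_eq_quadrants: "borel = sigma UNIV (range quadrant)"
proof (rule borel_eq_sigmaI1[OF borel_eq_lessThan])
  show "quadrant q \<in> sets borel" for q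
    by (rule quadrant_borel)
  fix X :: "(real \<times> real) set"
  assume "X \<in> range (\<lambda>a. {x. eucl_less x a})"
  then obtain a b where X: "X = {x. eucl_less x (a, b)}" by auto
  have "X = \<Union> (quadrant ` {q. of_rat (fst q) < a \<and> of_rat (snd q) < b})"
  proof (intro equalityI subsetI)
    fix x assume "x \<in> X"
    then have "fst x < a" "snd x < b"
      by (cases x; auto simp: X eucl_less_def Basis_prod_def)+
    obtain p where p: "fst x < of_rat p" "of_rat p < a" using of_rat_dense[OF \<open>fst x < a\<close>] by blast
    obtain q where q: "snd x < of_rat q" "of_rat q < b" using of_rat_dense[OF \<open>snd x < b\<close>] by blast
    from p q have "x \<in> quadrant (p, q)" "(p, q) \<in> {q. of_rat (fst q) < a \<and> of_rat (snd q) < b}"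
      by (auto simp: quadrant_def mem_Times_iff)
    then show "x \<in> \<Union> (quadrant ` {q. of_rat (fst q) < a \<and> of_rat (snd q) < b})" by blast
  qed (auto simp: X eucl_less_def Basis_prod_def quadrant_def)
  moreover have "\<Union> (quadrant ` {q. of_rat (fst q) < a \<and> of_rat (snd q) < b}) \<in> sets (sigma UNIV (range quadrant))"
    by (intro sets.countable_UN') (auto simp: sets_measure_of)
  ultimately show "X \<in> sets (sigma UNIV (range quadrant))" by simp
qed

lemma Int_stable_quadrants: "Int_stable (range quadrant)"
proof (rule Int_stableI_image)
  fix p q :: "rat \<times> rat"
  have less_min: "x < of_rat (min a b) \<longleftrightarrow> x < of_rat a \<and> x < of_rat b" for x :: real and a b
  proof (cases "a \<le> b")
    case True
    then have "real_of_rat a \<le> of_rat b" by (simp add: of_rat_less_eq)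
    with True show ?thesis by (auto simp: min_def)
  next
    case False
    then have "real_of_rat b \<le> of_rat a" by (simp add: of_rat_less_eq)
    with False show ?thesis by (auto simp: min_def)
  qed
  have "quadrant p \<inter> quadrant q = quadrant (min (fst p) (fst q), min (snd p) (snd q))"
    by (auto simp: quadrant_def less_min)
  then show "\<exists>r\<in>UNIV. quadrant p \<inter> quadrant q = quadrant r" by blast
qed

lemma space_time_finite: "emeasure lborel (space_time h T) < \<infinity>"
proof -
  have "bounded (space_time h T)"
    unfolding Sigma_M_def by (intro bounded_Times) auto
  then show ?thesis by (rule emeasure_bounded_finite)
qed

lemma finite_measure_lebesgue_on:
  fixes S :: "'a::euclidean_space set"
  assumes "S \<in> sets borel" "emeasure lborel S < \<infinity>"
  shows "finite_measure (lebesgue_on S)"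
  using assms by (intro finite_measureI) (simp add: emeasure_restrict_space)

lemma test_space_indicator:
  assumes "B \<in> sets borel" "w \<in> C_per"
  shows "(\<lambda>a p. indicator B a * w p) \<in> test_space (space_time h T)"
proof (rule test_space_simple[OF domain_borel(3) space_time_finite])
  have "simple_function (lebesgue_on (space_time h T)) (indicator B :: _ \<Rightarrow> real)"
  proof (rule simple_function_borel_measurable)
    show "(indicator B :: _ \<Rightarrow> real) \<in> borel_measurable (lebesgue_on (space_time h T))"
      using assms by (intro measurable_restrict_space1 measurable_completion) simp
    have "(indicator B :: _ \<Rightarrow> real) ` space (lebesgue_on (space_time h T)) \<subseteq> {0, 1}" by (auto simp: indicator_def)
    then show "finite ((indicator B :: _ \<Rightarrow> real) ` space (lebesgue_on (space_time h T)))" by (rule finite_subset) simp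
  qed
  then show "simple_function (lebesgue_on (space_time h T)) (\<lambda>a p. indicator B a * w p)"
    by (rule simple_function_compose1)
  show "(\<lambda>a p. indicator B a * w p) ` space (lebesgue_on (space_time h T)) \<subseteq> C_per"
    using assms C_per_cmult by auto
qed

section \<open>Density as an induction principle for test functions\<close>

context
  fixes h T :: real and Good :: "(real \<times> real \<Rightarrow> real \<times> (real \<times> real) \<times> real \<Rightarrow> real) \<Rightarrow> bool"
  assumes Gmem: "\<And>f. Good f \<Longrightarrow> f \<in> test_space (space_time h T)"
    and Gadd: "\<And>f g. Good f \<Longrightarrow> Good g \<Longrightarrow> Good (\<lambda>a p. f a p + g a p)"
    and Gcmult: "\<And>r f. Good f \<Longrightarrow> Good (\<lambda>a p. r * f a p)"
    and Gapprox: "\<And>f. f \<in> test_space (space_time h T) \<Longrightarrow>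
      (\<And>e. 0 < e \<Longrightarrow> \<exists>g. Good g \<and> test_norm (space_time h T) (\<lambda>a p. f a p - g a p) < e) \<Longrightarrow> Good f"
    and Ggen: "\<And>q j k c m n d. Good (\<lambda>a p. indicator (quadrant q) a * trig_gen j k c m n d p)"
begin

private abbreviation "S \<equiv> space_time h T"

private lemma S: "S \<in> sets borel" by (rule domain_borel)

private lemma fin: "finite_measure (lebesgue_on S)"
  by (rule finite_measure_lebesgue_on[OF S space_time_finite])

private lemma const_sqint: "sqint (lebesgue_on S) (\<lambda>_. c)"
  using fin by (simp add: sqint_def finite_measure.integrable_const)

text \<open>Functions that agree almost everywhere are at distance 0, so closedness of
  \<open>Good\<close> absorbs null sets.\<close>

private lemma cong_AE:
  assumes f: "f \<in> test_space S" and g: "Good g" and eq: "AE a in lebesgue_on S. f a = g a"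
  shows "Good f"
proof (rule Gapprox[OF f])
  fix e :: real assume "0 < e"
  have "test_norm S (\<lambda>a p. f a p - g a p) \<le> norm2 (lebesgue_on S) (\<lambda>_. 0)"
  proof (rule test_norm_le[OF const_sqint])
    show "AE a in lebesgue_on S. (\<lambda>p. f a p - g a p) \<in> C_per"
      using eq by eventually_elim (simp add: C_per_const)
    show "AE a in lebesgue_on S. C_per_norm (\<lambda>p. f a p - g a p) \<le> \<bar>0\<bar>"
      using eq by eventually_elim (simp add: C_per_norm_def closure_cell)
  qed
  then show "\<exists>g. Good g \<and> test_norm S (\<lambda>a p. f a p - g a p) < e"
    using g \<open>0 < e\<close> by (auto simp: norm2_def)
qed

private lemma quadrant_trig_poly:
  assumes "u \<in> trig_poly"
  shows "Good (\<lambda>a p. indicator (quadrant q) a * u p)"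
  using assms
proof (induction rule: trig_poly.induct)
  case (gen j k c m n d)
  show ?case by (rule Ggen)
next
  case (add f g)
  then show ?case using Gadd by (simp add: distrib_left)
next
  case (cmult f r)
  then show ?case using Gcmult[of "\<lambda>a p. indicator (quadrant q) a * f p" r] by (simp add: mult.left_commute)
qed

private lemma quadrant_C_per:
  assumes w: "w \<in> C_per"
  shows "Good (\<lambda>a p. indicator (quadrant q) a * w p)"
proof (rule Gapprox)
  have B: "quadrant q \<in> sets borel"
    by (rule quadrant_borel)
  show "(\<lambda>a p. indicator (quadrant q) a * w p) \<in> test_space S"
    by (rule test_space_indicator[OF B w])
  fix e :: real assume e: "0 < e"
  define r where "r = norm2 (lebesgue_on S) (\<lambda>_. 1)"
  have r: "0 \<le> r" by (simp add: r_def)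
  \<comment> \<open>The constant \<open>e / (r + 1)\<close> has norm \<open>e * r / (r + 1)\<close>,
    which is below \<open>e\<close>; the added 1 covers \<open>r = 0\<close>.\<close>
  then have "0 < e / (r + 1)" using e by simp
  then obtain u where u: "u \<in> trig_poly" "C_per_norm (\<lambda>p. w p - u p) \<le> e / (r + 1)"
    using trig_poly_dense[OF w] by blast
  let ?d = "\<lambda>a p. indicator (quadrant q) a * w p - indicator (quadrant q) a * u p"
  have d: "(\<lambda>p. w p - u p) \<in> C_per" using w trig_poly_C_per[OF u(1)] by (rule C_per_diff)
  have "test_norm S ?d
      \<le> norm2 (lebesgue_on S) (\<lambda>_. e / (r + 1))"
  proof (rule test_norm_le[OF const_sqint])
    show "AE a in lebesgue_on S. (?d a) \<in> C_per"
      using C_per_cmult[OF d] by (simp add: right_diff_distrib)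
    have "C_per_norm (?d a) \<le> \<bar>e / (r + 1)\<bar>" for a
    proof -
      have "C_per_norm (?d a)
          \<le> \<bar>indicator (quadrant q) a\<bar> * C_per_norm (\<lambda>p. w p - u p)"
        using C_per_norm_cmult[OF d, of "indicator (quadrant q) a"] by (simp add: right_diff_distrib)
      also have "\<dots> \<le> 1 * C_per_norm (\<lambda>p. w p - u p)"
        by (intro mult_right_mono C_per_norm_nonneg d) (simp add: indicator_def)
      finally show ?thesis using u(2) by linarith
    qed
    then show "AE a in lebesgue_on S. C_per_norm (?d a) \<le> \<bar>e / (r + 1)\<bar>"
      by blast
  qed
  also have "\<dots> = \<bar>e / (r + 1)\<bar> * r"
    using norm2_cmult[of "lebesgue_on S" "e / (r + 1)" "\<lambda>_. 1"] by (simp add: r_def)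
  also have "\<dots> < e"
    using e r by (simp add: field_simps)
  finally show "\<exists>g. Good g \<and> test_norm S (\<lambda>a p. indicator (quadrant q) a * w p - g a p) < e"
    using quadrant_trig_poly[OF u(1)] by blast
qed

text \<open>The whole plane is needed for complements but is no quadrant. A quadrant whose corner
  lies beyond \<open>(T, h)\<close> agrees with it on \<open>S\<close>.\<close>

private lemma UNIV_C_per:
  assumes w: "w \<in> C_per"
  shows "Good (\<lambda>a p. indicator UNIV a * w p)"
proof -
  obtain p q :: rat where pq: "T < of_rat p" "h < of_rat q"
    using of_rat_dense[of T "T + 1"] of_rat_dense[of h "h + 1"] by auto
  show ?thesis
  proof (rule cong_AE[OF test_space_indicator[OF _ w] quadrant_C_per[OF w, of "(p, q)"]])
    have "indicator (quadrant (p, q)) a = (1::real)" if "a \<in> S" for a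
      using that pq by (auto simp: quadrant_def Sigma_M_def)
    then show "AE a in lebesgue_on S. (\<lambda>y. indicator UNIV a * w y) = (\<lambda>y. indicator (quadrant (p, q)) a * w y)"
      by (intro AE_I2) simp
  qed simp
qed

private lemma Good_sum:
  assumes "finite I" "\<And>i. i \<in> I \<Longrightarrow> Good (f i)"
  shows "Good (\<lambda>a p. \<Sum>i\<in>I. f i a p)"
  using assms
proof (induction I rule: finite_induct)
  case empty
  then show ?case using Gcmult[OF Ggen, of 0] by simp
next
  case (insert i I)
  then show ?case using Gadd[of "f i" "\<lambda>a p. \<Sum>i\<in>I. f i a p"] by simp
qed

text \<open>Dynkin's argument over the intersection-stable quadrants. Complements come from
  linearity and \<open>UNIV_C_per\<close>; for disjoint unions the indicator of the tail tends to 0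
  in \<open>L^2(S)\<close> by dominated convergence, as \<open>S\<close> has finite measure.\<close>

private lemma borel_C_per:
  assumes B: "B \<in> sets borel" and w: "w \<in> C_per"
  shows "Good (\<lambda>a p. indicator B a * w p)"
proof -
  have sb: "sigma_sets UNIV (range quadrant) = sets borel"
    by (subst borel_eq_quadrants) simp
  have "B \<in> sigma_sets UNIV (range quadrant)" using B by (simp add: sb)
  then show ?thesis
  proof (induction rule: sigma_sets_induct_disjoint[OF Int_stable_quadrants subset_UNIV[of "range quadrant", folded Pow_UNIV],
      consumes 1, case_names basic empty compl union])
    case (basic A)
    then show ?case using quadrant_C_per[OF w] by auto
  next
    case empty
    show ?case using Good_sum[of "{}"] by simp
  next
    case (compl A)
    from Gadd[OF UNIV_C_per[OF w] Gcmult[OF compl(2), of "- 1"]]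
    show ?case
      by (simp add: indicator_diff left_diff_distrib Compl_eq_Diff_UNIV[symmetric] indicator_compl)
  next
    case (union A)
    have A: "A i \<in> sets borel" for i using union(2) by (auto simp: sb)
    show ?case
    proof (rule Gapprox)
      show "(\<lambda>a p. indicator (\<Union>i. A i) a * w p) \<in> test_space S"
        by (intro test_space_indicator w sets.countable_UN) (use A in auto)
      fix e :: real assume e: "0 < e"
      define c where "c = C_per_norm w"
      \<comment> \<open>The tail indicator scaled by the norm of \<open>w\<close>; it dominates the
        sup norm of the truncation error at \<open>a\<close>.\<close>
      define g where "g n a = c * (indicator (\<Union>i. A i) a - indicator (\<Union>i<n. A i) a :: real)" for n :: nat and a
      have gm: "g n \<in> borel_measurable (lebesgue_on S)" for n
      proof -
        have "g n \<in> borel_measurable borel"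
          unfolding g_def using A by measurable
        then show ?thesis by (intro measurable_restrict_space1 measurable_completion) simp
      qed
      have gb: "\<bar>g n a\<bar> \<le> c" for n a
        using C_per_norm_nonneg[OF w] by (auto simp: g_def c_def indicator_def)
      have gb2: "norm ((g n a)\<^sup>2) \<le> c\<^sup>2" for n a
        using power_mono[OF gb[of n a], of 2] by simp
      have gs: "sqint (lebesgue_on S) (g n)" for n
        unfolding sqint_def
      proof
        show "integrable (lebesgue_on S) (\<lambda>a. (g n a)\<^sup>2)"
        proof (rule Bochner_Integration.integrable_bound)
          show "integrable (lebesgue_on S) (\<lambda>_. c\<^sup>2)" using const_sqint[of c] by (simp add: sqint_def)
          show "(\<lambda>a. (g n a)\<^sup>2) \<in> borel_measurable (lebesgue_on S)" using gm[of n] by measurable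
          show "AE a in lebesgue_on S. norm ((g n a)\<^sup>2) \<le> norm (c\<^sup>2)" using gb2[of n] by simp
        qed
      qed (rule gm)
      have "(\<lambda>n. LINT a|lebesgue_on S. (g n a)\<^sup>2) \<longlonglongrightarrow> (LINT a|lebesgue_on S. 0)"
      proof (rule integral_dominated_convergence)
        show "integrable (lebesgue_on S) (\<lambda>_. c\<^sup>2)" using const_sqint[of c] by (simp add: sqint_def)
        show "(\<lambda>a. (g n a)\<^sup>2) \<in> borel_measurable (lebesgue_on S)" for n using gm[of n] by measurable
        show "AE a in lebesgue_on S. norm ((g n a)\<^sup>2) \<le> c\<^sup>2" for n using gb2 by blast
        have "(\<lambda>n. (g n a)\<^sup>2) \<longlonglongrightarrow> (c * (indicator (\<Union>i. A i) a - indicator (\<Union>i. A i) a))\<^sup>2" for a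
          unfolding g_def by (intro tendsto_intros LIMSEQ_indicator_UN)
        then show "AE a in lebesgue_on S. (\<lambda>n. (g n a)\<^sup>2) \<longlonglongrightarrow> 0" by simp
      qed simp
      then have "(\<lambda>n. norm2 (lebesgue_on S) (g n)) \<longlonglongrightarrow> sqrt 0"
        unfolding norm2_def by (intro tendsto_real_sqrt) simp
      then have "(\<lambda>n. norm2 (lebesgue_on S) (g n)) \<longlonglongrightarrow> 0" by simp
      from order_tendstoD(2)[OF this e] obtain n where n: "norm2 (lebesgue_on S) (g n) < e"
        by (auto dest: eventually_happens)
      have ind: "indicator (\<Union>i<n. A i) a * w p = (\<Sum>i<n. indicator (A i) a * w p)" for a p
        using union(1) by (subst indicator_UN_disjoint) (auto simp: sum_distrib_right disjoint_family_on_def)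
      let ?d = "\<lambda>a p. indicator (\<Union>i. A i) a * w p - indicator (\<Union>i<n. A i) a * w p"
      have "Good (\<lambda>a p. indicator (\<Union>i<n. A i) a * w p)"
        unfolding ind by (rule Good_sum) (use union(3) in auto)
      moreover have "test_norm S ?d \<le> norm2 (lebesgue_on S) (g n)"
      proof (rule test_norm_le[OF gs])
        show "AE a in lebesgue_on S. (?d a) \<in> C_per"
          by (intro AE_I2 C_per_diff C_per_cmult w)
        have "C_per_norm (?d a) \<le> \<bar>g n a\<bar>" for a
          using C_per_norm_cmult[OF w, of "indicator (\<Union>i. A i) a - indicator (\<Union>i<n. A i) a"] C_per_norm_nonneg[OF w]
          unfolding g_def c_def abs_mult by (simp add: mult.commute[of "C_per_norm w"] left_diff_distrib[of _ _ "w _"])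
        then show "AE a in lebesgue_on S. C_per_norm (?d a) \<le> \<bar>g n a\<bar>"
          by blast
      qed
      ultimately show "\<exists>g. Good g \<and> test_norm S (\<lambda>a p. indicator (\<Union>i. A i) a * w p - g a p) < e"
        using n by (meson le_less_trans)
    qed
  qed
qed

text \<open>Density is stated for a predicate that is linear and closed in \<open>test_norm\<close>,
  so that convergence of the functionals can be proved by checking generators only. What remains
  here is to write a simple function as a finite sum over its values, for which
  \<open>borel_C_per\<close> applies.\<close>

lemma test_space_density_principle:
  assumes f: "f \<in> test_space (space_time h T)"
  shows "Good f"
proof (rule Gapprox[OF f])
  fix e :: real assume "0 < e"
  from test_space_dense_simple[OF S f this] obtain s where
    s: "simple_function (lebesgue_on S) s" "s ` space (lebesgue_on S) \<subseteq> C_per"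
      "test_norm S (\<lambda>a p. f a p - s a p) < e" by blast
  obtain s' where s': "simple_function (lborel :: (real \<times> real) measure) s'" "AE a in lborel. a \<in> S \<longrightarrow> s a = s' a"
    using lebesgue_on_simple_function_borel[OF S s(1)] by blast
  let ?W = "s ` space (lebesgue_on S)"
  have finW: "finite ?W" by (rule simple_functionD(1)[OF s(1)])
  \<comment> \<open>The level sets are those of the Borel version \<open>s'\<close>, while the
    values range over those of \<open>s\<close>, which are known to lie in
    \<open>C_per\<close>.\<close>
  have "Good (\<lambda>a p. \<Sum>w\<in>?W. indicator (s' -` {w}) a * w p)"
  proof (rule Good_sum[OF finW])
    fix w assume "w \<in> ?W"
    moreover have "s' -` {w} \<in> sets borel"
      using simple_functionD(2)[OF s'(1), of "{w}"] by simp
    ultimately show "Good (\<lambda>a p. indicator (s' -` {w}) a * w p)"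
      using s(2) by (intro borel_C_per) auto
  qed
  moreover have "AE a in lebesgue_on S. s a = (\<lambda>p. \<Sum>w\<in>?W. indicator (s' -` {w}) a * w p)"
  proof -
    have "AE a in lebesgue_on S. s a = s' a" using s'(2) S by (simp add: AE_lebesgue_on)
    then show ?thesis
      using AE_space
    proof eventually_elim
      case (elim a)
      have "(\<Sum>w\<in>?W. indicator (s' -` {w}) a * w p) = (\<Sum>w\<in>?W. if w = s a then w p else 0)" for p
        using elim(1) by (intro sum.cong) (auto simp: indicator_def)
      moreover have "(\<Sum>w\<in>?W. if w = s a then w p else 0) = s a p" for p
        using imageI[OF elim(2), of s] finW by (subst sum.delta) simp_all
      ultimately show ?case by (intro ext) (simp only:)
    qed
  qed
  ultimately have "Good s"
    by (intro cong_AE[OF test_space_simple[OF S space_time_finite s(1,2)]])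
  with s(3) show "\<exists>g. Good g \<and> test_norm S (\<lambda>a p. f a p - g a p) < e" by blast
qed

end

section \<open>The mean value property\<close>

lemma has_bochner_integral_lborel_prod:
  fixes f :: "'a::euclidean_space \<Rightarrow> real" and g :: "'b::euclidean_space \<Rightarrow> real"
  assumes f: "has_bochner_integral lborel f x" and g: "has_bochner_integral lborel g y"
  shows "has_bochner_integral lborel (\<lambda>p. f (fst p) * g (snd p)) (x * y)"
proof -
  have fi: "integrable lborel f" and gi: "integrable lborel g"
    using f g by (simp_all add: has_bochner_integral_iff)
  have "integrable (lborel \<Otimes>\<^sub>M lborel) (\<lambda>p. f (fst p) * g (snd p))"
  proof (rule lborel_pair.Fubini_integrable)
    show "(\<lambda>p. f (fst p) * g (snd p)) \<in> borel_measurable (lborel \<Otimes>\<^sub>M lborel)"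
      using borel_measurable_integrable[OF fi] borel_measurable_integrable[OF gi] by measurable
    show "integrable lborel (\<lambda>x. LINT y|lborel. norm (f (fst (x, y)) * g (snd (x, y))))"
      using fi by (simp add: abs_mult)
    show "AE x in lborel. integrable lborel (\<lambda>y. f (fst (x, y)) * g (snd (x, y)))"
      using gi by simp
  qed
  then have int: "integrable lborel (\<lambda>p. f (fst p) * g (snd p))"
    by (simp add: lborel_prod)
  then show ?thesis
    using f g integral_lborel_pair(1)[OF int] by (simp add: has_bochner_integral_iff)
qed

lemma integrable_continuous_interval:
  fixes f :: "real \<Rightarrow> real"
  assumes "continuous_on UNIV f"
  shows "integrable lborel (\<lambda>t. indicator {a<..<b} t * f t)"
proof -
  have "integrable lborel (\<lambda>t. indicator {a<..<b} t *\<^sub>R (indicator {a..b} t *\<^sub>R f t))"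
    using borel_integrable_atLeastAtMost'[OF continuous_on_subset[OF assms subset_UNIV, of "{a..b}"]]
    unfolding set_integrable_def by (rule integrable_mult_indicator[rotated]) simp
  moreover have "(\<lambda>t. indicator {a<..<b} t *\<^sub>R (indicator {a..b} t *\<^sub>R f t)) = (\<lambda>t. indicator {a<..<b} t * f t)"
    by (auto simp: fun_eq_iff indicator_def)
  ultimately show ?thesis by simp
qed

lemma integral_Ioo_eq_Icc:
  fixes f :: "real \<Rightarrow> real"
  assumes "f \<in> borel_measurable borel"
  shows "(LINT t|lborel. indicator {a<..<b} t * f t) = (LINT t|lborel. indicator {a..b} t *\<^sub>R f t)"
proof (rule integral_cong_AE)
  have "AE t in lborel. t \<noteq> a" "AE t in lborel. t \<noteq> b"
    by (rule AE_lborel_singleton)+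
  then show "AE t in lborel. indicator {a<..<b} t * f t = indicator {a..b} t *\<^sub>R f t"
    by eventually_elim (auto simp: indicator_def less_le)
qed (use assms in simp_all)

lemma integral_cos_le:
  fixes \<omega> r c :: real
  assumes "\<omega> \<noteq> 0"
  shows "\<bar>LINT t|lborel. indicator {0<..<r} t * cos (\<omega> * t + c)\<bar> \<le> 2 / \<bar>\<omega>\<bar>"
proof (cases "0 \<le> r")
  case True
  have "(LINT t|lborel. indicator {0<..<r} t * cos (\<omega> * t + c))
      = (LINT t|lborel. indicator {0..r} t *\<^sub>R cos (\<omega> * t + c))"
    by (rule integral_Ioo_eq_Icc) simp
  also have "\<dots> = sin (\<omega> * r + c) / \<omega> - sin (\<omega> * 0 + c) / \<omega>"
  proof (rule integral_FTC_atLeastAtMost[OF True])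
    show "((\<lambda>t. sin (\<omega> * t + c) / \<omega>) has_vector_derivative cos (\<omega> * x + c)) (at x within {0..r})" for x
      using assms unfolding has_real_derivative_iff_has_vector_derivative[symmetric]
      by (auto intro!: derivative_eq_intros)
  qed (intro continuous_intros)
  also have "\<bar>\<dots>\<bar> \<le> 2 / \<bar>\<omega>\<bar>"
  proof -
    have "\<bar>sin (\<omega> * r + c) - sin (\<omega> * 0 + c)\<bar> \<le> 2"
      using abs_triangle_ineq4[of "sin (\<omega> * r + c)" "sin (\<omega> * 0 + c)"]
        abs_sin_le_one[of "\<omega> * r + c"] abs_sin_le_one[of "\<omega> * 0 + c"] by linarith
    then have "\<bar>sin (\<omega> * r + c) - sin (\<omega> * 0 + c)\<bar> / \<bar>\<omega>\<bar> \<le> 2 / \<bar>\<omega>\<bar>"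
      by (intro divide_right_mono) auto
    then show ?thesis by (simp add: diff_divide_distrib[symmetric])
  qed
  finally show ?thesis .
next
  case False
  then show ?thesis by simp
qed

lemma integral_cos_period:
  fixes k :: int
  shows "(LINT t|lborel. indicator {0<..<1} t * cos (2 * pi * of_int k * t + c)) = (if k = 0 then cos c else 0)"
proof (cases "k = 0")
  case False
  have "(LINT t|lborel. indicator {0<..<1} t * cos (2 * pi * of_int k * t + c))
      = (LINT t|lborel. indicator {0..1} t *\<^sub>R cos (2 * pi * of_int k * t + c))"
    by (rule integral_Ioo_eq_Icc) simp
  also have "\<dots> = sin (2 * pi * of_int k * 1 + c) / (2 * pi * of_int k) - sin (2 * pi * of_int k * 0 + c) / (2 * pi * of_int k)"
  proof (rule integral_FTC_atLeastAtMost)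
    show "((\<lambda>t. sin (2 * pi * of_int k * t + c) / (2 * pi * of_int k)) has_vector_derivative cos (2 * pi * of_int k * x + c)) (at x within {0..1})" for x
      using False unfolding has_real_derivative_iff_has_vector_derivative[symmetric]
      by (auto intro!: derivative_eq_intros)
  qed (auto intro!: continuous_intros)
  also have "sin (2 * pi * of_int k * 1 + c) = sin c"
    using sin_cos_eq_iff[of "2 * pi * of_int k * 1 + c" c] by auto
  finally show ?thesis using False by simp
qed simp

text \<open>This is \<open>max 0 r\<close>. The integral form spares a case distinction when a
  quadrant misses the domain.\<close>

definition len :: "real \<Rightarrow> real" where
  "len r = (LINT t|lborel. indicator {0<..<r} t)"

lemma integral_cos_oscillating:
  fixes \<omega> :: "nat \<Rightarrow> real"
  assumes "filterlim (\<lambda>n. \<bar>\<omega> n\<bar>) at_top sequentially"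
  shows "(\<lambda>n. LINT t|lborel. indicator {0<..<r} t * cos (\<omega> n * t + c)) \<longlonglongrightarrow> 0"
proof (rule Lim_null_comparison)
  show "(\<lambda>n. 2 / \<bar>\<omega> n\<bar>) \<longlonglongrightarrow> 0"
    by (rule real_tendsto_divide_at_top[OF tendsto_const assms])
  have "\<forall>\<^sub>F n in sequentially. \<bar>\<omega> n\<bar> > 0"
    using assms unfolding filterlim_at_top_dense by blast
  then show "\<forall>\<^sub>F n in sequentially. norm (LINT t|lborel. indicator {0<..<r} t * cos (\<omega> n * t + c)) \<le> 2 / \<bar>\<omega> n\<bar>"
    by eventually_elim (use integral_cos_le in auto)
qed

lemma len_cos: "(LINT t|lborel. indicator {0<..<r} t * cos (0 * t + c)) = len r * cos c"
  by (simp add: len_def)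

text \<open>Kept symbolic: rescaling \<open>x1\<close> by \<open>\<epsilon>\<close> yields the same
  factor before the limit and in it.\<close>

definition moment :: "nat \<Rightarrow> real" where
  "moment j = (LINT y|lborel. indicator {- 1/2<..<1/2} y * y ^ j)"

section \<open>The multiplicative span of the generators\<close>

inductive_set test_span :: "(real \<times> real \<Rightarrow> real \<times> (real \<times> real) \<times> real \<Rightarrow> real) set" where
  gen: "(\<lambda>a p. indicator (quadrant q) a * trig_gen j k c m n d p) \<in> test_span"
| add: "f \<in> test_span \<Longrightarrow> g \<in> test_span \<Longrightarrow> (\<lambda>a p. f a p + g a p) \<in> test_span"
| cmult: "f \<in> test_span \<Longrightarrow> (\<lambda>a p. r * f a p) \<in> test_span"

lemma quadrant_Int: "\<exists>r. quadrant p \<inter> quadrant q = quadrant r"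
  using Int_stable_quadrants unfolding Int_stable_def by blast

text \<open>This makes \<open>mean_value\<close> applicable to the square of a test function, the
  source of the \<open>L^2\<close> bound for the limit functional.\<close>

lemma test_span_mult:
  assumes "f \<in> test_span" "g \<in> test_span"
  shows "(\<lambda>a p. f a p * g a p) \<in> test_span"
  using assms
proof (induction f rule: test_span.induct)
  case (gen q j k c m n d)
  from gen show ?case
  proof (induction g rule: test_span.induct)
    case (gen q' j' k' c' m' n' d')
    obtain r where r: "quadrant q \<inter> quadrant q' = quadrant r" using quadrant_Int by blast
    have eq: "indicator (quadrant q) a * x * (indicator (quadrant q') a * y) = indicator (quadrant r) a * (x * y)"
      for a and x y :: real
      by (simp add: r[symmetric] indicator_inter_arith)
    have lin: "i * (1/4 * (x1 + x2 + (x3 + x4))) = 1/4 * ((i * x1 + i * x2) + (i * x3 + i * x4))" for i x1 x2 x3 x4 :: real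
      by (simp add: algebra_simps)
    show ?case
      unfolding eq trig_gen_mult lin by (intro test_span.intros)
  next
    case (add f g)
    show ?case unfolding distrib_left by (rule test_span.add[OF add.IH])
  next
    case (cmult f r)
    show ?case unfolding mult.left_commute[of _ r] by (rule test_span.cmult[OF cmult.IH])
  qed
next
  case (add f g)
  show ?case unfolding distrib_right by (rule test_span.add) (use add in auto)
next
  case (cmult f r)
  show ?case unfolding mult.assoc by (rule test_span.cmult) (use cmult in auto)
qed

lemma test_span_borel:
  assumes "f \<in> test_span"
  shows "(\<lambda>x. f (fst x) (snd x)) \<in> borel_measurable borel"
  using assms
proof (induction rule: test_span.induct)
  case (gen q j k c m n d)
  have q: "quadrant q \<in> sets borel"
    by (rule quadrant_borel)
  have 1: "(\<lambda>x :: (real \<times> real) \<times> real \<times> (real \<times> real) \<times> real. indicator (quadrant q) (fst x) :: real) \<in> borel_measurable borel"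
    by (rule measurable_compose[OF _ borel_measurable_indicator[OF q]])
       (intro borel_measurable_continuous_onI continuous_intros)
  have 2: "(\<lambda>x :: (real \<times> real) \<times> real \<times> (real \<times> real) \<times> real. trig_gen j k c m n d (snd x)) \<in> borel_measurable borel"
    unfolding trig_gen_def case_prod_beta by (intro borel_measurable_continuous_onI continuous_intros)
  show ?case by (rule borel_measurable_times[OF 1 2])
qed (intro borel_measurable_add borel_measurable_times borel_measurable_const; assumption)+

section \<open>Integrals of a single generator\<close>

lemma indicator_less_min:
  "indicator {0<..<r} (t::real) * indicator {..<s} t = (indicator {0<..<min r s} t :: real)"
  by (auto simp: indicator_def)

text \<open>The integrand splits into factors in \<open>t\<close>, \<open>x1\<close> and
  \<open>x2\<close>. The variables \<open>y2\<close> and \<open>z\<close> both read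
  \<open>x2\<close> and merge into the frequency \<open>m / \<epsilon> + n / \<epsilon>^2\<close>,
  and the substitution \<open>x1 = \<epsilon> * y\<close> gives
  \<open>\<epsilon> * moment j\<close>.\<close>

lemma mean_value_gen_oscillating:
  assumes e: "0 < \<epsilon>"
  shows "has_bochner_integral lborel
      (\<lambda>p. indicator ({0<..<T} \<times> Omega_M h \<epsilon>) p *
        (\<lambda>a p. indicator (quadrant q) a * trig_gen j k c m n d p) (fst (oscillate \<epsilon> p)) (snd (oscillate \<epsilon> p)))
      ((LINT t|lborel. indicator {0<..<min T (of_rat (fst q))} t * cos (2 * pi * of_int k / \<epsilon> * t + of_nat c * (pi/2))) *
       (\<epsilon> * moment j *
        (LINT x|lborel. indicator {0<..<min h (of_rat (snd q))} x *
           cos (2 * pi * (of_int m / \<epsilon> + of_int n / \<epsilon>\<^sup>2) * x + of_nat d * (pi/2)))))"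
proof -
  let ?A = "\<lambda>t. indicator {0<..<min T (of_rat (fst q))} t * cos (2 * pi * of_int k / \<epsilon> * t + of_nat c * (pi/2))"
  let ?B = "\<lambda>x. indicator {- \<epsilon> / 2<..<\<epsilon> / 2} x * (x / \<epsilon>) ^ j"
  let ?D = "\<lambda>x. indicator {0<..<min h (of_rat (snd q))} x *
           cos (2 * pi * (of_int m / \<epsilon> + of_int n / \<epsilon>\<^sup>2) * x + of_nat d * (pi/2))"
  have A: "has_bochner_integral lborel ?A (integral\<^sup>L lborel ?A)"
    by (intro has_bochner_integral_integrable integrable_continuous_interval continuous_intros)
  have D: "has_bochner_integral lborel ?D (integral\<^sup>L lborel ?D)"
    by (intro has_bochner_integral_integrable integrable_continuous_interval continuous_intros)
  have "integral\<^sup>L lborel ?B = \<bar>\<epsilon>\<bar> *\<^sub>R (LINT y|lborel. ?B (0 + \<epsilon> * y))"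
    by (rule lborel_integral_real_affine) (use e in simp)
  also have "(\<lambda>y. ?B (0 + \<epsilon> * y)) = (\<lambda>y. indicator {- 1/2<..<1/2} y * y ^ j)"
    using e mult_less_cancel_left_pos[OF e, of "- 1/2"] mult_less_cancel_left_pos[OF e, of _ "1/2"]
    by (auto simp: fun_eq_iff indicator_def)
  finally have "integral\<^sup>L lborel ?B = \<epsilon> * moment j"
    using e by (simp add: moment_def)
  then have B: "has_bochner_integral lborel ?B (\<epsilon> * moment j)"
    using e integrable_continuous_interval[of "\<lambda>x. (x / \<epsilon>) ^ j"]
    by (simp add: has_bochner_integral_iff continuous_intros)
  have eq: "indicator ({0<..<T} \<times> Omega_M h \<epsilon>) p *
        (indicator (quadrant q) (fst (oscillate \<epsilon> p)) * trig_gen j k c m n d (snd (oscillate \<epsilon> p)))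
      = ?A (fst p) * (?B (fst (snd p)) * ?D (snd (snd p)))" for p
  proof -
    obtain t x1 x2 where p: "p = (t, x1, x2)" by (cases p) auto
    have cos1: "cos (2 * pi * (of_int k * (t / \<epsilon>)) + of_nat c * (pi/2)) = cos (2 * pi * of_int k / \<epsilon> * t + of_nat c * (pi/2))"
      by (rule arg_cong[where f = cos]) simp
    have cos2: "cos (2 * pi * (of_int m * (x2 / \<epsilon>) + of_int n * (x2 / \<epsilon>\<^sup>2)) + of_nat d * (pi/2))
        = cos (2 * pi * (of_int m / \<epsilon> + of_int n / \<epsilon>\<^sup>2) * x2 + of_nat d * (pi/2))"
      by (rule arg_cong[where f = cos]) (simp add: algebra_simps)
    have ind: "indicator ({0<..<T} \<times> Omega_M h \<epsilon>) (t, x1, x2) * indicator (quadrant q) (t, x2)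
        = indicator {0<..<min T (of_rat (fst q))} t * indicator {- \<epsilon> / 2<..<\<epsilon> / 2} x1
          * (indicator {0<..<min h (of_rat (snd q))} x2 :: real)"
      unfolding Omega_M_def quadrant_def indicator_times fst_conv snd_conv indicator_less_min[symmetric]
      by (simp only: mult_ac)
    have alg: "i * (qq * (y * X * W)) = a * X * (b * y * (e * W))"
      if "i * qq = a * b * e" for i qq a b e y X W :: real
    proof -
      have "i * (qq * (y * X * W)) = (i * qq) * (y * X * W)" by (simp only: mult.assoc)
      also have "\<dots> = a * X * (b * y * (e * W))" unfolding that by (simp only: mult_ac)
      finally show ?thesis .
    qed
    show ?thesis
      unfolding p oscillate_def trig_gen_def fst_conv snd_conv prod.case cos1 cos2
      by (rule alg[OF ind])
  qed
  show ?thesis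
    unfolding eq by (rule has_bochner_integral_lborel_prod[OF A has_bochner_integral_lborel_prod[OF B D]])
qed

text \<open>Here \<open>y2\<close> and \<open>z\<close> are independent, so their common cosine has
  to be split before Fubini applies. \<open>F r s\<close> is the product integrand with phase
  \<open>r\<close> in \<open>y2\<close> and phase \<open>s\<close> in \<open>z\<close>.\<close>

lemma mean_value_gen_limit:
  shows "has_bochner_integral (lebesgue_on (limit_domain h T))
      (uncurry_test (\<lambda>a p. indicator (quadrant q) a * trig_gen j k c m n d p))
      (len (min T (of_rat (fst q))) * (if k = 0 then cos (of_nat c * (pi/2)) else 0) *
        (moment j * (len (min h (of_rat (snd q))) * (if m = 0 \<and> n = 0 then cos (of_nat d * (pi/2)) else 0))))"
    (is "has_bochner_integral _ (uncurry_test ?f) ?L")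
proof -
  let ?t = "indicator {0<..<min T (of_rat (fst q))} :: real \<Rightarrow> real"
  let ?x = "indicator {0<..<min h (of_rat (snd q))} :: real \<Rightarrow> real"
  let ?\<tau> = "\<lambda>\<tau>. indicator {0<..<1} \<tau> * cos (2 * pi * of_int k * \<tau> + of_nat c * (pi/2))"
  let ?y1 = "\<lambda>y. indicator {- 1/2<..<1/2} y * y ^ j"
  let ?y2 = "\<lambda>r y. indicator {0<..<1} y * cos (2 * pi * of_int m * y + r)"
  let ?z = "\<lambda>r z. indicator {0<..<1} z * cos (2 * pi * of_int n * z + r)"
  let ?d = "of_nat d * (pi/2)"
  have t: "has_bochner_integral lborel ?t (len (min T (of_rat (fst q))))"
    using integrable_continuous_interval[of "\<lambda>_. 1"] by (simp add: has_bochner_integral_iff len_def)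
  have x: "has_bochner_integral lborel ?x (len (min h (of_rat (snd q))))"
    using integrable_continuous_interval[of "\<lambda>_. 1"] by (simp add: has_bochner_integral_iff len_def)
  have cosI: "has_bochner_integral lborel (\<lambda>\<tau>. indicator {0<..<1} \<tau> * cos (2 * pi * of_int i * \<tau> + r)) (if i = 0 then cos r else 0)" for i :: int and r
    unfolding has_bochner_integral_iff integral_cos_period
    by (intro conjI integrable_continuous_interval continuous_intros refl)
  have y1: "has_bochner_integral lborel ?y1 (moment j)"
    unfolding moment_def by (intro has_bochner_integral_integrable integrable_continuous_interval continuous_intros)
  define F where "F r s q' = ?t (fst q') * (?x (fst (snd q')) * (?\<tau> (fst (snd (snd q'))) *
      (?y1 (fst (fst (snd (snd (snd q'))))) * ?y2 r (snd (fst (snd (snd (snd q')))))) * ?z s (snd (snd (snd (snd q'))))))"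
    for r s and q' :: "real \<times> real \<times> real \<times> (real \<times> real) \<times> real"
  have F: "has_bochner_integral lborel (F r s)
     (len (min T (of_rat (fst q))) * (len (min h (of_rat (snd q))) * ((if k = 0 then cos (of_nat c * (pi/2)) else 0) *
       (moment j * (if m = 0 then cos r else 0) * (if n = 0 then cos s else 0)))))" for r s
    unfolding F_def mult.assoc[of "?\<tau> _"]
    by (rule has_bochner_integral_lborel_prod[OF t has_bochner_integral_lborel_prod[OF x
          has_bochner_integral_lborel_prod[OF cosI has_bochner_integral_lborel_prod[OF
            has_bochner_integral_lborel_prod[OF y1 cosI] cosI]]]])
  have s0: "(if n = 0 then cos (- (pi/2)) else 0) = (0::real)" by simp
  \<comment> \<open>The addition formula with both products written as cosines: the product of sines
    carries the phase shifts \<open>pi/2\<close> and \<open>- (pi/2)\<close>. Its \<open>z\<close>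
    integral vanishes for every \<open>n\<close>, by periodicity if \<open>n\<close> is nonzero and
    by \<open>s0\<close> if \<open>n = 0\<close>.\<close>
  have eq: "indicator (limit_domain h T) q' * uncurry_test ?f q' = F ?d 0 q' + F (?d + pi/2) (- (pi/2)) q'" for q'
  proof -
    obtain t x \<tau> y1 y2 z where q': "q' = (t, x, \<tau>, (y1, y2), z)" by (cases q') auto
    have cos1: "cos (2 * pi * (of_int k * \<tau>) + of_nat c * (pi/2)) = cos (2 * pi * of_int k * \<tau> + of_nat c * (pi/2))"
      by (simp add: mult.assoc)
    have a1: "cos (a + pi/2) = - sin a" for a :: real by (simp add: cos_add)
    have a2: "cos (b + - (pi/2)) = sin b" for b :: real by (simp add: cos_diff)
    have "cos (2 * pi * (of_int m * y2 + of_int n * z) + ?d)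
        = cos ((2 * pi * of_int m * y2 + ?d) + (2 * pi * of_int n * z))"
      by (rule arg_cong[where f = cos]) (simp add: algebra_simps)
    also have "\<dots> = cos (2 * pi * of_int m * y2 + ?d) * cos (2 * pi * of_int n * z + 0)
        + cos (2 * pi * of_int m * y2 + (?d + pi/2)) * cos (2 * pi * of_int n * z + - (pi/2))"
      unfolding a2 add.assoc[symmetric] a1 by (simp add: cos_add)
    finally have cos2: "cos (2 * pi * (of_int m * y2 + of_int n * z) + ?d) = \<dots>" .
    have ind: "indicator (limit_domain h T) (t, x, \<tau>, (y1, y2), z) * indicator (quadrant q) (t, x)
        = ?t t * ?x x * (indicator {0<..<1} \<tau> * indicator {- 1/2<..<1/2} y1 * indicator {0<..<1} y2 * (indicator {0<..<1} z :: real))"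
      unfolding Sigma_M_def T_cell_def Y_cell_def Z_cell_def quadrant_def indicator_times fst_conv snd_conv
        indicator_less_min[symmetric]
      by (simp only: mult_ac)
    have alg: "i * (qq * (y * X * (C1 * Z1 + C2 * Z2)))
        = a * (b * (c * X * (d * y * (e * C1)) * (f * Z1))) + a * (b * (c * X * (d * y * (e * C2)) * (f * Z2)))"
      if "i * qq = a * b * (c * d * e * f)" for i qq y X C1 C2 Z1 Z2 a b c d e f :: real
    proof -
      have "i * (qq * (y * X * (C1 * Z1 + C2 * Z2))) = (i * qq) * (y * X * (C1 * Z1 + C2 * Z2))"
        by (simp only: mult.assoc)
      also have "\<dots> = a * (b * (c * X * (d * y * (e * C1)) * (f * Z1))) + a * (b * (c * X * (d * y * (e * C2)) * (f * Z2)))"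
        unfolding that by (simp only: distrib_left mult_ac)
      finally show ?thesis .
    qed
    show ?thesis
      unfolding q' F_def uncurry_test_def trig_gen_def fst_conv snd_conv prod.case cos1 cos2
      by (rule alg[OF ind])
  qed
  have "has_bochner_integral lborel (\<lambda>q'. indicator (limit_domain h T) q' * uncurry_test ?f q') ?L"
    unfolding eq using has_bochner_integral_add[OF F[of ?d 0] F[of "?d + pi/2" "- (pi/2)"]] unfolding s0
    by (rule back_subst[of "has_bochner_integral _ _"]) simp
  moreover have "uncurry_test ?f \<in> borel_measurable borel"
    unfolding uncurry_test_def
    by (rule measurable_compose[OF _ test_span_borel[OF test_span.gen], of "\<lambda>q'. ((fst q', fst (snd q')), snd (snd q'))", simplified fst_conv snd_conv])
       (intro borel_measurable_continuous_onI continuous_intros)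
  ultimately show ?thesis
    using lebesgue_on_integrable_cong_borel[OF domain_borel(11)] lebesgue_on_integral_cong_borel[OF domain_borel(11)]
    by (simp add: has_bochner_integral_iff)
qed

section \<open>Separation of scales and the mean value limit\<close>

context
  fixes \<epsilon> :: "nat \<Rightarrow> real"
  assumes pos: "\<And>n. 0 < \<epsilon> n" and lim: "\<epsilon> \<longlonglongrightarrow> 0"
begin

text \<open>The frequency is \<open>(m + n / \<epsilon>) / \<epsilon>\<close> up to the factor
  \<open>2 * pi\<close>. If \<open>n\<close> is nonzero, the finer scale wins, as
  \<open>\<bar>m + n / \<epsilon>\<bar>\<close> is at least
  \<open>\<bar>n\<bar> / \<epsilon> - \<bar>m\<bar>\<close>; so the two scales can cancel for single
  values of \<open>\<epsilon>\<close> but not in the limit.\<close>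

private lemma frequency_tends_to_infinity:
  fixes m n :: int
  assumes "m \<noteq> 0 \<or> n \<noteq> 0"
  shows "filterlim (\<lambda>i. \<bar>2 * pi * (of_int m / \<epsilon> i + of_int n / (\<epsilon> i)\<^sup>2)\<bar>) at_top sequentially"
proof -
  have inv: "filterlim (\<lambda>i. inverse (\<epsilon> i)) at_top sequentially"
    using filterlim_inverse_at_top[OF lim] pos by simp
  have "filterlim (\<lambda>i. \<bar>of_int m + of_int n * inverse (\<epsilon> i)\<bar> * inverse (\<epsilon> i)) at_top sequentially"
  proof (cases "n = 0")
    case True
    with assms have "0 < \<bar>real_of_int m\<bar>" by simp
    from filterlim_tendsto_pos_mult_at_top[OF tendsto_const this inv] show ?thesis
      using True by simp
  next
    case False
    then have n: "0 < \<bar>real_of_int n\<bar>" by simp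
    have "filterlim (\<lambda>i. - \<bar>of_int m\<bar> + \<bar>real_of_int n\<bar> * inverse (\<epsilon> i)) at_top sequentially"
      by (intro filterlim_tendsto_add_at_top[OF tendsto_const] filterlim_tendsto_pos_mult_at_top[OF tendsto_const n inv])
    then have "filterlim (\<lambda>i. \<bar>of_int m + of_int n * inverse (\<epsilon> i)\<bar>) at_top sequentially"
    proof (rule filterlim_at_top_mono, intro always_eventually allI)
      fix i
      have "\<bar>real_of_int n\<bar> * inverse (\<epsilon> i) = \<bar>of_int n * inverse (\<epsilon> i)\<bar>"
        using pos[of i] by (simp add: abs_mult)
      then show "- \<bar>of_int m\<bar> + \<bar>real_of_int n\<bar> * inverse (\<epsilon> i) \<le> \<bar>of_int m + of_int n * inverse (\<epsilon> i)\<bar>"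
        by linarith
    qed
    then show ?thesis by (rule filterlim_at_top_mult_at_top[OF _ inv])
  qed
  from filterlim_tendsto_pos_mult_at_top[OF tendsto_const _ this, of "2 * pi"]
  have "filterlim (\<lambda>i. 2 * pi * (\<bar>of_int m + of_int n * inverse (\<epsilon> i)\<bar> * inverse (\<epsilon> i))) at_top sequentially"
    by simp
  moreover have "2 * pi * (\<bar>of_int m + of_int n * inverse (\<epsilon> i)\<bar> * inverse (\<epsilon> i))
      = \<bar>2 * pi * (of_int m / \<epsilon> i + of_int n / (\<epsilon> i)\<^sup>2)\<bar>" for i
  proof -
    have "of_int m / \<epsilon> i + of_int n / (\<epsilon> i)\<^sup>2 = (of_int m + of_int n * inverse (\<epsilon> i)) * inverse (\<epsilon> i)"
      using less_imp_neq[OF pos[of i]] by (simp add: field_simps power2_eq_square)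
    then show ?thesis using pos[of i] by (simp add: abs_mult)
  qed
  ultimately show ?thesis by simp
qed

text \<open>Existence and value of the integrals travel together through the induction, because
  additivity of the values relies on integrability. For a generator, a nonzero frequency makes both
  the oscillating limit and the exact cell integral 0; with all frequencies 0 both reduce to the
  same product of lengths, moment and phases.\<close>

lemma mean_value:
  assumes "\<phi> \<in> test_span"
  shows "\<exists>I L. (\<forall>n. has_bochner_integral lborel
      (\<lambda>p. indicator ({0<..<T} \<times> Omega_M h (\<epsilon> n)) p * \<phi> (fst (oscillate (\<epsilon> n) p)) (snd (oscillate (\<epsilon> n) p))) (I n)) \<and>
    has_bochner_integral (lebesgue_on (limit_domain h T)) (uncurry_test \<phi>) L \<and> (\<lambda>n. I n / \<epsilon> n) \<longlonglongrightarrow> L"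
  using assms
proof (induction rule: test_span.induct)
  case (gen q j k c m n d)
  let ?A = "\<lambda>i. LINT t|lborel. indicator {0<..<min T (of_rat (fst q))} t * cos (2 * pi * of_int k / \<epsilon> i * t + of_nat c * (pi/2))"
  let ?D = "\<lambda>i. LINT x|lborel. indicator {0<..<min h (of_rat (snd q))} x *
           cos (2 * pi * (of_int m / \<epsilon> i + of_int n / (\<epsilon> i)\<^sup>2) * x + of_nat d * (pi/2))"
  have A: "?A \<longlonglongrightarrow> len (min T (of_rat (fst q))) * (if k = 0 then cos (of_nat c * (pi/2)) else 0)"
  proof (cases "k = 0")
    case True
    show ?thesis
      unfolding True by (simp only: of_int_0 mult_zero_right div_0 len_cos if_True simp_thms tendsto_const)
  next
    case False
    \<comment> \<open>The time variable has only the scale \<open>1 / \<epsilon>\<close>, which is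
      the frequency with second coefficient 0.\<close>
    then show ?thesis
      using integral_cos_oscillating[OF frequency_tends_to_infinity[of k 0]] by simp
  qed
  have D: "?D \<longlonglongrightarrow> len (min h (of_rat (snd q))) * (if m = 0 \<and> n = 0 then cos (of_nat d * (pi/2)) else 0)"
  proof (cases "m = 0 \<and> n = 0")
    case True
    then have "m = 0" "n = 0" by auto
    then show ?thesis
      by (simp only: of_int_0 div_0 add_0_left mult_zero_right len_cos if_True simp_thms tendsto_const)
  next
    case False
    then have "m \<noteq> 0 \<or> n \<noteq> 0" by simp
    from integral_cos_oscillating[OF frequency_tends_to_infinity[OF this]] show ?thesis
      unfolding if_not_P[OF False] mult_zero_right .
  qed
  have eq: "(\<lambda>i. ?A i * (\<epsilon> i * moment j * ?D i) / \<epsilon> i) = (\<lambda>i. ?A i * (moment j * ?D i))"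
    using pos by (auto simp: fun_eq_iff less_imp_neq[symmetric])
  have "(\<lambda>i. ?A i * (moment j * ?D i)) \<longlonglongrightarrow>
      len (min T (of_rat (fst q))) * (if k = 0 then cos (of_nat c * (pi/2)) else 0) *
        (moment j * (len (min h (of_rat (snd q))) * (if m = 0 \<and> n = 0 then cos (of_nat d * (pi/2)) else 0)))"
    by (intro tendsto_mult A D tendsto_const)
  then have limit: "(\<lambda>i. ?A i * (\<epsilon> i * moment j * ?D i) / \<epsilon> i) \<longlonglongrightarrow>
      len (min T (of_rat (fst q))) * (if k = 0 then cos (of_nat c * (pi/2)) else 0) *
        (moment j * (len (min h (of_rat (snd q))) * (if m = 0 \<and> n = 0 then cos (of_nat d * (pi/2)) else 0)))"
    unfolding eq .
  show ?case
  proof (rule exI[of _ "\<lambda>i. ?A i * (\<epsilon> i * moment j * ?D i)"],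
      rule exI[of _ "len (min T (of_rat (fst q))) * (if k = 0 then cos (of_nat c * (pi/2)) else 0) *
        (moment j * (len (min h (of_rat (snd q))) * (if m = 0 \<and> n = 0 then cos (of_nat d * (pi/2)) else 0)))"],
      intro conjI allI)
    show "has_bochner_integral lborel
      (\<lambda>p. indicator ({0<..<T} \<times> Omega_M h (\<epsilon> i)) p *
        (indicator (quadrant q) (fst (oscillate (\<epsilon> i) p)) * trig_gen j k c m n d (snd (oscillate (\<epsilon> i) p))))
      (?A i * (\<epsilon> i * moment j * ?D i))" for i
      by (rule mean_value_gen_oscillating[OF pos])
    show "has_bochner_integral (lebesgue_on (limit_domain h T))
      (uncurry_test (\<lambda>a p. indicator (quadrant q) a * trig_gen j k c m n d p))
      (len (min T (of_rat (fst q))) * (if k = 0 then cos (of_nat c * (pi/2)) else 0) *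
        (moment j * (len (min h (of_rat (snd q))) * (if m = 0 \<and> n = 0 then cos (of_nat d * (pi/2)) else 0))))"
      by (rule mean_value_gen_limit)
  qed (rule limit)
next
  let ?O = "\<lambda>n f p. indicator ({0<..<T} \<times> Omega_M h (\<epsilon> n)) p * f (fst (oscillate (\<epsilon> n) p)) (snd (oscillate (\<epsilon> n) p))"
  case (add f g)
  then obtain I L I' L' where
    f: "\<And>n. has_bochner_integral lborel (?O n f) (I n)"
      "has_bochner_integral (lebesgue_on (limit_domain h T)) (uncurry_test f) L" "(\<lambda>n. I n / \<epsilon> n) \<longlonglongrightarrow> L" and
    g: "\<And>n. has_bochner_integral lborel (?O n g) (I' n)"
      "has_bochner_integral (lebesgue_on (limit_domain h T)) (uncurry_test g) L'" "(\<lambda>n. I' n / \<epsilon> n) \<longlonglongrightarrow> L'"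
    by blast
  show ?case
  proof (intro exI[of _ "\<lambda>n. I n + I' n"] exI[of _ "L + L'"] conjI allI)
    show "has_bochner_integral lborel (\<lambda>p. indicator ({0<..<T} \<times> Omega_M h (\<epsilon> n)) p *
        (f (fst (oscillate (\<epsilon> n) p)) (snd (oscillate (\<epsilon> n) p)) + g (fst (oscillate (\<epsilon> n) p)) (snd (oscillate (\<epsilon> n) p)))) (I n + I' n)" for n
      unfolding distrib_left by (intro has_bochner_integral_add f g)
    show "has_bochner_integral (lebesgue_on (limit_domain h T)) (uncurry_test (\<lambda>a p. f a p + g a p)) (L + L')"
      using has_bochner_integral_add[OF f(2) g(2)] by (simp add: uncurry_test_def[abs_def])
    show "(\<lambda>n. (I n + I' n) / \<epsilon> n) \<longlonglongrightarrow> L + L'"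
      unfolding add_divide_distrib by (intro tendsto_add f g)
  qed
next
  let ?O = "\<lambda>n f p. indicator ({0<..<T} \<times> Omega_M h (\<epsilon> n)) p * f (fst (oscillate (\<epsilon> n) p)) (snd (oscillate (\<epsilon> n) p))"
  case (cmult f r)
  then obtain I L where
    f: "\<And>n. has_bochner_integral lborel (?O n f) (I n)"
      "has_bochner_integral (lebesgue_on (limit_domain h T)) (uncurry_test f) L" "(\<lambda>n. I n / \<epsilon> n) \<longlonglongrightarrow> L"
    by blast
  show ?case
  proof (intro exI[of _ "\<lambda>n. r * I n"] exI[of _ "r * L"] conjI allI)
    show "has_bochner_integral lborel (\<lambda>p. indicator ({0<..<T} \<times> Omega_M h (\<epsilon> n)) p *
        (r * f (fst (oscillate (\<epsilon> n) p)) (snd (oscillate (\<epsilon> n) p)))) (r * I n)" for n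
      unfolding mult.left_commute[of _ r] by (intro has_bochner_integral_mult_right f)
    show "has_bochner_integral (lebesgue_on (limit_domain h T)) (uncurry_test (\<lambda>a p. r * f a p)) (r * L)"
      using has_bochner_integral_mult_right[OF f(2), of r] by (simp add: uncurry_test_def[abs_def])
    show "(\<lambda>n. r * I n / \<epsilon> n) \<longlonglongrightarrow> r * L"
      using tendsto_mult_left[OF f(3), of r] by simp
  qed
qed

end

section \<open>Compactness\<close>

lemma test_span_test_space: "f \<in> test_span \<Longrightarrow> f \<in> test_space (space_time h T)"
proof (induction rule: test_span.induct)
  case (gen q j k c m n d)
  have "quadrant q \<in> sets borel"
    by (rule quadrant_borel)
  then show ?case by (rule test_space_indicator[OF _ trig_gen_C_per])
next
  case (add f g)
  show ?case by (rule test_space_add[OF domain_borel(3) add.IH])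
next
  case (cmult f r)
  show ?case by (rule test_space_cmult[OF domain_borel(3) cmult.IH])
qed

text \<open>The bound is the same for all generators, powers of \<open>y1\<close> included since
  \<open>\<bar>y1\<bar>\<close> is at most 1 on the strip. The diagonal extraction relies on one
  constant for all indices.\<close>

lemma test_norm_gen_le:
  "test_norm (space_time h T) (\<lambda>a p. indicator (quadrant q) a * trig_gen j k c m n d p)
    \<le> norm2 (lebesgue_on (space_time h T)) (\<lambda>_. 1)"
proof (rule test_norm_le)
  show "sqint (lebesgue_on (space_time h T)) (\<lambda>_. 1)"
    using finite_measure_lebesgue_on[OF domain_borel(3) space_time_finite]
    by (simp add: sqint_def finite_measure.integrable_const)
  show "AE a in lebesgue_on (space_time h T). (\<lambda>p. indicator (quadrant q) a * trig_gen j k c m n d p) \<in> C_per"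
    by (intro AE_I2 C_per_cmult trig_gen_C_per)
  have "C_per_norm (\<lambda>p. indicator (quadrant q) a * trig_gen j k c m n d p) \<le> \<bar>1\<bar>" for a
  proof (rule C_per_norm_least)
    fix p :: "real \<times> (real \<times> real) \<times> real" assume "p \<in> strip"
    then obtain \<tau> y1 y2 z where p: "p = (\<tau>, (y1, y2), z)" and y: "\<bar>y1\<bar> \<le> 1"
      by (cases p) (auto simp: abs_le_iff)
    have "\<bar>trig_gen j k c m n d p\<bar> \<le> 1 * 1 * 1"
      unfolding trig_gen_def p prod.case abs_mult power_abs
      by (intro mult_mono power_le_one y) auto
    then show "\<bar>indicator (quadrant q) a * trig_gen j k c m n d p\<bar> \<le> \<bar>1\<bar>"
      by (simp add: abs_mult indicator_def)
  qed
  then show "AE a in lebesgue_on (space_time h T).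
      C_per_norm (\<lambda>p. indicator (quadrant q) a * trig_gen j k c m n d p) \<le> \<bar>1\<bar>" by blast
qed

context
  fixes h T C :: real and \<epsilon> :: "nat \<Rightarrow> real" and v :: "nat \<Rightarrow> real \<Rightarrow> real \<times> real \<Rightarrow> real"
  assumes pos: "\<And>n. 0 < \<epsilon> n" and lim: "\<epsilon> \<longlonglongrightarrow> 0"
    and v: "\<And>n. v n \<in> bochner_L2 {0<..<T} (L2_space (Omega_M h (\<epsilon> n))) (L2_norm (Omega_M h (\<epsilon> n)))"
    and C: "0 < C"
    and bound: "\<And>n. 1 / sqrt (\<epsilon> n) * bochner_L2_norm {0<..<T} (L2_norm (Omega_M h (\<epsilon> n))) (v n) \<le> C"
begin

private abbreviation "ST \<equiv> space_time h T"
private abbreviation "P \<equiv> limit_domain h T"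

private definition pairing_val where
  "pairing_val n \<phi> t = (LINT x|lebesgue_on (Omega_M h (\<epsilon> n)).
     v n t x * oscillating (\<epsilon> n) \<phi> t x)"

private definition Lf where
  "Lf n \<phi> = 1 / \<epsilon> n * (LINT t|lebesgue_on {0<..<T}. pairing_val n \<phi> t)"

text \<open>The factor \<open>1 / \<epsilon>\<close> is split evenly: one
  \<open>1 / sqrt \<epsilon>\<close> normalises \<open>v n\<close> as in the assumed bound, the
  other goes with the test function.\<close>

private lemma scaled_bound:
  assumes x: "\<bar>x\<bar> \<le> bochner_L2_norm {0<..<T} (L2_norm (Omega_M h (\<epsilon> n))) (v n) * sqrt J" and J: "0 \<le> J"
  shows "\<bar>1 / \<epsilon> n * x\<bar> \<le> C * sqrt (J / \<epsilon> n)"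
proof -
  let ?b = "bochner_L2_norm {0<..<T} (L2_norm (Omega_M h (\<epsilon> n))) (v n)"
  have e: "0 < \<epsilon> n" by (rule pos)
  have "\<bar>1 / \<epsilon> n * x\<bar> = 1 / \<epsilon> n * \<bar>x\<bar>"
    using e by (simp add: abs_mult)
  also have "\<dots> \<le> 1 / \<epsilon> n * (?b * sqrt J)"
    using e x by (intro mult_left_mono) auto
  also have "\<dots> = (1 / sqrt (\<epsilon> n) * ?b) * sqrt (J / \<epsilon> n)"
  proof -
    have "1 / \<epsilon> n = 1 / (sqrt (\<epsilon> n) * sqrt (\<epsilon> n))" using e by simp
    then show ?thesis by (simp add: real_sqrt_divide)
  qed
  also have "\<dots> \<le> C * sqrt (J / \<epsilon> n)"
    using bound[of n] e J by (intro mult_right_mono) auto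
  finally show ?thesis .
qed

private lemma pairing_test:
  assumes \<phi>: "\<phi> \<in> test_space ST"
  shows "AE t in lebesgue_on {0<..<T}. integrable (lebesgue_on (Omega_M h (\<epsilon> n))) (\<lambda>x.
      v n t x * oscillating (\<epsilon> n) \<phi> t x)"
    and "integrable (lebesgue_on {0<..<T}) (pairing_val n \<phi>)"
    and "\<bar>Lf n \<phi>\<bar> \<le> C * test_norm ST \<phi>"
proof -
  obtain \<psi> where \<psi>: "\<psi> \<in> borel_measurable borel"
    "AE t in lborel. t \<in> {0<..<T} \<longrightarrow> (AE x in lborel. x \<in> Omega_M h (\<epsilon> n) \<longrightarrow>
       oscillating (\<epsilon> n) \<phi> t x = \<psi> (t, x))"
    "integrable lborel (\<lambda>p. indicator ({0<..<T} \<times> Omega_M h (\<epsilon> n)) p * (\<psi> p)\<^sup>2)"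
    "(LINT p|lborel. indicator ({0<..<T} \<times> Omega_M h (\<epsilon> n)) p * (\<psi> p)\<^sup>2) \<le> \<epsilon> n * (test_norm ST \<phi>)\<^sup>2"
    using test_oscillate[OF \<phi> pos[of n]] by blast
  note p = pairing[OF domain_borel(1) domain_borel(4) v[of n] \<psi>(1,3,2)]
  show "AE t in lebesgue_on {0<..<T}. integrable (lebesgue_on (Omega_M h (\<epsilon> n))) (\<lambda>x.
      v n t x * oscillating (\<epsilon> n) \<phi> t x)"
    by (rule p(1))
  show "integrable (lebesgue_on {0<..<T}) (pairing_val n \<phi>)"
    unfolding pairing_val_def by (rule p(2))
  let ?J = "LINT p|lborel. indicator ({0<..<T} \<times> Omega_M h (\<epsilon> n)) p * (\<psi> p)\<^sup>2"
  have "0 \<le> ?J" by (intro integral_nonneg_AE) simp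
  from scaled_bound[OF p(3) this]
  have "\<bar>Lf n \<phi>\<bar> \<le> C * sqrt (?J / \<epsilon> n)"
    by (simp add: Lf_def pairing_val_def)
  also have "\<dots> \<le> C * sqrt ((test_norm ST \<phi>)\<^sup>2)"
    using \<psi>(4) pos[of n] C by (intro mult_left_mono real_sqrt_le_mono) (auto simp: field_simps)
  also have "\<dots> = C * test_norm ST \<phi>"
    by (simp add: test_norm_norm2)
  finally show "\<bar>Lf n \<phi>\<bar> \<le> C * test_norm ST \<phi>" .
qed

private lemma Lf_cmult: "Lf n (\<lambda>a p. r * \<phi> a p) = r * Lf n \<phi>"
proof -
  have "pairing_val n (\<lambda>a p. r * \<phi> a p) = (\<lambda>t. r * pairing_val n \<phi> t)"
    by (simp add: pairing_val_def mult.left_commute[of _ r] fun_eq_iff)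
  then show ?thesis by (simp add: Lf_def)
qed

private lemma Lf_add:
  assumes "\<phi> \<in> test_space ST" "\<psi> \<in> test_space ST"
  shows "Lf n (\<lambda>a p. \<phi> a p + \<psi> a p) = Lf n \<phi> + Lf n \<psi>"
proof -
  have i: "integrable (lebesgue_on {0<..<T}) (pairing_val n (\<lambda>a p. \<phi> a p + \<psi> a p))"
    by (rule pairing_test(2)[OF test_space_add[OF domain_borel(3) assms]])
  note j = pairing_test(2)[OF assms(1), of n] pairing_test(2)[OF assms(2), of n]
  have "(LINT t|lebesgue_on {0<..<T}. pairing_val n (\<lambda>a p. \<phi> a p + \<psi> a p) t)
      = (LINT t|lebesgue_on {0<..<T}. pairing_val n \<phi> t + pairing_val n \<psi> t)"
  proof (rule integral_cong_AE)
    show "AE t in lebesgue_on {0<..<T}. pairing_val n (\<lambda>a p. \<phi> a p + \<psi> a p) t = pairing_val n \<phi> t + pairing_val n \<psi> t"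
      using pairing_test(1)[OF assms(1), of n] pairing_test(1)[OF assms(2), of n]
      by eventually_elim (simp add: pairing_val_def distrib_left)
  qed (use i j in \<open>auto intro!: borel_measurable_add borel_measurable_integrable\<close>)
  then show ?thesis
    using j by (simp add: Lf_def distrib_left add_divide_distrib)
qed

private lemma Lf_diff:
  assumes "\<phi> \<in> test_space ST" "\<psi> \<in> test_space ST"
  shows "Lf n (\<lambda>a p. \<phi> a p - \<psi> a p) = Lf n \<phi> - Lf n \<psi>"
  using Lf_add[OF assms(1) test_space_cmult[OF domain_borel(3) assms(2)], of n "- 1"]
    Lf_cmult[of n "- 1" \<psi>] by simp

text \<open>Unlike \<open>pairing_test\<close>, this estimate takes no supremum over the cell:
  \<open>J n\<close> is the scaled integral of the squared oscillating function, and
  \<open>mean_value\<close> for \<open>\<phi> * \<phi>\<close> identifies its limit.\<close>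

private lemma Lf_span_bound:
  assumes \<phi>: "\<phi> \<in> test_span"
  shows "\<exists>J. (\<forall>n. \<bar>Lf n \<phi>\<bar> \<le> C * sqrt (J n)) \<and> J \<longlonglongrightarrow> (norm2 (lebesgue_on P) (uncurry_test \<phi>))\<^sup>2"
proof -
  obtain I L where
    I: "\<And>n. has_bochner_integral lborel (\<lambda>p. indicator ({0<..<T} \<times> Omega_M h (\<epsilon> n)) p *
        (\<phi> (fst (oscillate (\<epsilon> n) p)) (snd (oscillate (\<epsilon> n) p)) * \<phi> (fst (oscillate (\<epsilon> n) p)) (snd (oscillate (\<epsilon> n) p)))) (I n)"
    and L: "has_bochner_integral (lebesgue_on P) (uncurry_test (\<lambda>a p. \<phi> a p * \<phi> a p)) L"
    and lim: "(\<lambda>n. I n / \<epsilon> n) \<longlonglongrightarrow> L"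
    using mean_value[OF pos lim test_span_mult[OF \<phi> \<phi>], of T h] by blast
  have "L = (norm2 (lebesgue_on P) (uncurry_test \<phi>))\<^sup>2"
    unfolding norm2_power2 using has_bochner_integral_integral_eq[OF L]
    by (simp add: uncurry_test_def[abs_def] power2_eq_square)
  moreover have "\<bar>Lf n \<phi>\<bar> \<le> C * sqrt (I n / \<epsilon> n)" for n
  proof -
    define \<psi> where "\<psi> p = \<phi> (fst (oscillate (\<epsilon> n) p)) (snd (oscillate (\<epsilon> n) p))" for p
    have \<psi>: "\<psi> \<in> borel_measurable borel"
      unfolding \<psi>_def using oscillate_borel[OF test_span_borel[OF \<phi>], of "\<epsilon> n"] .
    have sq: "has_bochner_integral lborel (\<lambda>p. indicator ({0<..<T} \<times> Omega_M h (\<epsilon> n)) p * (\<psi> p)\<^sup>2) (I n)"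
      using I[of n] by (simp add: \<psi>_def power2_eq_square)
    have val: "AE t in lborel. t \<in> {0<..<T} \<longrightarrow> (AE x in lborel. x \<in> Omega_M h (\<epsilon> n) \<longrightarrow>
       oscillating (\<epsilon> n) \<phi> t x = \<psi> (t, x))"
      by (intro AE_I2 impI) (simp add: \<psi>_def oscillate_def)
    have int: "integrable lborel (\<lambda>p. indicator ({0<..<T} \<times> Omega_M h (\<epsilon> n)) p * (\<psi> p)\<^sup>2)"
      and In: "(LINT p|lborel. indicator ({0<..<T} \<times> Omega_M h (\<epsilon> n)) p * (\<psi> p)\<^sup>2) = I n"
      using sq by (simp_all add: has_bochner_integral_iff)
    have "0 \<le> I n"
      unfolding In[symmetric] by (intro integral_nonneg_AE) simp
    from scaled_bound[OF pairing(3)[OF domain_borel(1) domain_borel(4) v[of n] \<psi> int val, unfolded In] this]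
    show ?thesis by (simp add: Lf_def pairing_val_def)
  qed
  ultimately show ?thesis
    by (intro exI[of _ "\<lambda>n. I n / \<epsilon> n"]) (use lim in simp)
qed

lemma multiscale_compactness:
  "\<exists>v0 \<in> L2_space P. \<exists>r::nat \<Rightarrow> nat. strict_mono r \<and> multiscale_converges h T (\<epsilon> \<circ> r) (v \<circ> r) v0"
proof -
  have S: "ST \<in> sets borel" and Pb: "P \<in> sets borel" by (rule domain_borel)+
  define G where "G i = (case i of (q, j, k, c, m, n, d) \<Rightarrow>
      (\<lambda>a p. indicator (quadrant q) a * trig_gen j k c m n d p))"
    for i :: "(rat \<times> rat) \<times> nat \<times> int \<times> nat \<times> int \<times> int \<times> nat"
  have G_norm: "test_norm ST (G i) \<le> norm2 (lebesgue_on ST) (\<lambda>_. 1)" for i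
    by (cases i) (simp add: G_def test_norm_gen_le)
  have G_span: "G i \<in> test_span" for i
    by (cases i) (simp add: G_def test_span.gen)
  have "norm (Lf n (G i)) \<le> C * norm2 (lebesgue_on ST) (\<lambda>_. 1)" for n i
    using order_trans[OF pairing_test(3)[OF test_span_test_space[OF G_span]] mult_left_mono[OF G_norm]] C
    by simp
  \<comment> \<open>Diagonal extraction: each \<open>Lf n\<close> is regarded as a function on the
    countable index type of \<open>G\<close>, with a bound uniform in \<open>n\<close> and in the
    index.\<close>
  then obtain r where r: "strict_mono r" and conv: "\<And>i. \<exists>l. (\<lambda>n. Lf (r n) (G i)) \<longlonglongrightarrow> l"
    using function_convergent_subsequence[of UNIV "\<lambda>n i. Lf n (G i)" "C * norm2 (lebesgue_on ST) (\<lambda>_. 1)"]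
    by (metis UNIV_I countableI_type)
  have span_conv: "convergent (\<lambda>n. Lf (r n) \<phi>)" if "\<phi> \<in> test_span" for \<phi>
    using that
  proof (induction rule: test_span.induct)
    case (gen q j k c m n d)
    show ?case using conv[of "(q, j, k, c, m, n, d)"] by (simp add: G_def convergent_def)
  next
    case (add f g)
    show ?case
      unfolding Lf_add[OF test_span_test_space[OF add.hyps(1)] test_span_test_space[OF add.hyps(2)]]
      by (rule convergent_add[OF add.IH])
  next
    case (cmult f c)
    obtain l where "(\<lambda>n. Lf (r n) f) \<longlonglongrightarrow> l" using cmult.IH by (auto simp: convergent_def)
    then have "(\<lambda>n. c * Lf (r n) f) \<longlonglongrightarrow> c * l" by (rule tendsto_mult_left)
    then show ?case unfolding Lf_cmult convergent_def by blast
  qed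
  \<comment> \<open>Riesz representation needs a functional of functions on \<open>P\<close>, so the
    limit is defined on uncurried functions; \<open>curry\<close> recovers the test
    function.\<close>
  define Lim where "Lim f = lim (\<lambda>n. Lf (r n) (\<lambda>a p. f (fst a, snd a, p)))" for f
  have curry: "(\<lambda>a p. uncurry_test \<phi> (fst a, snd a, p)) = \<phi>" for \<phi>
    by (simp add: uncurry_test_def)
  have Lim: "(\<lambda>n. Lf (r n) \<phi>) \<longlonglongrightarrow> Lim (uncurry_test \<phi>)" if "\<phi> \<in> test_span" for \<phi>
    unfolding Lim_def curry using span_conv[OF that] by (simp add: convergent_LIMSEQ_iff)
  have "emeasure lborel P < \<infinity>"
  proof -
    have "bounded P"
      unfolding Sigma_M_def T_cell_def Y_cell_def Z_cell_def by (intro bounded_Times) auto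
    then show ?thesis by (rule emeasure_bounded_finite)
  qed
  then interpret P: finite_measure "lebesgue_on P" by (rule finite_measure_lebesgue_on[OF Pb])
  have "\<exists>w. sqint (lebesgue_on P) w \<and> (\<forall>f\<in>uncurry_test ` test_span. (LINT x|lebesgue_on P. w x * f x) = Lim f)"
  proof (rule P.riesz_representation_subspace)
    show "sqint (lebesgue_on P) f" if "f \<in> uncurry_test ` test_span" for f
      using that test_uncurry(1)[OF test_span_test_space] by blast
    show "uncurry_test (G undefined) \<in> uncurry_test ` test_span"
      by (rule imageI[OF G_span])
    fix f assume "f \<in> uncurry_test ` test_span"
    then obtain \<phi> where \<phi>: "\<phi> \<in> test_span" and f: "f = uncurry_test \<phi>" by blast
    have cm: "(\<lambda>x. c * f x) = uncurry_test (\<lambda>a p. c * \<phi> a p)" for c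
      by (simp add: f uncurry_test_def[abs_def])
    show "(\<lambda>x. c * f x) \<in> uncurry_test ` test_span" for c
      unfolding cm by (intro imageI test_span.cmult \<phi>)
    show "Lim (\<lambda>x. c * f x) = c * Lim f" for c
    proof (rule LIMSEQ_unique)
      show "(\<lambda>n. Lf (r n) (\<lambda>a p. c * \<phi> a p)) \<longlonglongrightarrow> Lim (\<lambda>x. c * f x)"
        unfolding cm by (intro Lim test_span.cmult \<phi>)
      show "(\<lambda>n. Lf (r n) (\<lambda>a p. c * \<phi> a p)) \<longlonglongrightarrow> c * Lim f"
        unfolding Lf_cmult f by (intro tendsto_mult_left Lim \<phi>)
    qed
    show "\<bar>Lim f\<bar> \<le> C * norm2 (lebesgue_on P) f"
    proof -
      obtain J where J: "\<And>n. \<bar>Lf n \<phi>\<bar> \<le> C * sqrt (J n)" "J \<longlonglongrightarrow> (norm2 (lebesgue_on P) f)\<^sup>2"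
        using Lf_span_bound[OF \<phi>] f by blast
      have "(\<lambda>n. C * sqrt (J (r n))) \<longlonglongrightarrow> C * sqrt ((norm2 (lebesgue_on P) f)\<^sup>2)"
        using LIMSEQ_subseq_LIMSEQ[OF J(2) r] by (intro tendsto_intros) (simp add: o_def)
      moreover have "(\<lambda>n. \<bar>Lf (r n) \<phi>\<bar>) \<longlonglongrightarrow> \<bar>Lim f\<bar>"
        unfolding f by (intro tendsto_rabs Lim \<phi>)
      ultimately have "\<bar>Lim f\<bar> \<le> C * sqrt ((norm2 (lebesgue_on P) f)\<^sup>2)"
        using J(1) by (intro LIMSEQ_le[of "\<lambda>n. \<bar>Lf (r n) \<phi>\<bar>"]) auto
      then show ?thesis by simp
    qed
    fix g assume "g \<in> uncurry_test ` test_span"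
    then obtain \<psi> where \<psi>: "\<psi> \<in> test_span" and g: "g = uncurry_test \<psi>" by blast
    have add: "(\<lambda>x. f x + g x) = uncurry_test (\<lambda>a p. \<phi> a p + \<psi> a p)"
      by (simp add: f g uncurry_test_def[abs_def])
    show "(\<lambda>x. f x + g x) \<in> uncurry_test ` test_span"
      unfolding add by (intro imageI test_span.add \<phi> \<psi>)
    show "Lim (\<lambda>x. f x + g x) = Lim f + Lim g"
    proof (rule LIMSEQ_unique)
      show "(\<lambda>n. Lf (r n) (\<lambda>a p. \<phi> a p + \<psi> a p)) \<longlonglongrightarrow> Lim (\<lambda>x. f x + g x)"
        unfolding add by (intro Lim test_span.add \<phi> \<psi>)
      show "(\<lambda>n. Lf (r n) (\<lambda>a p. \<phi> a p + \<psi> a p)) \<longlonglongrightarrow> Lim f + Lim g"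
        unfolding Lf_add[OF test_span_test_space[OF \<phi>] test_span_test_space[OF \<psi>]] f g
        by (intro tendsto_add Lim \<phi> \<psi>)
    qed
  qed
  then obtain w where w: "sqint (lebesgue_on P) w"
    "\<And>\<phi>. \<phi> \<in> test_span \<Longrightarrow> (LINT x|lebesgue_on P. w x * uncurry_test \<phi> x) = Lim (uncurry_test \<phi>)"
    by blast
  \<comment> \<open>The representer is Lebesgue measurable only; its Borel version makes the nested
    integrals of the convergence statement accessible to \<open>test_uncurry\<close>.\<close>
  obtain v0 where v0b: "v0 \<in> borel_measurable borel" and wv: "AE x in lborel. x \<in> P \<longrightarrow> w x = v0 x"
    using lebesgue_on_borel_representative[OF Pb] w(1) by (auto simp: sqint_def)
  have wv': "AE x in lebesgue_on P. w x = v0 x" using wv Pb by (subst AE_lebesgue_on)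
  have v0m: "v0 \<in> borel_measurable (lebesgue_on P)"
    using v0b by (intro measurable_restrict_space1 measurable_completion) simp
  have v0: "sqint (lebesgue_on P) v0"
    unfolding sqint_def
  proof
    show "integrable (lebesgue_on P) (\<lambda>x. (v0 x)\<^sup>2)"
      by (rule integrable_cong_AE_imp[OF sqint_integrable[OF w(1)]])
         (use v0m wv' in \<open>auto elim: eventually_mono\<close>)
  qed (rule v0m)
  define R where "R \<phi> = (LINT q|lebesgue_on P. v0 q * uncurry_test \<phi> q)" for \<phi>
  have R_span: "R \<phi> = Lim (uncurry_test \<phi>)" if "\<phi> \<in> test_span" for \<phi>
  proof -
    have m: "uncurry_test \<phi> \<in> borel_measurable (lebesgue_on P)" "w \<in> borel_measurable (lebesgue_on P)"
      using test_uncurry(1)[OF test_span_test_space[OF that]] w(1) by (auto simp: sqint_def)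
    have "R \<phi> = (LINT x|lebesgue_on P. w x * uncurry_test \<phi> x)"
      unfolding R_def
      by (rule integral_cong_AE) (use m v0m wv' in \<open>auto intro!: borel_measurable_times elim: eventually_mono\<close>)
    with w(2)[OF that] show ?thesis by simp
  qed
  have R_int: "integrable (lebesgue_on P) (\<lambda>q. v0 q * uncurry_test \<phi> q)" if "\<phi> \<in> test_space ST" for \<phi>
    by (rule integrable_mult_sqint[OF v0 test_uncurry(1)[OF that]])
  have R_cmult: "R (\<lambda>a p. c * \<phi> a p) = c * R \<phi>" for c \<phi>
    by (simp add: R_def uncurry_test_def mult.left_commute[of _ c])
  have R_add: "R (\<lambda>a p. \<phi> a p + \<psi> a p) = R \<phi> + R \<psi>" if "\<phi> \<in> test_space ST" "\<psi> \<in> test_space ST" for \<phi> \<psi>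
    using R_int[OF that(1)] R_int[OF that(2)] by (simp add: R_def uncurry_test_def distrib_left)
  have R_diff: "R (\<lambda>a p. \<phi> a p - \<psi> a p) = R \<phi> - R \<psi>" if "\<phi> \<in> test_space ST" "\<psi> \<in> test_space ST" for \<phi> \<psi>
    using R_int[OF that(1)] R_int[OF that(2)] by (simp add: R_def uncurry_test_def right_diff_distrib)
  define K where "K = norm2 (lebesgue_on P) v0"
  have K: "0 \<le> K" by (simp add: K_def)
  have R_bound: "\<bar>R \<phi>\<bar> \<le> K * test_norm ST \<phi>" if "\<phi> \<in> test_space ST" for \<phi>
    unfolding R_def
    using norm2_Cauchy_Schwarz[OF v0 test_uncurry(1)[OF that]]
      mult_left_mono[OF test_uncurry(2)[OF that] K] by (simp add: K_def)
  \<comment> \<open>Membership is part of the statement because the density principle requires its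
    predicate to imply it.\<close>
  have main: "\<phi> \<in> test_space ST \<and> (\<lambda>n. Lf (r n) \<phi>) \<longlonglongrightarrow> R \<phi>" if "\<phi> \<in> test_space ST" for \<phi>
    using that
  proof (rule test_space_density_principle[rotated -1])
    fix f g assume f: "f \<in> test_space ST \<and> (\<lambda>n. Lf (r n) f) \<longlonglongrightarrow> R f"
      and g: "g \<in> test_space ST \<and> (\<lambda>n. Lf (r n) g) \<longlonglongrightarrow> R g"
    then show "(\<lambda>a p. f a p + g a p) \<in> test_space ST \<and>
        (\<lambda>n. Lf (r n) (\<lambda>a p. f a p + g a p)) \<longlonglongrightarrow> R (\<lambda>a p. f a p + g a p)"
      by (auto simp: Lf_add R_add intro: test_space_add[OF S] tendsto_add)
  next
    fix c f assume "f \<in> test_space ST \<and> (\<lambda>n. Lf (r n) f) \<longlonglongrightarrow> R f"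
    then show "(\<lambda>a p. c * f a p) \<in> test_space ST \<and> (\<lambda>n. Lf (r n) (\<lambda>a p. c * f a p)) \<longlonglongrightarrow> R (\<lambda>a p. c * f a p)"
      unfolding Lf_cmult R_cmult by (auto intro: test_space_cmult[OF S] tendsto_mult_left)
  next
    fix q j k c m n d
    have "(\<lambda>a p. indicator (quadrant q) a * trig_gen j k c m n d p) \<in> test_span" by (rule test_span.gen)
    then show "(\<lambda>a p. indicator (quadrant q) a * trig_gen j k c m n d p) \<in> test_space ST \<and>
      (\<lambda>i. Lf (r i) (\<lambda>a p. indicator (quadrant q) a * trig_gen j k c m n d p))
        \<longlonglongrightarrow> R (\<lambda>a p. indicator (quadrant q) a * trig_gen j k c m n d p)"
      using test_span_test_space Lim R_span by metis
  next
    fix f assume f: "f \<in> test_space ST"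
      and ap: "\<And>e. 0 < e \<Longrightarrow> \<exists>g. (g \<in> test_space ST \<and> (\<lambda>n. Lf (r n) g) \<longlonglongrightarrow> R g) \<and> test_norm ST (\<lambda>a p. f a p - g a p) < e"
    have "(\<lambda>n. Lf (r n) f) \<longlonglongrightarrow> R f"
    proof (rule LIMSEQ_I)
      fix e :: real assume e: "0 < e"
      \<comment> \<open>Replacing \<open>f\<close> by \<open>g\<close> costs at most
        \<open>C * \<delta>\<close> in \<open>Lf\<close> and \<open>K * \<delta>\<close> in
        \<open>R\<close>, together at most \<open>e / 2\<close>; the other half is left for the
        convergence at \<open>g\<close>.\<close>
      define \<delta> where "\<delta> = e / (2 * (C + K + 1))"
      have "0 < \<delta>" using e C K by (simp add: \<delta>_def)
      then obtain g where g: "g \<in> test_space ST" "(\<lambda>n. Lf (r n) g) \<longlonglongrightarrow> R g"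
        and fg: "test_norm ST (\<lambda>a p. f a p - g a p) < \<delta>" using ap by blast
      have tn: "0 \<le> test_norm ST (\<lambda>a p. f a p - g a p)" by (simp add: test_norm_norm2)
      have d: "(\<lambda>a p. f a p - g a p) \<in> test_space ST" by (rule test_space_diff[OF S f g(1)])
      obtain N where N: "\<And>n. n \<ge> N \<Longrightarrow> norm (Lf (r n) g - R g) < e / 2"
        using LIMSEQ_D[OF g(2), of "e / 2"] e by auto
      have small: "(C + K) * \<delta> \<le> e / 2"
      proof -
        have "(C + K) * \<delta> = e / 2 * ((C + K) / (C + K + 1))" by (simp add: \<delta>_def)
        also have "\<dots> \<le> e / 2 * 1" using e C K by (intro mult_left_mono) auto
        finally show ?thesis by simp
      qed
      have "norm (Lf (r n) f - R f) < e" if "n \<ge> N" for n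
      proof -
        have "\<bar>Lf (r n) f - Lf (r n) g\<bar> \<le> C * \<delta>"
          using order_trans[OF pairing_test(3)[OF d, of "r n"] mult_left_mono[OF less_imp_le[OF fg]]] C
          by (simp add: Lf_diff[OF f g(1)])
        moreover have "\<bar>R f - R g\<bar> \<le> K * \<delta>"
          using order_trans[OF R_bound[OF d] mult_left_mono[OF less_imp_le[OF fg] K]] by (simp add: R_diff[OF f g(1)])
        moreover have "\<bar>Lf (r n) f - R f\<bar> \<le> \<bar>Lf (r n) f - Lf (r n) g\<bar> + \<bar>Lf (r n) g - R g\<bar> + \<bar>R f - R g\<bar>"
          by (simp add: abs_if)
        moreover have "\<bar>Lf (r n) g - R g\<bar> < e / 2" "C * \<delta> + K * \<delta> \<le> e / 2"
          using N[OF that] small by (simp_all add: distrib_right)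
        ultimately show ?thesis
          unfolding real_norm_def by linarith
      qed
      then show "\<exists>N. \<forall>n\<ge>N. norm (Lf (r n) f - R f) < e" by blast
    qed
    with f show "f \<in> test_space ST \<and> (\<lambda>n. Lf (r n) f) \<longlonglongrightarrow> R f" by blast
  qed auto
  have "multiscale_converges h T (\<epsilon> \<circ> r) (v \<circ> r) v0"
    unfolding multiscale_converges_def
  proof
    fix \<phi> assume \<phi>: "\<phi> \<in> test_space ST"
    show "(\<lambda>n. 1 / (\<epsilon> \<circ> r) n *
         (LINT t|lebesgue_on {0<..<T}. LINT x|lebesgue_on (Omega_M h ((\<epsilon> \<circ> r) n)).
            (v \<circ> r) n t x *
            \<phi> (t, snd x) (t / (\<epsilon> \<circ> r) n, (fst x / (\<epsilon> \<circ> r) n, snd x / (\<epsilon> \<circ> r) n), snd x / ((\<epsilon> \<circ> r) n)\<^sup>2)))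
      \<longlonglongrightarrow>
         (LINT t|lebesgue_on {0<..<T}. LINT xb|lebesgue_on (Sigma_M h).
            LINT \<tau>|lebesgue_on T_cell. LINT y|lebesgue_on Y_cell. LINT z|lebesgue_on Z_cell.
              v0 (t, xb, \<tau>, y, z) * \<phi> (t, xb) (\<tau>, y, z))"
      using main[OF \<phi>] unfolding test_uncurry(3)[OF \<phi> v0b v0] R_def Lf_def pairing_val_def by simp
  qed
  with v0 r show ?thesis
    unfolding L2_space_sqint[symmetric] by blast
qed

end

theorem theorem1:
  fixes h T C :: real
    and \<epsilon> :: "nat \<Rightarrow> real"
    and v :: "nat \<Rightarrow> real \<Rightarrow> real \<times> real \<Rightarrow> real"
  assumes "h > 0" and "T > 0"
    and "\<And>n. \<epsilon> n > 0"
    and "\<epsilon> \<longlonglongrightarrow> 0"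
    and "\<And>n. \<exists>N::nat. h = real N * \<epsilon> n"
    and "\<And>n. v n \<in> bochner_L2 {0<..<T} (L2_space (Omega_M h (\<epsilon> n))) (L2_norm (Omega_M h (\<epsilon> n)))"
    and "C > 0"
    and "\<And>n. 1 / sqrt (\<epsilon> n) * bochner_L2_norm {0<..<T} (L2_norm (Omega_M h (\<epsilon> n))) (v n) \<le> C"
  shows "\<exists>v0 \<in> L2_space ({0<..<T} \<times> Sigma_M h \<times> T_cell \<times> Y_cell \<times> Z_cell).
           \<exists>r::nat \<Rightarrow> nat. strict_mono r \<and> multiscale_converges h T (\<epsilon> \<circ> r) (v \<circ> r) v0"
  using assms(3,4,6,7,8) by (rule multiscale_compactness)

end
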